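(* In addition to the standing assumptions (1)–(6) of the context, assume: (i) (translation invariance of the unperturbed dynamics) $S(t)(f\circ\tau_x)=(S(t)f)\circ\tau_x$ for any local function $f$, $x\in\mathbb Z^d$ and $t\ge0$; (ii) the stationary process with generator $L_{\rm env}$ (and initial distribution $\mu$) has finite speed of propagation with $\alpha(u)\le e^{-\theta u}$ for some $\theta>0$; (iii) $r,\hat r_\varepsilon$ have finite range: there exists $R>0$ such that $r(z,\cdot)\equiv0$ and $\hat r_\varepsilon(z,\cdot)\equiv0$ if $z\notin B(R)$, and such that the supports of $r(z,\cdot)$ and $\hat r_\varepsilon(z,\cdot)$ are included in $B(R)$ (i.e. these functions depend on $\eta$ only through $(\eta(x))_{x\in B(R)}$). Then there exists $\theta'>0$ (depending on $\varepsilon$ and $\gamma$) such that, for any local function $f:\Omega\to\mathbb R$ and all $x\in\mathbb Z^d$, $$|\mu_\varepsilon(\tau_xf)-\mu(f)|\le C(f,\varepsilon,\gamma)\,e^{-\theta'|x|_\infty},$$ where $C(f,\varepsilon,\gamma)$ is a finite constant depending only on $f,\varepsilon,\gamma$ (for the given model, and in particular not on $x$).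
   Context: $S$ is a compact Polish space, $\Omega=S^{\mathbb Z^d}$ with the product topology, $(\tau_x\eta)(y)=\eta(x+y)$, $\tau_xf:=f\circ\tau_x$. A local function is a bounded measurable function on $\Omega$ depending only on finitely many coordinates. $C(\Omega)$ is the space of real continuous functions with sup norm. For a measure $\nu$, $\nu(f)=\int f\,d\nu$. $\|\cdot\|$ is the norm of $L^2(\mu)$ and the associated operator norm. $B(R)=\{y\in\mathbb Z^d:|y|_\infty\le R\}$. Standing assumptions. (1) The dynamic random environment $(\sigma_t)_{t\ge0}$ is a Feller Markov process on $\Omega$ with càdlàg paths, stationary w.r.t. a probability measure $\mu$ which is translation invariant. $\mathbb E^{\rm env}_\mu$ is the expectation of the environment process started from $\mu$. $S_{\rm env}(t)$ is its semigroup on $L^2(\mu)$, with generator $L_{\rm env}$ of domain $\mathcal D(L_{\rm env})$; its generator on $C(\Omega)$ is $\mathcal L_{\rm env}$, with domain $\mathcal D(\mathcal L_{\rm env})$. (2) $S_{\rm env}(t)(f\circ\tau_x)=(S_{\rm env}(t)f)\circ\tau_x$ for all $f\in L^2(\mu)$, $t\ge0$, $x\in\mathbb Z^d$; and for some $\gamma>0$ the Poincaré inequality $\gamma\|f\|^2\le-\mu(fL_{\rm env}f)$ holds for all $f\in\mathcal D(L_{\rm env})$ with $\mu(f)=0$. (3) There are continuous functions $r_\varepsilon(y,\cdot),r(y,\cdot),\hat r_\varepsilon(y,\cdot)$ on $\Omega$, $y\in\mathbb Z^d$, which vanish for $y=0$, with $r_\varepsilon,r\ge0$ and $r_\varepsilon=r+\hat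 r_\varepsilon$, such that for some $n\ge1$: $\sum_y|y|^n\sup_\eta r(y,\eta)<\infty$ and $\sum_y|y|^n\sup_\eta|\hat r_\varepsilon(y,\eta)|<\infty$. The unperturbed walker $(X_t)$ on $\mathbb Z^d$ jumps from $x$ to $x+y$ at rate $r(y,\tau_x\eta)$ when the (autonomous) environment is in state $\eta$; the perturbed walker $(X^{(\varepsilon)}_t)$ is defined in the same way with $r_\varepsilon$ in place of $r$. (4) The environments seen from the walkers, $(\tau_{X_t}\sigma_t)_{t\ge0}$ and $(\tau_{X^{(\varepsilon)}_t}\sigma_t)_{t\ge0}$, are Feller processes on $\Omega$ with generators on $C(\Omega)$ given by $\mathcal L_{\rm env}+\mathcal L_{\rm jump}$ and $\mathcal L_{\rm env}+\mathcal L_{\rm jump}+\hat{\mathcal L}_\varepsilon$ respectively, both with domain $\mathcal D(\mathcal L_{\rm env})$, where $\mathcal L_{\rm jump}f(\eta)=\sum_yr(y,\eta)[f(\tau_y\eta)-f(\eta)]$ and $\hat{\mathcal L}_\varepsilon f(\eta)=\sum_y\hat r_\varepsilon(y,\eta)[f(\tau_y\eta)-f(\eta)]$. (5) $\mu$ is invariant for $(\tau_{X_t}\sigma_t)_{t\ge0}$. (6) The bounded operator $\hat L_\varepsilon$ on $L^2(\mu)$, $\hat L_\varepsilon f(\eta)=\sum_y\hat r_\varepsilon(y,\eta)[f(\tau_y\eta)-f(\eta)]$, has norm $\varepsilon:=\|\hat L_\varepsilon\|<\gamma$. Notation. $S(t)f(\eta)=\mathbb E_\eta[f(\eta_t)]$,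 where $\mathbb E_\eta$ is the expectation for the environment seen by the unperturbed walker, $\eta_t=\tau_{X_t}\sigma_t$, started from $\eta$. Under (1)–(6) there is a unique probability measure on $\Omega$ that is absolutely continuous w.r.t. $\mu$ and invariant for $(\tau_{X^{(\varepsilon)}_t}\sigma_t)_{t\ge0}$; it is denoted $\mu_\varepsilon$. Finite speed of propagation. The stationary environment process with generator $L_{\rm env}$ and initial distribution $\mu$ has finite speed of propagation if there exist a function $\alpha:\mathbb R_+\to\mathbb R_+$ with $\lim_{u\to\infty}\alpha(u)=0$ and a constant $C>0$ such that $|\mathbb E^{\rm env}_\mu[XY]-\mathbb E^{\rm env}_\mu[X]\mathbb E^{\rm env}_\mu[Y]|\le\alpha(d(\Lambda,\Lambda'))$ for any random variables $X,Y$ bounded in modulus by one and any sets $\Lambda,\Lambda'\subset\mathbb Z^d$ such that, for some $t\ge0$, $X$ is determined by $(\sigma_s(x):0\le s\le t,x\in\Lambda)$, $Y$ is determined by $(\sigma_s(x):0\le s\le t,x\in\Lambda')$, and $d(\Lambda,\Lambda')=\min\{|x-x'|_\infty:x\in\Lambda,x'\in\Lambda'\}\ge Ct$. *)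

theory Defs
  imports "HOL-Probability.Probability"
begin

text \<open>Sites are elements of \<^typ>\<open>int ^ 'd\<close>, configurations are functions
  \<^typ>\<open>int ^ 'd \<Rightarrow> 's\<close>, which carry the product topology and its Borel sigma-algebra.\<close>

definition norm_inf :: "int ^ 'd \<Rightarrow> real" where
  "norm_inf x = real_of_int (Max (range (\<lambda>i. \<bar>x $ i\<bar>)))"

definition sup_ball :: "real \<Rightarrow> (int ^ 'd) set" where
  "sup_ball R = {y. norm_inf y \<le> R}"

definition set_distance :: "(int ^ 'd) set \<Rightarrow> (int ^ 'd) set \<Rightarrow> real" where
  "set_distance A B = Inf {norm_inf (x - y) | x y. x \<in> A \<and> y \<in> B}"

definition translate :: "int ^ 'd \<Rightarrow> (int ^ 'd \<Rightarrow> 's) \<Rightarrow> int ^ 'd \<Rightarrow> 's" where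
  "translate x \<eta> y = \<eta> (x + y)"

definition depends_only_on :: "(('i \<Rightarrow> 's) \<Rightarrow> real) \<Rightarrow> 'i set \<Rightarrow> bool" where
  "depends_only_on f A \<longleftrightarrow> (\<forall>\<eta> \<zeta>. (\<forall>x\<in>A. \<eta> x = \<zeta> x) \<longrightarrow> f \<eta> = f \<zeta>)"

definition local_function :: "((int ^ 'd \<Rightarrow> 's::topological_space) \<Rightarrow> real) \<Rightarrow> bool" where
  "local_function f \<longleftrightarrow> f \<in> borel_measurable borel \<and> bounded (range f) \<and>
     (\<exists>A. finite A \<and> depends_only_on f A)"

text \<open>A process started from an arbitrary point is given by a measurable space \<open>M\<close>, a kernel \<open>P\<close>
  of probability measures on \<open>M\<close> (the law for each starting point) and a family
  \<open>Y t\<close>, \<open>t \<ge> 0\<close>, of maps on \<open>M\<close>. Values at negative times are irrelevant. The process started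
  from the distribution \<open>\<nu>\<close> lives on the probability space \<open>\<nu> \<bind> P\<close>.\<close>

definition cadlag :: "(real \<Rightarrow> 'a::topological_space) \<Rightarrow> bool" where
  "cadlag f \<longleftrightarrow> (\<forall>t\<ge>0. (f \<longlongrightarrow> f t) (at_right t)) \<and> (\<forall>t>0. \<exists>l. (f \<longlongrightarrow> l) (at_left t))"

definition events :: "'w set \<Rightarrow> 'i set \<Rightarrow> ('i \<Rightarrow> 'w \<Rightarrow> 'a::topological_space) \<Rightarrow> 'w set set" where
  "events W I Y = {Y i -` B \<inter> W | i B. i \<in> I \<and> B \<in> sets borel}"

definition transition ::
    "('a \<Rightarrow> 'w measure) \<Rightarrow> (real \<Rightarrow> 'w \<Rightarrow> 'a) \<Rightarrow> real \<Rightarrow> ('a \<Rightarrow> real) \<Rightarrow> 'a \<Rightarrow> real" where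
  "transition P Y t f \<eta> = (\<integral>w. f (Y t w) \<partial>P \<eta>)"

definition markov_process ::
    "'w measure \<Rightarrow> ('a::topological_space \<Rightarrow> 'w measure) \<Rightarrow> (real \<Rightarrow> 'w \<Rightarrow> 'a) \<Rightarrow> bool" where
  "markov_process M P Y \<longleftrightarrow>
     P \<in> borel \<rightarrow>\<^sub>M prob_algebra M \<and>
     (\<forall>t\<ge>0. Y t \<in> M \<rightarrow>\<^sub>M borel) \<and>
     (\<forall>\<eta>. AE w in P \<eta>. Y 0 w = \<eta>) \<and>
     (\<forall>\<eta> s t f A. 0 \<le> s \<longrightarrow> 0 \<le> t \<longrightarrow> f \<in> borel_measurable borel \<longrightarrow> bounded (range f) \<longrightarrow>
        A \<in> sigma_sets (space M) (events (space M) {0..s} Y) \<longrightarrow>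
        (\<integral>w\<in>A. f (Y (s + t) w) \<partial>P \<eta>) = (\<integral>w\<in>A. transition P Y t f (Y s w) \<partial>P \<eta>))"

text \<open>For a compact state space, where every continuous function is bounded and vanishes at infinity.\<close>

definition feller_process ::
    "'w measure \<Rightarrow> ('a::topological_space \<Rightarrow> 'w measure) \<Rightarrow> (real \<Rightarrow> 'w \<Rightarrow> 'a) \<Rightarrow> bool" where
  "feller_process M P Y \<longleftrightarrow> markov_process M P Y \<and>
     (\<forall>f. continuous_on UNIV f \<longrightarrow>
        (\<forall>t\<ge>0. continuous_on UNIV (transition P Y t f)) \<and>
        uniform_limit UNIV (\<lambda>t. transition P Y t f) f (at_right 0))"

definition invariant_measure ::
    "('a::topological_space \<Rightarrow> 'w measure) \<Rightarrow> (real \<Rightarrow> 'w \<Rightarrow> 'a) \<Rightarrow> 'a measure \<Rightarrow> bool" where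
  "invariant_measure P Y \<nu> \<longleftrightarrow> (\<forall>t\<ge>0. distr (\<nu> \<bind> P) borel (Y t) = \<nu>)"

text \<open>Generators are represented by their graphs.\<close>

definition C_generator ::
    "(real \<Rightarrow> ('a \<Rightarrow> real) \<Rightarrow> 'a \<Rightarrow> real) \<Rightarrow>
     (('a::topological_space \<Rightarrow> real) \<times> ('a \<Rightarrow> real)) set" where
  "C_generator S = {(f, g). continuous_on UNIV f \<and> continuous_on UNIV g \<and>
     uniform_limit UNIV (\<lambda>t \<eta>. (S t f \<eta> - f \<eta>) / t) g (at_right 0)}"

text \<open>Elements of \<open>L\<^sup>2(\<mu>)\<close> are represented by functions; equality in \<open>L\<^sup>2(\<mu>)\<close> is equality almost
  everywhere.\<close>

definition square_integrable :: "'a measure \<Rightarrow> ('a \<Rightarrow> real) \<Rightarrow> bool" where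
  "square_integrable \<mu> f \<longleftrightarrow> f \<in> borel_measurable \<mu> \<and> integrable \<mu> (\<lambda>\<eta>. (f \<eta>)\<^sup>2)"

definition L2_norm :: "'a measure \<Rightarrow> ('a \<Rightarrow> real) \<Rightarrow> real" where
  "L2_norm \<mu> f = sqrt (\<integral>\<eta>. (f \<eta>)\<^sup>2 \<partial>\<mu>)"

definition L2_operator_norm :: "'a measure \<Rightarrow> (('a \<Rightarrow> real) \<Rightarrow> 'a \<Rightarrow> real) \<Rightarrow> real" where
  "L2_operator_norm \<mu> T = Sup {L2_norm \<mu> (T f) | f. square_integrable \<mu> f \<and> L2_norm \<mu> f \<le> 1}"

definition L2_generator ::
    "'a measure \<Rightarrow> (real \<Rightarrow> ('a \<Rightarrow> real) \<Rightarrow> 'a \<Rightarrow> real) \<Rightarrow> (('a \<Rightarrow> real) \<times> ('a \<Rightarrow> real)) set" where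
  "L2_generator \<mu> S = {(f, g). square_integrable \<mu> f \<and> square_integrable \<mu> g \<and>
     ((\<lambda>t. L2_norm \<mu> (\<lambda>\<eta>. (S t f \<eta> - f \<eta>) / t - g \<eta>)) \<longlongrightarrow> 0) (at_right 0)}"

definition jump_operator ::
    "(int ^ 'd \<Rightarrow> (int ^ 'd \<Rightarrow> 's) \<Rightarrow> real) \<Rightarrow> ((int ^ 'd \<Rightarrow> 's) \<Rightarrow> real) \<Rightarrow> (int ^ 'd \<Rightarrow> 's) \<Rightarrow> real"
  where "jump_operator r f \<eta> = (\<Sum>\<^sub>\<infinity>y. r y \<eta> * (f (translate y \<eta>) - f \<eta>))"

text \<open>The walker \<open>X\<close> starts at the origin and, given the whole trajectory of the environment \<open>\<sigma>\<close>,
  is a time-inhomogeneous pure jump process which jumps from \<open>x\<close> to \<open>x + y\<close> at rate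
  \<open>r y (translate x (\<sigma> t))\<close> at time \<open>t\<close>. This is expressed by the martingale problem: for every bounded \<open>h\<close>,
  \<open>h (X t) - \<integral>\<^sub>0\<^sup>t \<Sum>y. r y (translate (X u) (\<sigma> u)) (h (X u + y) - h (X u)) du\<close> is a martingale for the
  filtration generated at time \<open>s\<close> by \<open>(\<sigma> u)\<close>, \<open>u \<ge> 0\<close>, and \<open>(X u)\<close>, \<open>u \<le> s\<close>. Having the
  entire environment in the filtration expresses that the environment is autonomous; with the
  filtration of the past only, simultaneous jumps of \<open>\<sigma>\<close> and \<open>X\<close> would not be excluded.\<close>

definition walker ::
    "'w measure \<Rightarrow> ((int ^ 'd \<Rightarrow> 's::topological_space) \<Rightarrow> 'w measure) \<Rightarrow>
     (real \<Rightarrow> 'w \<Rightarrow> int ^ 'd \<Rightarrow> 's) \<Rightarrow> (int ^ 'd \<Rightarrow> (int ^ 'd \<Rightarrow> 's) \<Rightarrow> real) \<Rightarrow>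
     (real \<Rightarrow> 'w \<Rightarrow> int ^ 'd) \<Rightarrow> bool" where
  "walker M P \<sigma> r X \<longleftrightarrow>
     (\<forall>t\<ge>0. X t \<in> M \<rightarrow>\<^sub>M borel) \<and>
     (\<forall>w\<in>space M. cadlag (\<lambda>t. X t w)) \<and>
     (\<forall>\<eta>. AE w in P \<eta>. X 0 w = 0) \<and>
     (\<forall>\<eta> s t A (h :: int ^ 'd \<Rightarrow> real). 0 \<le> s \<longrightarrow> s \<le> t \<longrightarrow> bounded (range h) \<longrightarrow>
        A \<in> sigma_sets (space M) (events (space M) {0..} \<sigma> \<union> events (space M) {0..s} X) \<longrightarrow>
        (\<integral>w\<in>A. (h (X t w) - h (X s w)) \<partial>P \<eta>) =
        (\<integral>w\<in>A. (\<integral>u\<in>{s..t}. (\<Sum>\<^sub>\<infinity>y. r y (translate (X u w) (\<sigma> u w)) * (h (X u w + y) - h (X u w)))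
           \<partial>lborel) \<partial>P \<eta>))"

definition seen_from ::
    "(real \<Rightarrow> 'w \<Rightarrow> int ^ 'd) \<Rightarrow> (real \<Rightarrow> 'w \<Rightarrow> int ^ 'd \<Rightarrow> 's) \<Rightarrow> real \<Rightarrow> 'w \<Rightarrow> int ^ 'd \<Rightarrow> 's" where
  "seen_from X \<sigma> t w = translate (X t w) (\<sigma> t w)"

text \<open>\<open>Q\<close> is the law under which the environment is stationary. The sets are taken nonempty so that
  their distance is a minimum.\<close>

definition finite_speed ::
    "'w measure \<Rightarrow> (real \<Rightarrow> 'w \<Rightarrow> int ^ 'd \<Rightarrow> 's::topological_space) \<Rightarrow> (real \<Rightarrow> real) \<Rightarrow> bool" where
  "finite_speed Q \<sigma> \<alpha> \<longleftrightarrow>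
     (\<forall>u\<ge>0. \<alpha> u \<ge> 0) \<and> (\<alpha> \<longlongrightarrow> 0) at_top \<and>
     (\<exists>C>0. \<forall>t\<ge>0. \<forall>\<Lambda> \<Lambda>' X Y.
        \<Lambda> \<noteq> {} \<longrightarrow> \<Lambda>' \<noteq> {} \<longrightarrow> set_distance \<Lambda> \<Lambda>' \<ge> C * t \<longrightarrow>
        X \<in> borel_measurable (sigma (space Q) (events (space Q) ({0..t} \<times> \<Lambda>) (\<lambda>(s, x) w. \<sigma> s w x))) \<longrightarrow>
        Y \<in> borel_measurable (sigma (space Q) (events (space Q) ({0..t} \<times> \<Lambda>') (\<lambda>(s, x) w. \<sigma> s w x))) \<longrightarrow>
        (\<forall>w\<in>space Q. \<bar>X w\<bar> \<le> 1) \<longrightarrow> (\<forall>w\<in>space Q. \<bar>Y w\<bar> \<le> 1) \<longrightarrow>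
        \<bar>(\<integral>w. X w * Y w \<partial>Q) - (\<integral>w. X w \<partial>Q) * (\<integral>w. Y w \<partial>Q)\<bar> \<le> \<alpha> (set_distance \<Lambda> \<Lambda>'))"

end

theory Submission
  imports Defs
begin

text \<open>The idea is to let time decouple the walker from its starting environment and to let the finite
  speed of propagation keep a far away observable independent of the walker for that long.

  Write \<open>Y\<^sub>t\<close> for the environment seen from the perturbed walker. Two facts are played against each other
  at a time \<open>t\<close> proportional to the distance of \<open>x\<close> from the origin.

  First, the law of \<open>Y\<^sub>t\<close> started from \<open>\<mu>\<close> is within \<open>O(exp (- c t))\<close> of \<open>\<mu>\<^sub>\<epsilon>\<close> in total variation, where
  \<open>c > 0\<close> is at most the spectral gap minus the norm of the perturbation (\<open>perturbed_feller.relaxation\<close>).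
  Differentiating the \<open>\<mu>\<close>-variance of \<open>S\<^sub>\<epsilon>(t) f\<close>, the environment contributes at most \<open>- 2 \<gamma>\<close> times the
  variance by the Poincare inequality, the unperturbed jumps contribute a nonpositive quantity because \<open>\<mu>\<close>
  is invariant for them, and the perturbation at most \<open>2 \<epsilon>\<close> times the variance. So the variance decays
  exponentially. The \<open>\<mu>\<close>-mean of \<open>S\<^sub>\<epsilon>(t) f\<close> is moved by the perturbation only, at a speed bounded by the
  standard deviation, so it converges at the same rate, and absolute continuity identifies the limit as
  \<open>\<mu>\<^sub>\<epsilon>(f)\<close>. This happens for continuous functions, but it bounds the total variation distance, and local
  functions are merely measurable.

  Second, for the walker started from \<open>\<mu>\<close> the observable \<open>f(\<tau>\<^sub>x Y\<^sub>t)\<close> has almost the same mean as under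
  \<open>\<mu>\<close> (\<open>environment_walk.far_observable_decorrelates\<close>). Given the environment path, the position of the
  walker is a jump process with known rates, and iterating Dynkin's formula expresses
  the mean of \<open>f(\<tau>\<^sub>x Y\<^sub>t)\<close> by means of products of two factors: a coefficient that collects the jump rates of
  the first \<open>j\<close> steps, and a translate of \<open>f\<close> (\<open>environment_walk.dyson_expansion\<close>). The coefficient
  depends on the environment up to time \<open>t\<close> within distance \<open>j R\<close> of the origin, the translate on the
  environment at time \<open>t\<close> near \<open>x\<close>, so that finite speed of propagation factorises the mean of their
  product. For centred \<open>f\<close> nothing but an exponentially small error is left, and
  the remainder after \<open>n\<close> steps is of order \<open>(N t)\<^sup>n / n!\<close> with a bound \<open>N\<close> on the jump rates.

  Choosing \<open>n\<close> and \<open>t\<close> as small multiples of the distance makes all errors exponentially small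
  in it (\<open>choice_of_scales\<close>).\<close>

section \<open>Contraction semigroups on Banach spaces\<close>

locale contraction_semigroup =
  fixes T :: "real \<Rightarrow> 'a::banach \<Rightarrow> 'a"
  assumes linear: "t \<ge> 0 \<Longrightarrow> linear (T t)"
    and contraction: "t \<ge> 0 \<Longrightarrow> norm (T t f) \<le> norm f"
    and T_0: "T 0 f = f"
    and semigroup: "s \<ge> 0 \<Longrightarrow> t \<ge> 0 \<Longrightarrow> T (s + t) f = T s (T t f)"
    and right_continuous: "((\<lambda>t. T t f) \<longlongrightarrow> f) (at_right 0)"
begin

definition generates :: "'a \<Rightarrow> 'a \<Rightarrow> bool" where
  "generates f g \<longleftrightarrow> ((\<lambda>t. (T t f - f) /\<^sub>R t) \<longlongrightarrow> g) (at_right 0)"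

lemma bounded_linear: "t \<ge> 0 \<Longrightarrow> bounded_linear (T t)"
  using linear contraction
  by (intro bounded_linear_intro[where K = 1]) (auto simp: linear_add linear_scale)

lemma small_times_right_continuous:
  assumes "e > 0"
  shows "\<exists>d>0. \<forall>h. 0 \<le> h \<and> h < d \<longrightarrow> norm (T h f - f) < e"
proof -
  have "\<forall>\<^sub>F h in at_right 0. dist (T h f) f < e"
    using right_continuous assms by (rule tendstoD)
  then obtain d where "d > 0" and d: "\<And>h. h > 0 \<Longrightarrow> h < d \<Longrightarrow> dist (T h f) f < e"
    by (auto simp: eventually_at_right_field)
  then have "norm (T h f - f) < e" if "0 \<le> h" "h < d" for h
    using that assms T_0[of f] d[of h] by (cases "h = 0") (auto simp: dist_norm)
  then show ?thesis
    using \<open>d > 0\<close> by blast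
qed

lemma continuous_on_orbit: "continuous_on {0..} (\<lambda>t. T t f)"
proof -
  have increment: "norm (T t f - T s f) \<le> norm (T (t - s) f - f)" if "0 \<le> s" "s \<le> t" for s t
  proof -
    have "T t f = T s (T (t - s) f)"
      using semigroup[of s "t - s" f] that by simp
    then have "T t f - T s f = T s (T (t - s) f - f)"
      using that linear_diff[OF linear] by simp
    then show ?thesis
      using contraction that by simp
  qed
  show ?thesis
    unfolding continuous_on_iff
  proof (intro ballI allI impI)
    fix t e :: real
    assume "t \<in> {0..}" "0 < e"
    then obtain d where "d > 0" and d: "\<And>h. 0 \<le> h \<Longrightarrow> h < d \<Longrightarrow> norm (T h f - f) < e"
      using small_times_right_continuous by blast
    have "dist (T s f) (T t f) < e" if "s \<in> {0..}" "dist s t < d" for s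
      using that \<open>t \<in> {0..}\<close> increment[of s t] increment[of t s] d[of "t - s"] d[of "s - t"]
      by (cases "s \<le> t") (auto simp: dist_norm norm_minus_commute)
    then show "\<exists>d>0. \<forall>s\<in>{0..}. dist s t < d \<longrightarrow> dist (T s f) (T t f) < e"
      using \<open>d > 0\<close> by blast
  qed
qed

lemma generates_orbit:
  assumes "generates f g" "t \<ge> 0"
  shows "generates (T t f) (T t g)"
proof -
  have "((\<lambda>h. T t ((T h f - f) /\<^sub>R h)) \<longlongrightarrow> T t g) (at_right 0)"
    using assms bounded_linear.tendsto[OF bounded_linear] unfolding generates_def by blast
  moreover have "\<forall>\<^sub>F h in at_right 0. T t ((T h f - f) /\<^sub>R h) = (T h (T t f) - T t f) /\<^sub>R h"
  proof (rule eventually_at_rightI[of 0 1])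
    fix h :: real
    assume "h \<in> {0<..<1}"
    moreover from this have "T t (T h f) = T h (T t f)"
      using assms semigroup[of t h f] semigroup[of h t f] by (simp add: add.commute)
    ultimately show "T t ((T h f - f) /\<^sub>R h) = (T h (T t f) - T t f) /\<^sub>R h"
      using assms linear[of t] by (simp add: linear_scale linear_diff)
  qed simp
  ultimately show ?thesis
    unfolding generates_def by (rule Lim_transform_eventually)
qed

lemma generates_scale:
  assumes "generates f g"
  shows "generates (c *\<^sub>R f) (c *\<^sub>R g)"
proof -
  have "((\<lambda>t. c *\<^sub>R ((T t f - f) /\<^sub>R t)) \<longlongrightarrow> c *\<^sub>R g) (at_right 0)"
    using assms unfolding generates_def by (intro tendsto_intros)
  moreover have "\<forall>\<^sub>F t in at_right 0. c *\<^sub>R ((T t f - f) /\<^sub>R t) = (T t (c *\<^sub>R f) - c *\<^sub>R f) /\<^sub>R t"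
    using linear by (intro eventually_at_rightI[of 0 1]) (auto simp: linear_scale algebra_simps)
  ultimately show ?thesis
    unfolding generates_def by (rule Lim_transform_eventually)
qed

text \<open>The generator gives the right derivative of an orbit by definition. The left derivative is
  obtained by restarting the orbit at the earlier of the two times, where it has to be compared
  with a generator value that has moved by \<^term>\<open>T h g - g\<close>.\<close>

lemma orbit_has_vector_derivative:
  assumes "generates f g" "t \<ge> 0"
  shows "((\<lambda>t. T t f) has_vector_derivative T t g) (at t within {0..})"
  unfolding has_vector_derivative_def has_derivative_within_alt
proof (intro conjI allI impI)
  show "bounded_linear (\<lambda>s. s *\<^sub>R T t g)"
    by (rule bounded_linear_scaleR_left)
  fix e :: real
  assume "e > 0"
  then have "\<forall>\<^sub>F h in at_right 0. dist ((T h f - f) /\<^sub>R h) g < e / 2"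
    using assms(1) unfolding generates_def by (intro tendstoD) auto
  then obtain d1 where "d1 > 0"
    and "\<And>h. h > 0 \<Longrightarrow> h < d1 \<Longrightarrow> dist ((T h f - f) /\<^sub>R h) g < e / 2"
    by (auto simp: eventually_at_right_field)
  then have quotient: "norm ((T h f - f) - h *\<^sub>R g) \<le> e / 2 * h" if "h > 0" "h < d1" for h
  proof -
    have "(T h f - f) - h *\<^sub>R g = h *\<^sub>R ((T h f - f) /\<^sub>R h - g)"
      using that by (simp add: scaleR_right_diff_distrib)
    also have "norm \<dots> = h * dist ((T h f - f) /\<^sub>R h) g"
      using that by (simp add: dist_norm)
    also have "\<dots> \<le> h * (e / 2)"
      using that \<open>\<And>h. h > 0 \<Longrightarrow> h < d1 \<Longrightarrow> dist ((T h f - f) /\<^sub>R h) g < e / 2\<close>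
      by (intro mult_left_mono) (auto simp: less_imp_le)
    finally show ?thesis
      by (simp add: mult.commute)
  qed
  obtain d2 where "d2 > 0" and d2: "\<And>h. 0 \<le> h \<Longrightarrow> h < d2 \<Longrightarrow> norm (T h g - g) < e / 2"
    using small_times_right_continuous[of "e / 2" g] \<open>e > 0\<close> by auto
  have "norm (T s f - T t f - (s - t) *\<^sub>R T t g) \<le> e * norm (s - t)"
    if "s \<in> {0..}" "norm (s - t) < min d1 d2" for s
  proof (cases s t rule: linorder_cases)
    case less
    define h where "h = t - s"
    have h: "0 < h" "h < d1" "h < d2" "0 \<le> s"
      using less that by (auto simp: h_def)
    have t: "t = h + s"
      by (simp add: h_def)
    have shift: "T t k = T s (T h k)" for k
      using semigroup[of s h k] h by (simp add: h_def)
    have "T s f - T t f - (s - t) *\<^sub>R T t g = T s (h *\<^sub>R (T h g - g) - (T h f - f - h *\<^sub>R g))"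
      unfolding shift linear_diff[OF linear[OF h(4)]] linear_scale[OF linear[OF h(4)]]
      by (simp add: t algebra_simps)
    then have "norm (T s f - T t f - (s - t) *\<^sub>R T t g)
        \<le> norm (h *\<^sub>R (T h g - g) - (T h f - f - h *\<^sub>R g))"
      using contraction h by simp
    also have "\<dots> \<le> norm (h *\<^sub>R (T h g - g)) + norm (T h f - f - h *\<^sub>R g)"
      by (rule norm_triangle_ineq4)
    also have "\<dots> \<le> h * (e / 2) + e / 2 * h"
      using quotient[of h] d2[of h] h by (intro add_mono) (auto intro!: mult_left_mono)
    finally show ?thesis
      using h by (simp add: h_def algebra_simps)
  next
    case equal
    then show ?thesis by simp
  next
    case greater
    define h where "h = s - t"
    have h: "0 < h" "h < d1"
      using greater that by (auto simp: h_def)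
    have "T s f = T t (T h f)"
      using semigroup[of t h f] h assms(2) by (simp add: h_def)
    then have "T s f - T t f - (s - t) *\<^sub>R T t g = T t (T h f - f - h *\<^sub>R g)"
      using linear[OF assms(2)] by (simp add: linear_diff linear_scale h_def)
    then have "norm (T s f - T t f - (s - t) *\<^sub>R T t g) \<le> e / 2 * h"
      using contraction[OF assms(2)] quotient[OF h] by (metis order_trans)
    also have "\<dots> \<le> e * norm (s - t)"
      using h \<open>e > 0\<close> by (simp add: h_def)
    finally show ?thesis .
  qed
  then show "\<exists>d>0. \<forall>s\<in>{0..}. norm (s - t) < d \<longrightarrow>
      norm (T s f - T t f - (s - t) *\<^sub>R T t g) \<le> e * norm (s - t)"
    using \<open>d1 > 0\<close> \<open>d2 > 0\<close> by (intro exI[of _ "min d1 d2"]) auto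
qed

text \<open>The averages of an orbit over a short time interval lie in the domain of the generator,
  by the fundamental theorem of calculus, and approximate the starting point of the orbit.\<close>

lemma dense_domain:
  assumes "e > 0"
  shows "\<exists>f' g'. generates f' g' \<and> norm (f' - f) < e"
proof -
  define F where "F t = integral {0..t} (\<lambda>s. T s f)" for t
  have continuous: "continuous_on {a..b} (\<lambda>s. T s f)" if "a \<ge> 0" for a b
    using continuous_on_orbit by (rule continuous_on_subset) (use that in auto)
  have F_derivative: "(F has_vector_derivative T u f) (at_right u)" if "u \<ge> 0" for u
  proof -
    have "(F has_vector_derivative T u f) (at u within {0..u + 1})"
      unfolding F_def using that continuous by (intro integral_has_vector_derivative) auto
    then have "(F has_vector_derivative T u f) (at u within {u..u + 1})"
      by (rule has_vector_derivative_within_subset) (use that in auto)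
    then show ?thesis
      using at_within_Icc_at_right[of u "u + 1"] by simp
  qed
  have F_quotient: "((\<lambda>h. (F (u + h) - F u) /\<^sub>R h) \<longlongrightarrow> T u f) (at_right 0)" if "u \<ge> 0" for u
  proof -
    have "((\<lambda>s. (F s - F u) /\<^sub>R (s - u)) \<longlongrightarrow> T u f) (at_right u)"
    proof (rule LIM_zero_cancel)
      have "((\<lambda>s. ((F s - F u) - (s - u) *\<^sub>R T u f) /\<^sub>R norm (s - u)) \<longlongrightarrow> 0) (at_right u)"
        using F_derivative[OF that] unfolding has_vector_derivative_def has_derivative_at_within
        by blast
      moreover have "\<forall>\<^sub>F s in at_right u. ((F s - F u) - (s - u) *\<^sub>R T u f) /\<^sub>R norm (s - u) =
          (F s - F u) /\<^sub>R (s - u) - T u f"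
      proof (rule eventually_at_rightI[of u "u + 1"])
        fix s assume "s \<in> {u<..<u + 1}"
        then show "((F s - F u) - (s - u) *\<^sub>R T u f) /\<^sub>R norm (s - u) =
            (F s - F u) /\<^sub>R (s - u) - T u f"
          by (simp add: scaleR_diff_right[of _ "F s - F u"])
      qed simp
      ultimately show "((\<lambda>s. (F s - F u) /\<^sub>R (s - u) - T u f) \<longlongrightarrow> 0) (at_right u)"
        by (rule Lim_transform_eventually)
    qed
    then show ?thesis
      by (subst (asm) at_right_to_0) (simp add: filterlim_filtermap add.commute)
  qed
  have T_F: "T t (F h) = F (h + t) - F t" if "t \<ge> 0" "h \<ge> 0" for t h
  proof -
    have "T t (F h) = integral {0..h} (\<lambda>s. T t (T s f))"
      unfolding F_def
      using integral_linear[OF integrable_continuous_real[OF continuous] bounded_linear] that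
      by (simp add: o_def)
    also have "\<dots> = integral {0..h} ((\<lambda>s. T s f) \<circ> (+) t)"
      by (rule integral_cong) (simp add: semigroup[OF that(1)])
    also have "\<dots> = integral {0 + t..h + t} (\<lambda>s. T s f)"
      by (rule integral_shift_Icc_real)
    also have "\<dots> = F (h + t) - F t"
      unfolding F_def
      using Henstock_Kurzweil_Integration.integral_combine[of 0 t "h + t" "\<lambda>s. T s f"] that
        integrable_continuous_real[OF continuous] by (simp add: algebra_simps)
    finally show ?thesis .
  qed
  have F_0: "F 0 = 0"
    by (simp add: F_def)
  have generates_F: "generates (F h) (T h f - f)" if "h \<ge> 0" for h
  proof -
    have "((\<lambda>t. (F (h + t) - F h) /\<^sub>R t - (F (0 + t) - F 0) /\<^sub>R t) \<longlongrightarrow> T h f - T 0 f) (at_right 0)"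
      using that by (intro tendsto_diff F_quotient) auto
    moreover have "\<forall>\<^sub>F t in at_right 0. (F (h + t) - F h) /\<^sub>R t - (F (0 + t) - F 0) /\<^sub>R t =
        (T t (F h) - F h) /\<^sub>R t"
      using that by (intro eventually_at_rightI[of 0 1])
        (auto simp: T_F F_0 algebra_simps)
    ultimately show ?thesis
      unfolding generates_def by (simp add: T_0 tendsto_cong)
  qed
  have "((\<lambda>h. F h /\<^sub>R h) \<longlongrightarrow> f) (at_right 0)"
    using F_quotient[of 0] by (simp add: F_0 T_0)
  then have "\<forall>\<^sub>F h in at_right 0. dist (F h /\<^sub>R h) f < e"
    using assms by (rule tendstoD)
  then have "\<forall>\<^sub>F h in at_right 0. dist (F h /\<^sub>R h) f < e \<and> h > 0"
    using eventually_at_right_less by (rule eventually_conj)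
  then obtain h where "h > 0" and close: "dist (F h /\<^sub>R h) f < e"
    using eventually_happens'[of "at_right (0::real)"] by auto
  have "generates (F h /\<^sub>R h) ((T h f - f) /\<^sub>R h)"
    using generates_scale[OF generates_F] \<open>h > 0\<close> by simp
  then show ?thesis
    using close by (auto simp: dist_norm)
qed

end

section \<open>Feller processes\<close>

lemma (in prob_space) abs_integral_le:
  fixes f :: "'a \<Rightarrow> real"
  assumes "integrable M f" "\<And>x. x \<in> space M \<Longrightarrow> \<bar>f x\<bar> \<le> b"
  shows "\<bar>\<integral>x. f x \<partial>M\<bar> \<le> b"
proof -
  have "\<bar>\<integral>x. f x \<partial>M\<bar> \<le> (\<integral>x. \<bar>f x\<bar> \<partial>M)"
    by (rule integral_abs_bound)
  also have "\<dots> \<le> b"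
    using assms by (intro integral_le_const) auto
  finally show ?thesis .
qed

lemma integral_bind_kernel:
  fixes f :: "'b \<Rightarrow> real"
  assumes "prob_space L" "K \<in> L \<rightarrow>\<^sub>M prob_algebra N" "f \<in> borel_measurable N"
    and "\<And>x. x \<in> space N \<Longrightarrow> \<bar>f x\<bar> \<le> b"
  shows "(\<integral>x. f x \<partial>(L \<bind> K)) = (\<integral>x. (\<integral>y. f y \<partial>K x) \<partial>L)"
proof -
  interpret L: prob_space L by fact
  have K: "K \<in> L \<rightarrow>\<^sub>M subprob_algebra N"
    using assms(2) by (rule measurable_prob_algebraD)
  have subprob: "AE M' in distr L (subprob_algebra N) K. emeasure M' (space M') \<le> ennreal 1"
    using K by (auto intro!: AE_I2 subprob_space.emeasure_space_le_1 simp: space_subprob_algebra)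
  have "(\<integral>x. f x \<partial>(L \<bind> K)) = (\<integral>M'. integral\<^sup>L M' f \<partial>distr L (subprob_algebra N) K)"
    unfolding bind_nonempty''[OF K L.not_empty]
    using assms(3,4) L.finite_measure_distr[OF K] subprob
    by (intro integral_join[where B = b and B' = 1]) auto
  also have "\<dots> = (\<integral>x. (\<integral>y. f y \<partial>K x) \<partial>L)"
    using K assms(3) by (intro integral_distr) auto
  finally show ?thesis .
qed

subsection \<open>Transition operators\<close>

locale markov =
  fixes M :: "'w measure" and P :: "'a::polish_space \<Rightarrow> 'w measure" and Y :: "real \<Rightarrow> 'w \<Rightarrow> 'a"
  assumes markov: "markov_process M P Y"
begin

lemma kernel [measurable]: "P \<in> borel \<rightarrow>\<^sub>M prob_algebra M"
  using markov by (simp add: markov_process_def)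

lemma Y_measurable: "t \<ge> 0 \<Longrightarrow> Y t \<in> M \<rightarrow>\<^sub>M borel"
  using markov by (simp add: markov_process_def)

lemma prob_space_P: "prob_space (P \<eta>)" and sets_P [measurable_cong]: "sets (P \<eta>) = sets M"
  using measurable_space[OF kernel, of \<eta>] by (auto simp: space_prob_algebra)

lemma space_P: "space (P \<eta>) = space M"
  using sets_P by (rule sets_eq_imp_space_eq)

lemma integrable_Y:
  fixes f :: "'a \<Rightarrow> real"
  assumes "f \<in> borel_measurable borel" "\<And>\<eta>. \<bar>f \<eta>\<bar> \<le> b" "t \<ge> 0"
  shows "integrable (P \<eta>) (\<lambda>w. f (Y t w))"
proof -
  interpret prob_space "P \<eta>" by (rule prob_space_P)
  note [measurable] = Y_measurable[OF assms(3)] assms(1)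
  show ?thesis
    using assms by (intro integrable_const_bound[where B = b]) auto
qed

lemma transition_bounded:
  assumes "f \<in> borel_measurable borel" "\<And>\<eta>. \<bar>f \<eta>\<bar> \<le> b" "t \<ge> 0"
  shows "\<bar>transition P Y t f \<eta>\<bar> \<le> b"
  unfolding transition_def
  using integrable_Y[OF assms] assms(2) by (intro prob_space.abs_integral_le[OF prob_space_P])

lemma transition_const: "transition P Y t (\<lambda>_. c) = (\<lambda>_. c)"
  using prob_space.prob_space[OF prob_space_P] by (auto simp: transition_def)

lemma transition_linear:
  assumes "f \<in> borel_measurable borel" "\<And>\<eta>. \<bar>f \<eta>\<bar> \<le> b"
    and "g \<in> borel_measurable borel" "\<And>\<eta>. \<bar>g \<eta>\<bar> \<le> b'" "t \<ge> 0"
  shows "transition P Y t (\<lambda>\<eta>. f \<eta> + g \<eta>) \<eta> = transition P Y t f \<eta> + transition P Y t g \<eta>"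
    and "transition P Y t (\<lambda>\<eta>. f \<eta> - g \<eta>) \<eta> = transition P Y t f \<eta> - transition P Y t g \<eta>"
  using integrable_Y[OF assms(1,2,5), of \<eta>] integrable_Y[OF assms(3,4,5), of \<eta>]
  by (simp_all add: transition_def)

lemma transition_scale: "transition P Y t (\<lambda>\<eta>. c * f \<eta>) \<eta> = c * transition P Y t f \<eta>"
  by (simp add: transition_def)

lemma transition_0:
  assumes [measurable]: "f \<in> borel_measurable borel"
  shows "transition P Y 0 f = f"
proof
  fix \<eta>
  interpret prob_space "P \<eta>" by (rule prob_space_P)
  have "AE w in P \<eta>. Y 0 w = \<eta>"
    using markov by (simp add: markov_process_def)
  then have AE: "AE w in P \<eta>. f (Y 0 w) = f \<eta>"
    by eventually_elim simp
  note [measurable] = Y_measurable[of 0]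
  have "(\<integral>w. f (Y 0 w) \<partial>P \<eta>) = (\<integral>w. f \<eta> \<partial>P \<eta>)"
    by (rule integral_cong_AE) (use AE in auto)
  then show "transition P Y 0 f \<eta> = f \<eta>"
    by (simp add: transition_def prob_space)
qed

lemma chapman_kolmogorov:
  assumes "f \<in> borel_measurable borel" "\<And>\<eta>. \<bar>f \<eta>\<bar> \<le> b" "s \<ge> 0" "t \<ge> 0"
  shows "transition P Y (s + t) f \<eta> = transition P Y s (transition P Y t f) \<eta>"
proof -
  have "bounded (range f)"
    using assms(2) by (auto simp: bounded_iff)
  moreover have "space M \<in> sigma_sets (space M) (events (space M) {0..s} Y)"
    by (rule sigma_sets_top)
  ultimately have "(\<integral>w\<in>space M. f (Y (s + t) w) \<partial>P \<eta>)
      = (\<integral>w\<in>space M. transition P Y t f (Y s w) \<partial>P \<eta>)"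
    using markov assms(1,3,4) unfolding markov_process_def by blast
  moreover have "(\<integral>w\<in>space M. h w \<partial>P \<eta>) = (\<integral>w. h w \<partial>P \<eta>)" for h :: "'w \<Rightarrow> real"
    unfolding set_lebesgue_integral_def
    by (rule Bochner_Integration.integral_cong) (auto simp: space_P)
  ultimately show ?thesis
    by (simp add: transition_def)
qed

context
  fixes \<nu> :: "'a measure"
  assumes \<nu>: "prob_space \<nu>" "sets \<nu> = sets borel"
begin

lemma prob_space_start: "prob_space (\<nu> \<bind> P)"
  and sets_start: "sets (\<nu> \<bind> P) = sets M"
proof -
  have P: "P \<in> \<nu> \<rightarrow>\<^sub>M prob_algebra M"
    using kernel \<nu>(2) by (simp cong: measurable_cong_sets)
  show "prob_space (\<nu> \<bind> P)"
    using \<nu> P by (intro prob_space_bind'[OF _ P]) (auto simp: space_prob_algebra)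
  show "sets (\<nu> \<bind> P) = sets M"
    using prob_space.not_empty[OF \<nu>(1)] by (intro sets_bind) (auto simp: sets_P)
qed

lemma integral_start:
  fixes f :: "'w \<Rightarrow> real"
  assumes "f \<in> borel_measurable M" "\<And>w. w \<in> space M \<Longrightarrow> \<bar>f w\<bar> \<le> b"
  shows "(\<integral>w. f w \<partial>(\<nu> \<bind> P)) = (\<integral>\<eta>. (\<integral>w. f w \<partial>P \<eta>) \<partial>\<nu>)"
proof (rule integral_bind_kernel[OF \<nu>(1) _ assms])
  show "P \<in> \<nu> \<rightarrow>\<^sub>M prob_algebra M"
    using kernel \<nu>(2) by (simp cong: measurable_cong_sets)
qed

lemma integral_transition:
  assumes "f \<in> borel_measurable borel" "\<And>\<eta>. \<bar>f \<eta>\<bar> \<le> b" "t \<ge> 0"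
  shows "(\<integral>w. f (Y t w) \<partial>(\<nu> \<bind> P)) = (\<integral>\<eta>. transition P Y t f \<eta> \<partial>\<nu>)"
  unfolding transition_def
  using assms Y_measurable by (intro integral_start[where b = b]) (auto intro: measurable_compose)

lemma integral_invariant:
  assumes "invariant_measure P Y \<nu>"
    and "f \<in> borel_measurable borel" "\<And>\<eta>. \<bar>f \<eta>\<bar> \<le> b" "t \<ge> 0"
  shows "(\<integral>\<eta>. transition P Y t f \<eta> \<partial>\<nu>) = (\<integral>\<eta>. f \<eta> \<partial>\<nu>)"
proof -
  have "(\<integral>\<eta>. f \<eta> \<partial>\<nu>) = (\<integral>\<eta>. f \<eta> \<partial>distr (\<nu> \<bind> P) borel (Y t))"
    using assms(1,4) by (simp add: invariant_measure_def)
  also have "\<dots> = (\<integral>w. f (Y t w) \<partial>(\<nu> \<bind> P))"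
    using assms Y_measurable sets_start
    by (intro integral_distr) (auto cong: measurable_cong_sets)
  finally show ?thesis
    using integral_transition[OF assms(2-4)] by simp
qed

end

end

subsection \<open>The Feller semigroup\<close>

instance bcontfun :: (metric_space, banach) banach ..

lemma continuous_bounds:
  fixes f :: "'a::metric_space \<Rightarrow>\<^sub>C real"
  shows "apply_bcontfun f \<in> borel_measurable borel" "\<And>\<eta>. \<bar>f \<eta>\<bar> \<le> norm f"
  using norm_bounded[of f] by (auto intro: borel_measurable_continuous_onI)

lemma integrable_continuous:
  fixes f :: "'a::metric_space \<Rightarrow>\<^sub>C real"
  assumes "finite_measure \<nu>" "sets \<nu> = sets borel"
  shows "integrable \<nu> f"
proof -
  interpret finite_measure \<nu> by fact
  show ?thesis
    using continuous_bounds[of f] assms(2)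
    by (intro integrable_const_bound[where B = "norm f"]) (auto cong: measurable_cong_sets)
qed

lemma bounded_linear_integral:
  assumes "prob_space \<nu>" "sets \<nu> = sets borel"
  shows "bounded_linear (\<lambda>f :: 'a::metric_space \<Rightarrow>\<^sub>C real. \<integral>\<eta>. f \<eta> \<partial>\<nu>)"
proof (rule bounded_linear_intro[where K = 1])
  interpret prob_space \<nu> by fact
  note int = integrable_continuous[OF finite_measure_axioms assms(2)]
  fix f g :: "'a \<Rightarrow>\<^sub>C real" and c :: real
  show "(\<integral>\<eta>. (f + g) \<eta> \<partial>\<nu>) = (\<integral>\<eta>. f \<eta> \<partial>\<nu>) + (\<integral>\<eta>. g \<eta> \<partial>\<nu>)"
    using int by simp
  show "(\<integral>\<eta>. (c *\<^sub>R f) \<eta> \<partial>\<nu>) = c *\<^sub>R (\<integral>\<eta>. f \<eta> \<partial>\<nu>)"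
    by simp
  show "norm (\<integral>\<eta>. f \<eta> \<partial>\<nu>) \<le> norm f * 1"
    using int[of f] continuous_bounds(2)[of f] by (simp add: abs_integral_le)
qed

locale feller =
  fixes M :: "'w measure" and P :: "'a::polish_space \<Rightarrow> 'w measure" and Y :: "real \<Rightarrow> 'w \<Rightarrow> 'a"
  assumes feller: "feller_process M P Y" and compact: "compact (UNIV :: 'a set)"
begin

sublocale markov M P Y
  using feller by unfold_locales (simp add: feller_process_def)

lemma bcontfun_iff: "f \<in> bcontfun \<longleftrightarrow> continuous_on UNIV f" for f :: "'a \<Rightarrow> real"
  using compact compact_continuous_image[of UNIV f] compact_imp_bounded
  by (auto simp: bcontfun_def)

text \<open>On a compact space all continuous functions are bounded, so that the transition operators act on the
  Banach space of bounded continuous functions, where calculus along orbits is available.\<close>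

definition T :: "real \<Rightarrow> ('a \<Rightarrow>\<^sub>C real) \<Rightarrow> ('a \<Rightarrow>\<^sub>C real)" where
  "T t f = Bcontfun (transition P Y t f)"

lemma apply_T: "t \<ge> 0 \<Longrightarrow> apply_bcontfun (T t f) = transition P Y t f"
  unfolding T_def using feller
  by (intro Bcontfun_inverse) (auto simp: feller_process_def bcontfun_iff)

sublocale contraction_semigroup T
proof unfold_locales
  fix t c :: real and f g :: "'a \<Rightarrow>\<^sub>C real"
  assume t: "t \<ge> 0"
  show "T t (f + g) = T t f + T t g"
    using transition_linear(1)[OF continuous_bounds continuous_bounds t]
    by (intro bcontfun_eqI) (simp add: apply_T[OF t] plus_bcontfun.rep_eq[abs_def])
  show "T t (c *\<^sub>R f) = c *\<^sub>R T t f"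
    by (intro bcontfun_eqI) (simp add: apply_T[OF t] transition_scale scaleR_bcontfun.rep_eq[abs_def])
  show "norm (T t f) \<le> norm f"
    using transition_bounded[OF continuous_bounds t, of f] by (intro norm_bound) (simp add: apply_T t)
next
  fix f :: "'a \<Rightarrow>\<^sub>C real"
  show "T 0 f = f"
    by (intro bcontfun_eqI) (simp add: apply_T transition_0 continuous_bounds)
  have "uniform_limit UNIV (\<lambda>t. transition P Y t f) f (at_right 0)"
    using feller by (simp add: feller_process_def)
  moreover have "\<forall>\<^sub>F t in at_right 0. \<forall>\<eta>\<in>UNIV. transition P Y t f \<eta> = T t f \<eta>"
    by (intro eventually_at_rightI[of 0 1]) (auto simp: apply_T)
  ultimately show "((\<lambda>t. T t f) \<longlongrightarrow> f) (at_right 0)"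
    by (intro uniform_limit_tendsto_bcontfun) (auto simp: uniform_limit_cong)
next
  fix s t :: real and f :: "'a \<Rightarrow>\<^sub>C real"
  assume st: "s \<ge> 0" "t \<ge> 0"
  show "T (s + t) f = T s (T t f)"
  proof (rule bcontfun_eqI)
    fix \<eta>
    have "transition P Y (s + t) f \<eta> = transition P Y s (transition P Y t f) \<eta>"
      using st by (intro chapman_kolmogorov[where b = "norm f"] continuous_bounds)
    then show "T (s + t) f \<eta> = T s (T t f) \<eta>"
      using st by (simp only: apply_T add_nonneg_nonneg)
  qed
qed

lemma generates_iff:
  "generates f g \<longleftrightarrow> (apply_bcontfun f, apply_bcontfun g) \<in> C_generator (transition P Y)"
proof -
  have "generates f g \<longleftrightarrow>
      uniform_limit UNIV (\<lambda>t. apply_bcontfun ((T t f - f) /\<^sub>R t)) g (at_right 0)"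
    unfolding generates_def
    by (rule iffI; erule tendsto_bcontfun_uniform_limit uniform_limit_tendsto_bcontfun)
  also have "\<dots> \<longleftrightarrow> uniform_limit UNIV (\<lambda>t \<eta>. (transition P Y t f \<eta> - f \<eta>) / t) g (at_right 0)"
    by (intro uniform_limit_cong eventually_at_rightI[of 0 1])
      (auto simp: apply_T divide_inverse mult.commute)
  finally show ?thesis
    by (simp add: C_generator_def)
qed

lemma C_generatorE:
  assumes "(f, g) \<in> C_generator (transition P Y)"
  obtains f' g' where "f = apply_bcontfun f'" "g = apply_bcontfun g'" "generates f' g'"
proof -
  have "f \<in> bcontfun" "g \<in> bcontfun"
    using assms by (auto simp: C_generator_def bcontfun_iff)
  then obtain f' g' where "f = apply_bcontfun f'" "g = apply_bcontfun g'"
    by (metis bcontfunE)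
  then show ?thesis
    using that assms generates_iff by blast
qed

text \<open>Differentiating the identity
  \<^prop>\<open>(\<integral>\<eta>. T t f \<eta> \<partial>\<nu>) = (\<integral>\<eta>. f \<eta> \<partial>\<nu>)\<close>
  at time \<open>0\<close>.\<close>

lemma integral_generator_invariant:
  assumes \<nu>: "prob_space \<nu>" "sets \<nu> = sets borel" "invariant_measure P Y \<nu>"
    and "(f, g) \<in> C_generator (transition P Y)"
  shows "(\<integral>\<eta>. g \<eta> \<partial>\<nu>) = 0"
proof -
  obtain f' g' where f: "f = apply_bcontfun f'" and g: "g = apply_bcontfun g'"
    and "generates f' g'"
    using assms(4) by (rule C_generatorE)
  interpret bounded_linear "\<lambda>f :: 'a \<Rightarrow>\<^sub>C real. \<integral>\<eta>. f \<eta> \<partial>\<nu>"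
    using \<nu>(1,2) by (rule bounded_linear_integral)
  have "((\<lambda>t. \<integral>\<eta>. ((T t f' - f') /\<^sub>R t) \<eta> \<partial>\<nu>) \<longlongrightarrow> (\<integral>\<eta>. g' \<eta> \<partial>\<nu>)) (at_right 0)"
    using \<open>generates f' g'\<close> unfolding generates_def by (rule tendsto)
  moreover have "\<forall>\<^sub>F t in at_right 0. (\<integral>\<eta>. ((T t f' - f') /\<^sub>R t) \<eta> \<partial>\<nu>) = 0"
  proof (rule eventually_at_rightI[of 0 1])
    fix t :: real
    assume "t \<in> {0<..<1}"
    then have "(\<integral>\<eta>. T t f' \<eta> \<partial>\<nu>) = (\<integral>\<eta>. f' \<eta> \<partial>\<nu>)"
      using integral_invariant[OF \<nu> continuous_bounds] by (simp add: apply_T)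
    then show "(\<integral>\<eta>. ((T t f' - f') /\<^sub>R t) \<eta> \<partial>\<nu>) = 0"
      unfolding scaleR diff by simp
  qed simp
  ultimately have "((\<lambda>t. 0) \<longlongrightarrow> (\<integral>\<eta>. g' \<eta> \<partial>\<nu>)) (at_right (0::real))"
    by (rule Lim_transform_eventually)
  then show ?thesis
    unfolding g by (simp add: tendsto_const_iff)
qed

end

section \<open>Continuous test functions\<close>

text \<open>The indicator of a compact set is the pointwise limit of the truncated cones over it.\<close>

lemma indicator_compact_approximation:
  fixes \<nu> :: "'a::metric_space measure"
  assumes "finite_measure \<nu>" "sets \<nu> = sets borel" "compact K" "e > 0"
  shows "\<exists>h :: 'a \<Rightarrow>\<^sub>C real. (\<integral>x. \<bar>indicator K x - h x\<bar> \<partial>\<nu>) < e"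
proof (cases "K = {}")
  case True
  then show ?thesis
    using \<open>e > 0\<close> by (intro exI[of _ 0]) simp
next
  case False
  interpret finite_measure \<nu> by fact
  note [measurable_cong] = assms(2)
  define h where "h n x = max 0 (1 - real n * infdist x K)" for n x
  have continuous: "continuous_on UNIV (h n)" for n
    unfolding h_def by (intro continuous_intros)
  have range: "0 \<le> h n x" "h n x \<le> 1" for n x
    by (auto simp: h_def infdist_nonneg)
  then have "h n \<in> bcontfun" for n
    using continuous by (intro bcontfun_normI[where b = 1]) auto
  then have h: "apply_bcontfun (Bcontfun (h n)) = h n" for n
    by (rule Bcontfun_inverse)
  have [measurable]: "h n \<in> borel_measurable borel" "K \<in> sets borel" for n
    using continuous assms(3) by (auto intro: borel_measurable_continuous_onI borel_compact)
  have pointwise: "(\<lambda>n. \<bar>indicator K x - h n x\<bar>) \<longlonglongrightarrow> 0" for x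
  proof (cases "x \<in> K")
    case True
    then show ?thesis by (simp add: h_def)
  next
    case False
    then have "infdist x K > 0"
      using assms(3) \<open>K \<noteq> {}\<close> infdist_pos_not_in_closed compact_imp_closed by blast
    then obtain N where "1 < real N * infdist x K"
      using reals_Archimedean3 by blast
    then have "1 \<le> real n * infdist x K" if "n \<ge> N" for n
      using that mult_right_mono[of "real N" "real n" "infdist x K"] \<open>infdist x K > 0\<close> by linarith
    then have "\<forall>\<^sub>F n in sequentially. \<bar>indicator K x - h n x\<bar> = 0"
      using False by (intro eventually_sequentiallyI[of N]) (simp add: h_def max_absorb1)
    then show ?thesis
      by (rule tendsto_eventually)
  qed
  have "(\<lambda>n. \<integral>x. \<bar>indicator K x - h n x\<bar> \<partial>\<nu>) \<longlonglongrightarrow> (\<integral>x. 0 \<partial>\<nu>)"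
  proof (rule integral_dominated_convergence[where w = "\<lambda>_. 1", rotated -1])
    show "AE x in \<nu>. norm \<bar>indicator K x - h n x\<bar> \<le> 1" for n
    proof (rule AE_I2)
      fix x
      show "norm \<bar>indicator K x - h n x\<bar> \<le> 1"
        using range[of n x] by (cases "x \<in> K") auto
    qed
  qed (use pointwise in auto)
  then have "\<forall>\<^sub>F n in sequentially. (\<integral>x. \<bar>indicator K x - h n x\<bar> \<partial>\<nu>) < e"
    using \<open>e > 0\<close> by (intro order_tendstoD) auto
  then obtain n where "(\<integral>x. \<bar>indicator K x - h n x\<bar> \<partial>\<nu>) < e"
    using eventually_happens'[OF sequentially_bot] by blast
  then show ?thesis
    by (intro exI[of _ "Bcontfun (h n)"]) (simp add: h)
qed

text \<open>Inner regularity of finite measures on Polish spaces reduces measurable sets to compact ones.\<close>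

lemma continuous_dense_L1:
  fixes \<nu> :: "'a::polish_space measure" and f :: "'a \<Rightarrow> real"
  assumes "finite_measure \<nu>" "sets \<nu> = sets borel" "integrable \<nu> f" "e > 0"
  shows "\<exists>h :: 'a \<Rightarrow>\<^sub>C real. (\<integral>x. \<bar>f x - h x\<bar> \<partial>\<nu>) < e"
  using assms(3,4)
proof (induction arbitrary: e rule: integrable_induct)
  interpret finite_measure \<nu> by fact
  note [measurable_cong] = assms(2)
  note integrable = integrable_continuous[OF assms(1,2)]
  {
    case (base A c)
    define e' where "e' = e / (\<bar>c\<bar> + 1) / 2"
    have "e' > 0"
      using base by (simp add: e'_def)
    have sup: "emeasure \<nu> A = (SUP K \<in> {K. K \<subseteq> A \<and> compact K}. emeasure \<nu> K)"
      using base assms(2) by (intro inner_regular) auto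
    have "\<exists>K\<in>{K. K \<subseteq> A \<and> compact K}. emeasure \<nu> A < emeasure \<nu> K + ennreal e'"
      by (rule SUP_approx_ennreal[OF \<open>e' > 0\<close> _ sup]) (use base in auto)
    then obtain K where K: "K \<subseteq> A" "compact K" "emeasure \<nu> A < emeasure \<nu> K + ennreal e'"
      by auto
    have [measurable]: "K \<in> sets \<nu>" "A \<in> sets \<nu>"
      using K(2) base borel_compact by (auto simp: assms(2))
    have "measure \<nu> A \<le> measure \<nu> K + e'"
      using K(3) \<open>e' > 0\<close>
      by (simp add: emeasure_eq_measure ennreal_less_iff flip: ennreal_plus)
    then have small: "(\<integral>x. \<bar>indicator A x - indicator K x\<bar> \<partial>\<nu>) \<le> e'"
    proof -
      have "(\<integral>x. \<bar>indicator A x - indicator K x\<bar> \<partial>\<nu>) =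
          (\<integral>x. indicat_real A x - indicator K x \<partial>\<nu>)"
        using K(1) by (intro Bochner_Integration.integral_cong) (auto simp: indicator_def)
      also have "\<dots> = measure \<nu> A - measure \<nu> K"
        by (simp add: Bochner_Integration.integral_diff emeasure_eq_measure)
      finally show ?thesis
        using \<open>measure \<nu> A \<le> measure \<nu> K + e'\<close> by simp
    qed
    obtain h :: "'a \<Rightarrow>\<^sub>C real" where h: "(\<integral>x. \<bar>indicator K x - h x\<bar> \<partial>\<nu>) < e'"
      using indicator_compact_approximation[OF assms(1,2) K(2) \<open>e' > 0\<close>] by blast
    note [simp] = integrable[of h]
    have "(\<integral>x. \<bar>indicator A x *\<^sub>R c - apply_bcontfun (c *\<^sub>R h) x\<bar> \<partial>\<nu>)
        \<le> (\<integral>x. \<bar>c\<bar> * (\<bar>indicator A x - indicator K x\<bar> + \<bar>indicator K x - h x\<bar>) \<partial>\<nu>)"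
    proof (rule integral_mono)
      fix x
      have "\<bar>indicator A x *\<^sub>R c - apply_bcontfun (c *\<^sub>R h) x\<bar> = \<bar>c\<bar> * \<bar>indicator A x - h x\<bar>"
        by (simp add: abs_mult[symmetric] algebra_simps)
      also have "\<dots> \<le> \<bar>c\<bar> * (\<bar>indicator A x - indicator K x\<bar> + \<bar>indicator K x - h x\<bar>)"
        by (intro mult_left_mono) auto
      finally show "\<bar>indicator A x *\<^sub>R c - apply_bcontfun (c *\<^sub>R h) x\<bar>
          \<le> \<bar>c\<bar> * (\<bar>indicator A x - indicator K x\<bar> + \<bar>indicator K x - h x\<bar>)" .
    qed (auto simp: emeasure_eq_measure)
    also have "\<dots> = \<bar>c\<bar> * ((\<integral>x. \<bar>indicator A x - indicator K x\<bar> \<partial>\<nu>) + (\<integral>x. \<bar>indicator K x - h x\<bar> \<partial>\<nu>))"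
      by (simp add: emeasure_eq_measure)
    also have "\<dots> \<le> \<bar>c\<bar> * (e' + e')"
      using small h by (intro mult_left_mono) auto
    also have "\<dots> < (\<bar>c\<bar> + 1) * (e' + e')"
      using \<open>e' > 0\<close> by (intro mult_strict_right_mono) auto
    also have "\<dots> = e"
    proof -
      have "\<bar>c\<bar> + 1 \<noteq> 0"
        by linarith
      then show ?thesis
        unfolding e'_def field_sum_of_halves times_divide_eq_right
        by (rule nonzero_mult_div_cancel_left)
    qed
    finally show ?case by blast
  next
    case (add f g)
    obtain h k :: "'a \<Rightarrow>\<^sub>C real"
      where h: "(\<integral>x. \<bar>f x - h x\<bar> \<partial>\<nu>) < e / 2" and k: "(\<integral>x. \<bar>g x - k x\<bar> \<partial>\<nu>) < e / 2"
      using add.IH[of "e / 2"] add.prems by auto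
    have "(\<integral>x. \<bar>(f x + g x) - apply_bcontfun (h + k) x\<bar> \<partial>\<nu>) \<le> (\<integral>x. \<bar>f x - h x\<bar> + \<bar>g x - k x\<bar> \<partial>\<nu>)"
      using add.hyps integrable by (intro integral_mono) auto
    also have "\<dots> = (\<integral>x. \<bar>f x - h x\<bar> \<partial>\<nu>) + (\<integral>x. \<bar>g x - k x\<bar> \<partial>\<nu>)"
      using add.hyps integrable by (intro Bochner_Integration.integral_add) auto
    also have "\<dots> < e"
      using h k by simp
    finally show ?case by blast
  next
    case (lim f s)
    have "(\<lambda>i. \<integral>x. \<bar>f x - s i x\<bar> \<partial>\<nu>) \<longlonglongrightarrow> (\<integral>x. 0 \<partial>\<nu>)"
    proof (rule integral_dominated_convergence[where w = "\<lambda>x. 3 * \<bar>f x\<bar>"])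
      show "AE x in \<nu>. (\<lambda>i. \<bar>f x - s i x\<bar>) \<longlonglongrightarrow> 0"
      proof (rule AE_I2)
        fix x
        assume "x \<in> space \<nu>"
        then have "(\<lambda>i. \<bar>f x - s i x\<bar>) \<longlonglongrightarrow> \<bar>f x - f x\<bar>"
          by (intro tendsto_intros lim.hyps(2))
        then show "(\<lambda>i. \<bar>f x - s i x\<bar>) \<longlonglongrightarrow> 0"
          by simp
      qed
      show "AE x in \<nu>. norm \<bar>f x - s i x\<bar> \<le> 3 * \<bar>f x\<bar>" for i
        using lim.hyps(3)[of _ i] by (intro AE_I2) force
    qed (use lim in auto)
    then have "\<forall>\<^sub>F i in sequentially. (\<integral>x. \<bar>f x - s i x\<bar> \<partial>\<nu>) < e / 2"
      using lim.prems by (intro order_tendstoD) auto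
    then obtain i where i: "(\<integral>x. \<bar>f x - s i x\<bar> \<partial>\<nu>) < e / 2"
      using eventually_happens'[OF sequentially_bot] by blast
    obtain h :: "'a \<Rightarrow>\<^sub>C real" where h: "(\<integral>x. \<bar>s i x - h x\<bar> \<partial>\<nu>) < e / 2"
      using lim.IH[of "e / 2" i] lim.prems by auto
    have "(\<integral>x. \<bar>f x - h x\<bar> \<partial>\<nu>) \<le> (\<integral>x. \<bar>f x - s i x\<bar> + \<bar>s i x - h x\<bar> \<partial>\<nu>)"
      using lim integrable by (intro integral_mono) auto
    also have "\<dots> = (\<integral>x. \<bar>f x - s i x\<bar> \<partial>\<nu>) + (\<integral>x. \<bar>s i x - h x\<bar> \<partial>\<nu>)"
      using lim integrable by (intro Bochner_Integration.integral_add) auto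
    also have "\<dots> < e"
      using h i by simp
    finally show ?case by blast
  }
qed

text \<open>The approximating continuous functions have to serve both measures at once, so they are taken in
  \<open>L\<^sup>1\<close> of the average of the two.\<close>

lemma continuous_test_functions_suffice:
  fixes \<nu>1 \<nu>2 :: "'a::polish_space measure"
  assumes \<nu>: "prob_space \<nu>1" "sets \<nu>1 = sets borel" "prob_space \<nu>2" "sets \<nu>2 = sets borel"
    and continuous: "\<And>h :: 'a \<Rightarrow>\<^sub>C real. \<bar>(\<integral>x. apply_bcontfun h x \<partial>\<nu>1) - (\<integral>x. apply_bcontfun h x \<partial>\<nu>2)\<bar>
      \<le> k * norm h"
    and "k \<ge> 0"
    and f: "f \<in> borel_measurable borel" "\<And>x. \<bar>f x\<bar> \<le> b"
  shows "\<bar>(\<integral>x. f x \<partial>\<nu>1) - (\<integral>x. f x \<partial>\<nu>2)\<bar> \<le> k * b"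
proof (rule field_le_epsilon)
  fix e :: real
  assume "e > 0"
  interpret \<nu>1: prob_space \<nu>1 by fact
  interpret \<nu>2: prob_space \<nu>2 by fact
  define K where "K i = (if i then \<nu>1 else \<nu>2)" for i
  define \<nu> where "\<nu> = measure_pmf (bernoulli_pmf (1 / 2)) \<bind> K"
  have K: "K \<in> measure_pmf (bernoulli_pmf (1 / 2)) \<rightarrow>\<^sub>M prob_algebra borel"
    using \<nu> by (auto simp: K_def measurable_pmf_measure1 space_prob_algebra)
  have \<nu>_prob: "prob_space \<nu>"
    unfolding \<nu>_def using K
    by (intro prob_space_bind'[where M = "measure_pmf (bernoulli_pmf (1 / 2))"])
      (auto simp: space_prob_algebra measure_pmf.prob_space_axioms)
  have \<nu>_sets: "sets \<nu> = sets borel"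
    unfolding \<nu>_def using \<nu> by (intro sets_bind) (auto simp: K_def)
  interpret \<nu>: prob_space \<nu> by (rule \<nu>_prob)
  have average: "(\<integral>x. g x \<partial>\<nu>) = ((\<integral>x. g x \<partial>\<nu>1) + (\<integral>x. g x \<partial>\<nu>2)) / 2"
    if "g \<in> borel_measurable borel" "\<And>x. \<bar>g x\<bar> \<le> c" for g :: "'a \<Rightarrow> real" and c
    unfolding \<nu>_def
    by (subst integral_bind_kernel[OF measure_pmf.prob_space_axioms K that])
      (simp add: K_def field_simps)
  have "integrable \<nu> f"
    using f \<nu>_sets by (intro \<nu>.integrable_const_bound[where B = b]) (auto cong: measurable_cong_sets)
  then obtain h' :: "'a \<Rightarrow>\<^sub>C real" where h': "(\<integral>x. \<bar>f x - h' x\<bar> \<partial>\<nu>) < e / 2"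
    using continuous_dense_L1[OF \<nu>.finite_measure_axioms \<nu>_sets, of f "e / 2"] \<open>e > 0\<close> by auto
  have "b \<ge> 0"
    using f(2)[of undefined] by linarith
  \<comment> \<open>Truncating the approximation at the bound of \<^term>\<open>f\<close> brings it closer.\<close>
  define h where "h = Bcontfun (\<lambda>x. max (- b) (min b (h' x)))"
  have "(\<lambda>x. max (- b) (min b (h' x))) \<in> bcontfun"
    using \<open>b \<ge> 0\<close> by (intro bcontfun_normI[where b = b]) (auto intro!: continuous_intros)
  then have h: "h x = max (- b) (min b (h' x))" for x
    unfolding h_def by (subst Bcontfun_inverse) auto
  have "norm h \<le> b"
    using \<open>b \<ge> 0\<close> by (intro norm_bound) (auto simp: h)
  note integrable = integrable_continuous[OF \<nu>1.finite_measure_axioms \<nu>(2)]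
    integrable_continuous[OF \<nu>2.finite_measure_axioms \<nu>(4)]
    integrable_continuous[OF \<nu>.finite_measure_axioms \<nu>_sets]
  have f_integrable: "integrable \<nu>1 f" "integrable \<nu>2 f"
    using f \<nu>
    by (auto intro!: \<nu>1.integrable_const_bound[where B = b] \<nu>2.integrable_const_bound[where B = b]
      cong: measurable_cong_sets)
  have [measurable]: "f \<in> borel_measurable borel" "apply_bcontfun h \<in> borel_measurable borel"
    using f continuous_bounds by auto
  have "((\<integral>x. \<bar>f x - h x\<bar> \<partial>\<nu>1) + (\<integral>x. \<bar>f x - h x\<bar> \<partial>\<nu>2)) / 2 = (\<integral>x. \<bar>f x - h x\<bar> \<partial>\<nu>)"
  proof (rule average[symmetric])
    show "\<bar>\<bar>f x - h x\<bar>\<bar> \<le> b + norm h" for x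
      using f(2)[of x] continuous_bounds(2)[of h x] by linarith
  qed measurable
  also have "\<dots> \<le> (\<integral>x. \<bar>f x - h' x\<bar> \<partial>\<nu>)"
  proof (rule integral_mono)
    show "\<bar>f x - h x\<bar> \<le> \<bar>f x - h' x\<bar>" for x
      using f(2)[of x] by (auto simp: h)
  qed (use \<open>integrable \<nu> f\<close> integrable in auto)
  finally have close: "(\<integral>x. \<bar>f x - h x\<bar> \<partial>\<nu>1) + (\<integral>x. \<bar>f x - h x\<bar> \<partial>\<nu>2) \<le> e"
    using h' by simp
  have "\<bar>(\<integral>x. f x \<partial>\<nu>1) - (\<integral>x. h x \<partial>\<nu>1)\<bar> \<le> (\<integral>x. \<bar>f x - h x\<bar> \<partial>\<nu>1)"
    using f_integrable integrable integral_abs_bound[of \<nu>1 "\<lambda>x. f x - h x"] by simp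
  moreover have "\<bar>(\<integral>x. f x \<partial>\<nu>2) - (\<integral>x. h x \<partial>\<nu>2)\<bar> \<le> (\<integral>x. \<bar>f x - h x\<bar> \<partial>\<nu>2)"
    using f_integrable integrable integral_abs_bound[of \<nu>2 "\<lambda>x. f x - h x"] by simp
  moreover have "\<bar>(\<integral>x. h x \<partial>\<nu>1) - (\<integral>x. h x \<partial>\<nu>2)\<bar> \<le> k * b"
    using continuous[of h] mult_left_mono[OF \<open>norm h \<le> b\<close> \<open>k \<ge> 0\<close>] by linarith
  ultimately show "\<bar>(\<integral>x. f x \<partial>\<nu>1) - (\<integral>x. f x \<partial>\<nu>2)\<bar> \<le> k * b + e"
    using close by linarith
qed

section \<open>Relaxation of the perturbed process\<close>

lemma nonincreasing_on_half_line:
  fixes \<phi> :: "real \<Rightarrow> real"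
  assumes derivative: "\<And>t. t \<ge> 0 \<Longrightarrow> (\<phi> has_real_derivative \<phi>' t) (at t within {0..})"
    and nonpos: "\<And>t. t \<ge> 0 \<Longrightarrow> \<phi>' t \<le> 0"
    and "0 \<le> s" "s \<le> t"
  shows "\<phi> t \<le> \<phi> s"
proof (rule DERIV_nonpos_imp_decreasing_open[OF \<open>s \<le> t\<close>])
  fix x :: real
  assume x: "s < x" "x < t"
  then have "x \<in> interior {0..}"
    using assms(3) by (simp add: interior_real_atLeast)
  then have "at x within {0..} = at x"
    by (rule at_within_interior)
  then show "\<exists>y. DERIV \<phi> x :> y \<and> y \<le> 0"
    using derivative[of x] nonpos[of x] x assms(3) by (metis less_eq_real_def order_trans)
next
  have "continuous_on {0..} \<phi>"
    using derivative by (intro DERIV_continuous_on) auto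
  then show "continuous_on {s..t} \<phi>"
    by (rule continuous_on_subset) (use assms(3) in auto)
qed

lemma product_bcontfun:
  fixes f g :: "'a::metric_space \<Rightarrow>\<^sub>C real"
  shows "(\<lambda>\<eta>. f \<eta> * g \<eta>) \<in> bcontfun" "\<bar>f \<eta> * g \<eta>\<bar> \<le> norm f * norm g"
proof -
  show "\<bar>f \<eta> * g \<eta>\<bar> \<le> norm f * norm g" for \<eta>
    using continuous_bounds(2)[of f \<eta>] continuous_bounds(2)[of g \<eta>]
    by (auto simp: abs_mult intro!: mult_mono)
  then show "(\<lambda>\<eta>. f \<eta> * g \<eta>) \<in> bcontfun"
    by (intro bcontfun_normI[where b = "norm f * norm g"]) (auto intro!: continuous_intros)
qed

text \<open>The abstract setting of the relaxation estimate. The process \<^term>\<open>Z\<close> arises from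
  \<^term>\<open>\<sigma>\<close> by adding two bounded operators to the generator: \<^term>\<open>J\<close>,
  which preserves \<^term>\<open>\<mu>\<close> together with \<^term>\<open>\<sigma>\<close>, and a perturbation
  \<^term>\<open>J_hat\<close> whose norm on \<open>L\<^sup>2(\<mu>)\<close> is smaller than the spectral gap of
  \<^term>\<open>\<sigma>\<close>. The inequality on \<^term>\<open>J\<close> and squares says that
  \<^term>\<open>J\<close> has a nonnegative square field, as jump operators with nonnegative rates do.\<close>

locale perturbed_feller =
  env: feller M P \<sigma> + seen: feller M P Y + pert: feller M P Z
  for M :: "'w measure" and P :: "'a::polish_space \<Rightarrow> 'w measure" and \<sigma> Y Z :: "real \<Rightarrow> 'w \<Rightarrow> 'a" +
  fixes \<mu> \<nu> :: "'a measure" and J J_hat :: "('a \<Rightarrow> real) \<Rightarrow> 'a \<Rightarrow> real" and \<gamma> \<epsilon> b :: real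
  assumes \<mu>: "prob_space \<mu>" "sets \<mu> = sets borel"
    and env_invariant: "invariant_measure P \<sigma> \<mu>"
    and seen_invariant: "invariant_measure P Y \<mu>"
    and poincare: "(f, g) \<in> C_generator (transition P \<sigma>) \<Longrightarrow>
      \<gamma> * (\<integral>\<eta>. (f \<eta> - (\<integral>\<zeta>. f \<zeta> \<partial>\<mu>))\<^sup>2 \<partial>\<mu>) \<le> - (\<integral>\<eta>. (f \<eta> - (\<integral>\<zeta>. f \<zeta> \<partial>\<mu>)) * g \<eta> \<partial>\<mu>)"
    and seen_generator: "(f, g) \<in> C_generator (transition P \<sigma>) \<Longrightarrow>
      (f, \<lambda>\<eta>. g \<eta> + J f \<eta>) \<in> C_generator (transition P Y)"
    and pert_generator: "(f, h) \<in> C_generator (transition P Z) \<Longrightarrow>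
      \<exists>g. (f, g) \<in> C_generator (transition P \<sigma>) \<and> h = (\<lambda>\<eta>. g \<eta> + J f \<eta> + J_hat f \<eta>)"
    and J_continuous: "continuous_on UNIV f \<Longrightarrow> continuous_on UNIV (J f)"
    and J_diff: "J (\<lambda>\<eta>. f \<eta> - g \<eta>) \<eta> = J f \<eta> - J g \<eta>"
    and J_bounded: "(\<And>\<eta>. \<bar>f \<eta>\<bar> \<le> c) \<Longrightarrow> \<bar>J f \<eta>\<bar> \<le> b * c"
    and J_square: "2 * f \<eta> * J f \<eta> \<le> J (\<lambda>\<eta>. f \<eta> * f \<eta>) \<eta>"
    and J_hat_continuous: "continuous_on UNIV f \<Longrightarrow> continuous_on UNIV (J_hat f)"
    and J_hat_const: "J_hat (\<lambda>\<eta>. f \<eta> - c) = J_hat f"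
    and J_hat_bounded: "continuous_on UNIV f \<Longrightarrow>
      (\<integral>\<eta>. (J_hat f \<eta>)\<^sup>2 \<partial>\<mu>) \<le> \<epsilon>\<^sup>2 * (\<integral>\<eta>. (f \<eta>)\<^sup>2 \<partial>\<mu>)"
    and gap: "0 < \<epsilon>" "\<epsilon> < \<gamma>"
    and \<nu>: "prob_space \<nu>" "sets \<nu> = sets borel"
    and \<nu>_ac: "absolutely_continuous \<mu> \<nu>"
    and \<nu>_invariant: "invariant_measure P Z \<nu>"
begin

sublocale \<mu>: prob_space \<mu> by (rule \<mu>)

abbreviation mean :: "('a \<Rightarrow>\<^sub>C real) \<Rightarrow> real" where
  "mean f \<equiv> \<integral>\<eta>. f \<eta> \<partial>\<mu>"

definition form :: "('a \<Rightarrow>\<^sub>C real) \<Rightarrow> ('a \<Rightarrow>\<^sub>C real) \<Rightarrow> real" where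
  "form f g = (\<integral>\<eta>. f \<eta> * g \<eta> \<partial>\<mu>)"

definition var :: "('a \<Rightarrow>\<^sub>C real) \<Rightarrow> real" where
  "var f = form f f - (mean f)\<^sup>2"

lemma integrable_C: "continuous_on UNIV f \<Longrightarrow> integrable \<mu> (f :: 'a \<Rightarrow> real)"
  by (metis bcontfunE env.bcontfun_iff integrable_continuous \<mu>(2) \<mu>.finite_measure_axioms)

lemma bounded_bilinear_form: "bounded_bilinear form"
proof
  fix f f' g :: "'a \<Rightarrow>\<^sub>C real" and c :: real
  have int: "integrable \<mu> (\<lambda>\<eta>. f \<eta> * g \<eta>)" for f g :: "'a \<Rightarrow>\<^sub>C real"
    by (intro integrable_C continuous_intros) auto
  show "form (f + f') g = form f g + form f' g" "form g (f + f') = form g f + form g f'"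
    using int by (simp_all add: form_def algebra_simps)
  show "form (c *\<^sub>R f) g = c *\<^sub>R form f g" "form f (c *\<^sub>R g) = c *\<^sub>R form f g"
    by (simp_all add: form_def algebra_simps)
  show "\<exists>K. \<forall>f g. norm (form f g) \<le> norm f * norm g * K"
  proof (intro exI[of _ 1] allI)
    fix f g :: "'a \<Rightarrow>\<^sub>C real"
    show "norm (form f g) \<le> norm f * norm g * 1"
      unfolding form_def using int[of f g] product_bcontfun(2)[of f _ g]
      by (simp add: \<mu>.abs_integral_le)
  qed
qed

interpretation form: bounded_bilinear form
  by (rule bounded_bilinear_form)

interpretation mean: bounded_linear mean
  using \<mu> by (rule bounded_linear_integral)

lemma form_commute: "form f g = form g f"
  by (simp add: form_def mult.commute)

lemma form_centered:
  fixes f g :: "'a \<Rightarrow>\<^sub>C real"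
  shows "(\<integral>\<eta>. (f \<eta> - mean f) * g \<eta> \<partial>\<mu>) = form f g - mean f * mean g"
proof -
  have "integrable \<mu> (\<lambda>\<eta>. f \<eta> * g \<eta>)" "integrable \<mu> (\<lambda>\<eta>. mean f * g \<eta>)"
    by (intro integrable_C continuous_intros; auto)+
  then show ?thesis
    by (simp add: left_diff_distrib form_def)
qed

lemma var_eq:
  fixes f :: "'a \<Rightarrow>\<^sub>C real"
  shows "var f = (\<integral>\<eta>. (f \<eta> - mean f)\<^sup>2 \<partial>\<mu>)"
proof -
  have "integrable \<mu> (\<lambda>\<eta>. f \<eta> * f \<eta>)" "integrable \<mu> (\<lambda>\<eta>. f \<eta>)"
    by (intro integrable_C continuous_intros; auto)+
  then show ?thesis
    by (simp add: power2_eq_square algebra_simps form_def var_def \<mu>.prob_space)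
qed

lemma var_nonneg: "var f \<ge> 0"
  unfolding var_eq by (rule Bochner_Integration.integral_nonneg) simp

lemma var_le: "var f \<le> (norm f)\<^sup>2"
proof -
  have "form f f \<le> norm f * norm f"
    unfolding form_def using product_bcontfun(2)[of f _ f]
    by (intro \<mu>.integral_le_const integrable_C continuous_intros) (auto simp: abs_le_iff)
  then show ?thesis
    using zero_le_square[of "mean f"] unfolding var_def power2_eq_square by linarith
qed

lemma integral_env_generator:
  assumes "(f, g) \<in> C_generator (transition P \<sigma>)"
  shows "(\<integral>\<eta>. g \<eta> \<partial>\<mu>) = 0" "(\<integral>\<eta>. J f \<eta> \<partial>\<mu>) = 0"
proof -
  show g: "(\<integral>\<eta>. g \<eta> \<partial>\<mu>) = 0"
    using env.integral_generator_invariant[OF \<mu> env_invariant assms] .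
  have "continuous_on UNIV f" "continuous_on UNIV g"
    using assms by (auto simp: C_generator_def)
  then have "(\<integral>\<eta>. g \<eta> + J f \<eta> \<partial>\<mu>) = (\<integral>\<eta>. g \<eta> \<partial>\<mu>) + (\<integral>\<eta>. J f \<eta> \<partial>\<mu>)"
    by (intro Bochner_Integration.integral_add integrable_C J_continuous)
  moreover have "(\<integral>\<eta>. g \<eta> + J f \<eta> \<partial>\<mu>) = 0"
    using seen.integral_generator_invariant[OF \<mu> seen_invariant seen_generator[OF assms]] .
  ultimately show "(\<integral>\<eta>. J f \<eta> \<partial>\<mu>) = 0"
    using g by simp
qed

text \<open>The domain of the generator need not contain \<^term>\<open>f\<^sup>2\<close> together with
  \<^term>\<open>f\<close>. Since it is dense and \<^term>\<open>J\<close> is bounded,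
  \<^term>\<open>\<mu>\<close> is nevertheless invariant under the jumps alone.\<close>

lemma integral_J:
  fixes f :: "'a \<Rightarrow>\<^sub>C real"
  shows "(\<integral>\<eta>. J f \<eta> \<partial>\<mu>) = 0"
proof -
  have "\<bar>\<integral>\<eta>. J f \<eta> \<partial>\<mu>\<bar> \<le> 0 + \<bar>b\<bar> * e" if "e > 0" for e
  proof -
    obtain f' g' where "env.generates f' g'" and close: "norm (f' - f) < e"
      using env.dense_domain[OF \<open>e > 0\<close>] by blast
    then have "(\<integral>\<eta>. J f' \<eta> \<partial>\<mu>) = 0"
      using integral_env_generator(2) env.generates_iff by blast
    moreover have "\<bar>(\<integral>\<eta>. J f \<eta> \<partial>\<mu>) - (\<integral>\<eta>. J f' \<eta> \<partial>\<mu>)\<bar> \<le> \<bar>b\<bar> * e"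
    proof -
      have int: "integrable \<mu> (J f)" "integrable \<mu> (J f')"
        by (intro integrable_C J_continuous; auto)+
      have "\<bar>J f \<eta> - J f' \<eta>\<bar> \<le> \<bar>b\<bar> * e" for \<eta>
      proof -
        have "\<bar>f \<eta> - f' \<eta>\<bar> \<le> e" for \<eta>
          using continuous_bounds(2)[of "f' - f" \<eta>] close by simp
        then have "\<bar>J (\<lambda>\<eta>. f \<eta> - f' \<eta>) \<eta>\<bar> \<le> b * e"
          by (rule J_bounded)
        also have "\<dots> \<le> \<bar>b\<bar> * e"
          using that by (intro mult_right_mono) auto
        finally show ?thesis
          by (simp add: J_diff)
      qed
      then have "\<bar>\<integral>\<eta>. J f \<eta> - J f' \<eta> \<partial>\<mu>\<bar> \<le> \<bar>b\<bar> * e"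
        using int by (intro \<mu>.abs_integral_le) auto
      then show ?thesis
        using int by simp
    qed
    ultimately show ?thesis by simp
  qed
  then have "\<bar>\<integral>\<eta>. J f \<eta> \<partial>\<mu>\<bar> \<le> 0 + e" if "e > 0" for e
  proof -
    have "\<bar>\<integral>\<eta>. J f \<eta> \<partial>\<mu>\<bar> \<le> \<bar>b\<bar> * (e / (\<bar>b\<bar> + 1))"
      using \<open>\<And>e. e > 0 \<Longrightarrow> \<bar>\<integral>\<eta>. J f \<eta> \<partial>\<mu>\<bar> \<le> 0 + \<bar>b\<bar> * e\<close>[of "e / (\<bar>b\<bar> + 1)"] that by simp
    also have "\<dots> \<le> e"
      using that by (simp add: field_simps)
    finally show ?thesis by simp
  qed
  then have "\<bar>\<integral>\<eta>. J f \<eta> \<partial>\<mu>\<bar> \<le> 0"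
    by (rule field_le_epsilon)
  then show ?thesis by simp
qed

text \<open>Integrating the square field inequality against the invariant measure makes its right-hand side
  vanish.\<close>

lemma J_dissipative:
  fixes f :: "'a \<Rightarrow>\<^sub>C real"
  shows "(\<integral>\<eta>. f \<eta> * J f \<eta> \<partial>\<mu>) \<le> 0"
proof -
  define f2 where "f2 = Bcontfun (\<lambda>\<eta>. f \<eta> * f \<eta>)"
  have f2: "apply_bcontfun f2 = (\<lambda>\<eta>. f \<eta> * f \<eta>)"
    unfolding f2_def using product_bcontfun(1) by (rule Bcontfun_inverse)
  have "(\<integral>\<eta>. 2 * f \<eta> * J f \<eta> \<partial>\<mu>) \<le> (\<integral>\<eta>. J f2 \<eta> \<partial>\<mu>)"
    unfolding f2 using J_square
    by (intro integral_mono integrable_C J_continuous continuous_intros) auto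
  then show ?thesis
    by (simp add: integral_J mult.assoc)
qed

text \<open>A perturbation that annihilates constants sees only the centred part of \<^term>\<open>f\<close>,
  hence the variance in place of the second moment.\<close>

lemma J_hat_form:
  fixes f :: "'a \<Rightarrow>\<^sub>C real"
  shows "\<bar>\<integral>\<eta>. J_hat f \<eta> \<partial>\<mu>\<bar> \<le> \<epsilon> * sqrt (var f)"
  "(\<integral>\<eta>. (f \<eta> - mean f) * J_hat f \<eta> \<partial>\<mu>) \<le> \<epsilon> * var f"
proof -
  have continuous: "continuous_on UNIV (J_hat f)" "continuous_on UNIV (\<lambda>\<eta>. f \<eta> - mean f)"
    by (intro J_hat_continuous continuous_intros; auto)+
  note [simp] = integrable_C continuous continuous_intros
  have square: "(\<integral>\<eta>. (J_hat f \<eta>)\<^sup>2 \<partial>\<mu>) \<le> \<epsilon>\<^sup>2 * var f"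
    using J_hat_bounded[OF continuous(2)] by (simp add: J_hat_const var_eq)
  have "(\<integral>\<eta>. J_hat f \<eta> \<partial>\<mu>)\<^sup>2 \<le> (\<epsilon> * sqrt (var f))\<^sup>2"
    using \<mu>.variance_eq[of "J_hat f"] \<mu>.variance_positive[of "J_hat f"] square var_nonneg[of f]
    by (simp add: power_mult_distrib)
  then show "\<bar>\<integral>\<eta>. J_hat f \<eta> \<partial>\<mu>\<bar> \<le> \<epsilon> * sqrt (var f)"
    using gap(1) var_nonneg[of f] by (simp add: abs_le_square_iff[symmetric])
  have "(\<integral>\<eta>. 2 * \<epsilon> * ((f \<eta> - mean f) * J_hat f \<eta>) \<partial>\<mu>)
      \<le> (\<integral>\<eta>. \<epsilon>\<^sup>2 * (f \<eta> - mean f)\<^sup>2 + (J_hat f \<eta>)\<^sup>2 \<partial>\<mu>)"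
  proof (rule integral_mono)
    fix \<eta>
    show "2 * \<epsilon> * ((f \<eta> - mean f) * J_hat f \<eta>) \<le> \<epsilon>\<^sup>2 * (f \<eta> - mean f)\<^sup>2 + (J_hat f \<eta>)\<^sup>2"
      using sum_squares_bound[of "\<epsilon> * (f \<eta> - mean f)" "J_hat f \<eta>"]
      by (simp add: power_mult_distrib mult.assoc)
  qed simp_all
  also have "\<dots> = \<epsilon>\<^sup>2 * var f + (\<integral>\<eta>. (J_hat f \<eta>)\<^sup>2 \<partial>\<mu>)"
    by (simp add: var_eq)
  also have "\<dots> \<le> 2 * \<epsilon> * (\<epsilon> * var f)"
    using square by (simp add: power2_eq_square)
  finally show "(\<integral>\<eta>. (f \<eta> - mean f) * J_hat f \<eta> \<partial>\<mu>) \<le> \<epsilon> * var f"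
    using gap(1) by simp
qed

text \<open>The energy estimate: the spectral gap of the environment beats the perturbation, the jumps
  \<^term>\<open>J\<close> can only help, and the mean moves under the perturbation alone.\<close>

lemma generator_form:
  assumes "pert.generates f g"
  shows "form f g - mean f * mean g \<le> - (\<gamma> - \<epsilon>) * var f" "\<bar>mean g\<bar> \<le> \<epsilon> * sqrt (var f)"
proof -
  have "(apply_bcontfun f, apply_bcontfun g) \<in> C_generator (transition P Z)"
    using assms by (simp add: pert.generates_iff)
  then obtain h where h: "(apply_bcontfun f, h) \<in> C_generator (transition P \<sigma>)"
    and g: "apply_bcontfun g = (\<lambda>\<eta>. h \<eta> + J f \<eta> + J_hat f \<eta>)"
    using pert_generator by blast
  have "continuous_on UNIV h"
    using h by (auto simp: C_generator_def)
  then have continuous: "continuous_on UNIV h" "continuous_on UNIV (J f)" "continuous_on UNIV (J_hat f)"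
    by (auto intro: J_continuous J_hat_continuous)
  note [simp] = integrable_C continuous continuous_intros
  have "mean g = (\<integral>\<eta>. J_hat f \<eta> \<partial>\<mu>)"
    using integral_env_generator[OF h] by (simp add: g)
  then show "\<bar>mean g\<bar> \<le> \<epsilon> * sqrt (var f)"
    using J_hat_form(1)[of f] by simp
  have "form f g - mean f * mean g = (\<integral>\<eta>. (f \<eta> - mean f) * g \<eta> \<partial>\<mu>)"
    by (rule form_centered[symmetric])
  also have "\<dots> = (\<integral>\<eta>. (f \<eta> - mean f) * h \<eta> +
      (f \<eta> * J f \<eta> - mean f * J f \<eta>) + (f \<eta> - mean f) * J_hat f \<eta> \<partial>\<mu>)"
    unfolding g
    by (rule Bochner_Integration.integral_cong) (simp_all add: algebra_simps)
  also have "\<dots> = (\<integral>\<eta>. (f \<eta> - mean f) * h \<eta> \<partial>\<mu>) +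
      ((\<integral>\<eta>. f \<eta> * J f \<eta> \<partial>\<mu>) - mean f * (\<integral>\<eta>. J f \<eta> \<partial>\<mu>)) +
      (\<integral>\<eta>. (f \<eta> - mean f) * J_hat f \<eta> \<partial>\<mu>)"
    by simp
  also have "\<dots> \<le> - (\<gamma> * var f) + 0 + \<epsilon> * var f"
    using poincare[OF h] J_dissipative[of f] J_hat_form(2)[of f] integral_J[of f]
    by (simp add: var_eq)
  finally show "form f g - mean f * mean g \<le> - (\<gamma> - \<epsilon>) * var f"
    by (simp add: algebra_simps)
qed

text \<open>Gronwall's inequality for the variance along an orbit.\<close>

lemma var_decay:
  assumes "pert.generates f g" "t \<ge> 0"
  shows "var (pert.T t f) \<le> exp (- 2 * (\<gamma> - \<epsilon>) * t) * var f"
proof -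
  define \<phi> where "\<phi> s = exp (2 * (\<gamma> - \<epsilon>) * s) * var (pert.T s f)" for s
  define \<phi>' where "\<phi>' s = exp (2 * (\<gamma> - \<epsilon>) * s) * (2 * (\<gamma> - \<epsilon>) * var (pert.T s f) +
    2 * (form (pert.T s f) (pert.T s g) - mean (pert.T s f) * mean (pert.T s g)))" for s
  have "\<phi> t \<le> \<phi> 0"
  proof (rule nonincreasing_on_half_line[where \<phi> = \<phi> and \<phi>' = \<phi>'])
    fix s :: real
    assume "s \<ge> 0"
    note orbit = pert.orbit_has_vector_derivative[OF assms(1) \<open>s \<ge> 0\<close>]
    have "((\<lambda>s. form (pert.T s f) (pert.T s f)) has_real_derivative
        form (pert.T s f) (pert.T s g) + form (pert.T s g) (pert.T s f)) (at s within {0..})"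
      unfolding has_real_derivative_iff_has_vector_derivative
      by (rule form.has_vector_derivative[OF orbit orbit])
    moreover have "((\<lambda>s. mean (pert.T s f)) has_real_derivative mean (pert.T s g)) (at s within {0..})"
      unfolding has_real_derivative_iff_has_vector_derivative
      by (rule mean.has_vector_derivative[OF orbit])
    ultimately show "(\<phi> has_real_derivative \<phi>' s) (at s within {0..})"
      unfolding \<phi>_def \<phi>'_def var_def
      by (auto intro!: derivative_eq_intros simp: form_commute algebra_simps)
    have "form (pert.T s f) (pert.T s g) - mean (pert.T s f) * mean (pert.T s g)
        \<le> - (\<gamma> - \<epsilon>) * var (pert.T s f)"
      using pert.generates_orbit[OF assms(1) \<open>s \<ge> 0\<close>] by (rule generator_form)
    then have "2 * (\<gamma> - \<epsilon>) * var (pert.T s f) +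
        2 * (form (pert.T s f) (pert.T s g) - mean (pert.T s f) * mean (pert.T s g)) \<le> 0"
      by argo
    then show "\<phi>' s \<le> 0"
      unfolding \<phi>'_def by (intro mult_nonneg_nonpos) auto
  qed (use assms in auto)
  then have "exp (2 * (\<gamma> - \<epsilon>) * t) * var (pert.T t f) \<le> var f"
    by (simp add: \<phi>_def pert.T_0)
  moreover have "exp (- 2 * (\<gamma> - \<epsilon>) * t) = 1 / exp (2 * (\<gamma> - \<epsilon>) * t)"
    by (simp add: exp_minus[symmetric] inverse_eq_divide[symmetric] algebra_simps)
  ultimately show ?thesis
    by (simp add: pos_le_divide_eq mult.commute)
qed

text \<open>The integral of \<^term>\<open>\<epsilon> * exp (- (\<gamma> - \<epsilon>) * t)\<close> over
  positive times \<^term>\<open>t\<close>, that is, a bound on the total movement of the mean per unit of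
  initial standard deviation.\<close>

definition rate :: real where
  "rate = \<epsilon> / (\<gamma> - \<epsilon>)"

text \<open>The mean moves at a speed of at most \<^term>\<open>\<epsilon>\<close> standard deviations, which
  decay exponentially.\<close>

lemma mean_cauchy:
  assumes "pert.generates f g" "0 \<le> s" "s \<le> t"
  shows "\<bar>mean (pert.T t f) - mean (pert.T s f)\<bar> \<le> rate * exp (- (\<gamma> - \<epsilon>) * s) * sqrt (var f)"
proof -
  define E where "E s = rate * exp (- (\<gamma> - \<epsilon>) * s) * sqrt (var f)" for s
  have "c * mean (pert.T t f) + E t \<le> c * mean (pert.T s f) + E s" if "\<bar>c\<bar> = 1" for c
  proof (rule nonincreasing_on_half_line[OF _ _ assms(2,3)])
    fix s :: real
    assume "s \<ge> 0"
    have "((\<lambda>s. mean (pert.T s f)) has_real_derivative mean (pert.T s g)) (at s within {0..})"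
      unfolding has_real_derivative_iff_has_vector_derivative
      by (rule mean.has_vector_derivative[OF pert.orbit_has_vector_derivative[OF assms(1) \<open>s \<ge> 0\<close>]])
    then show "((\<lambda>s. c * mean (pert.T s f) + E s) has_real_derivative
        c * mean (pert.T s g) - (\<gamma> - \<epsilon>) * E s) (at s within {0..})"
      unfolding E_def by (auto intro!: derivative_eq_intros simp: algebra_simps)
    have "sqrt (var (pert.T s f)) \<le> sqrt ((exp (- (\<gamma> - \<epsilon>) * s))\<^sup>2 * var f)"
      using var_decay[OF assms(1) \<open>s \<ge> 0\<close>]
      by (simp add: exp_double[symmetric] algebra_simps)
    then have "\<epsilon> * sqrt (var (pert.T s f)) \<le> \<epsilon> * (exp (- (\<gamma> - \<epsilon>) * s) * sqrt (var f))"
      using gap(1) by (simp add: real_sqrt_mult)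
    also have "\<dots> = (\<gamma> - \<epsilon>) * E s"
      using gap by (simp add: E_def rate_def)
    finally have "\<bar>mean (pert.T s g)\<bar> \<le> (\<gamma> - \<epsilon>) * E s"
      using generator_form(2)[OF pert.generates_orbit[OF assms(1) \<open>s \<ge> 0\<close>]] by linarith
    moreover have "c * mean (pert.T s g) \<le> \<bar>mean (pert.T s g)\<bar>"
      using that abs_mult[of c "mean (pert.T s g)"] by simp
    ultimately show "c * mean (pert.T s g) - (\<gamma> - \<epsilon>) * E s \<le> 0"
      by simp
  qed
  from this[of 1] this[of "-1"] have "\<bar>mean (pert.T t f) - mean (pert.T s f)\<bar> \<le> E s - E t"
    by simp
  moreover have "E t \<ge> 0"
    using gap var_nonneg by (simp add: E_def rate_def)
  ultimately show ?thesis
    by (simp add: E_def)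
qed

text \<open>The orbit of \<^term>\<open>f\<close> approaches its \<^term>\<open>\<mu>\<close>-means in
  \<open>L\<^sup>2\<close>, hence almost everywhere along a subsequence, with respect to
  \<^term>\<open>\<mu>\<close> and therefore to \<^term>\<open>\<nu>\<close>. As \<^term>\<open>\<nu>\<close> is
  invariant, the means can only converge to the \<^term>\<open>\<nu>\<close>-integral of
  \<^term>\<open>f\<close>.\<close>

lemma mean_relaxation_domain:
  assumes "pert.generates f g" "t \<ge> 0"
  shows "\<bar>mean (pert.T t f) - (\<integral>\<eta>. f \<eta> \<partial>\<nu>)\<bar> \<le> rate * exp (- (\<gamma> - \<epsilon>) * t) * sqrt (var f)"
proof -
  interpret \<nu>: prob_space \<nu> by (rule \<nu>)
  define u where "u n \<eta> = pert.T (real n) f \<eta> - mean (pert.T (real n) f)" for n \<eta>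
  have u_continuous: "continuous_on UNIV (u n)" for n
    unfolding u_def by (intro continuous_intros) auto
  have bounds: "\<bar>u n \<eta>\<bar> \<le> 2 * norm f" for n \<eta>
  proof -
    have "norm (pert.T (real n) f) \<le> norm f"
      by (rule pert.contraction) simp
    moreover have "\<bar>mean (pert.T (real n) f)\<bar> \<le> norm (pert.T (real n) f)"
      using continuous_bounds(2) by (intro \<mu>.abs_integral_le integrable_C) auto
    ultimately show ?thesis
      using continuous_bounds(2)[of "pert.T (real n) f" \<eta>] by (simp add: u_def)
  qed
  have L1_le: "(\<integral>\<eta>. norm (u n \<eta>) \<partial>\<mu>) \<le> sqrt (var (pert.T (real n) f))" for n
  proof -
    note [simp] = integrable_C continuous_intros u_continuous
    have "(\<integral>\<eta>. norm (u n \<eta>) \<partial>\<mu>)\<^sup>2 \<le> (\<integral>\<eta>. (u n \<eta>)\<^sup>2 \<partial>\<mu>)"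
      using \<mu>.variance_eq[of "\<lambda>\<eta>. \<bar>u n \<eta>\<bar>"] \<mu>.variance_positive[of "\<lambda>\<eta>. \<bar>u n \<eta>\<bar>"] by simp
    then show ?thesis
      by (simp add: var_eq u_def real_le_rsqrt)
  qed
  have "(\<lambda>n. exp (- 2 * (\<gamma> - \<epsilon>)) ^ n) \<longlonglongrightarrow> 0"
    using gap by (intro LIMSEQ_realpow_zero) auto
  then have "(\<lambda>n. sqrt (exp (- 2 * (\<gamma> - \<epsilon>) * real n) * var f)) \<longlonglongrightarrow> sqrt (0 * var f)"
    unfolding exp_of_nat2_mult by (intro tendsto_real_sqrt tendsto_mult_right)
  then have vanishing: "(\<lambda>n. sqrt (exp (- 2 * (\<gamma> - \<epsilon>) * real n) * var f)) \<longlonglongrightarrow> 0"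
    by simp
  have "(\<lambda>n. \<integral>\<eta>. norm (u n \<eta>) \<partial>\<mu>) \<longlonglongrightarrow> 0"
  proof (rule Lim_null_comparison[OF _ vanishing], rule always_eventually, rule allI)
    fix n
    have "(\<integral>\<eta>. norm (u n \<eta>) \<partial>\<mu>) \<le> sqrt (exp (- 2 * (\<gamma> - \<epsilon>) * real n) * var f)"
      using L1_le[of n] var_decay[OF assms(1), of "real n"]
      by (meson of_nat_0_le_iff order_trans real_sqrt_le_iff)
    then show "norm (\<integral>\<eta>. norm (u n \<eta>) \<partial>\<mu>) \<le> sqrt (exp (- 2 * (\<gamma> - \<epsilon>) * real n) * var f)"
      by simp
  qed
  then obtain k :: "nat \<Rightarrow> nat" where k: "strict_mono k" and "AE \<eta> in \<mu>. (\<lambda>n. u (k n) \<eta>) \<longlonglongrightarrow> 0"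
    using tendsto_L1_AE_subseq[of \<mu> u] integrable_C[OF u_continuous] by blast
  then have ae: "AE \<eta> in \<nu>. (\<lambda>n. u (k n) \<eta>) \<longlonglongrightarrow> 0"
    using absolutely_continuous_AE[OF _ \<nu>_ac] \<mu>(2) \<nu>(2) by simp
  have "(\<lambda>n. \<integral>\<eta>. u (k n) \<eta> \<partial>\<nu>) \<longlonglongrightarrow> (\<integral>\<eta>. 0 \<partial>\<nu>)"
    using ae bounds u_continuous \<nu>(2)
    by (intro integral_dominated_convergence[where w = "\<lambda>_. 2 * norm f"])
      (auto intro: borel_measurable_continuous_onI cong: measurable_cong_sets)
  moreover have "(\<integral>\<eta>. u (k n) \<eta> \<partial>\<nu>) = (\<integral>\<eta>. f \<eta> \<partial>\<nu>) - mean (pert.T (real (k n)) f)" for n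
  proof -
    have "(\<integral>\<eta>. pert.T (real (k n)) f \<eta> \<partial>\<nu>) = (\<integral>\<eta>. f \<eta> \<partial>\<nu>)"
      using pert.integral_invariant[OF \<nu> \<nu>_invariant continuous_bounds, of "real (k n)"]
      by (simp add: pert.apply_T)
    then show ?thesis
      using integrable_continuous[OF \<nu>.finite_measure_axioms \<nu>(2)]
      by (simp add: u_def \<nu>.prob_space)
  qed
  ultimately have "(\<lambda>n. (\<integral>\<eta>. f \<eta> \<partial>\<nu>) - mean (pert.T (real (k n)) f)) \<longlonglongrightarrow> 0"
    by simp
  then have "(\<lambda>n. mean (pert.T t f) - ((\<integral>\<eta>. f \<eta> \<partial>\<nu>) - ((\<integral>\<eta>. f \<eta> \<partial>\<nu>) - mean (pert.T (real (k n)) f))))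
      \<longlonglongrightarrow> mean (pert.T t f) - ((\<integral>\<eta>. f \<eta> \<partial>\<nu>) - 0)"
    by (intro tendsto_intros)
  then have "(\<lambda>n. \<bar>mean (pert.T t f) - mean (pert.T (real (k n)) f)\<bar>)
      \<longlonglongrightarrow> \<bar>mean (pert.T t f) - (\<integral>\<eta>. f \<eta> \<partial>\<nu>)\<bar>"
    by (intro tendsto_rabs) simp
  moreover have "\<forall>\<^sub>F n in sequentially. \<bar>mean (pert.T t f) - mean (pert.T (real (k n)) f)\<bar>
      \<le> rate * exp (- (\<gamma> - \<epsilon>) * t) * sqrt (var f)"
  proof (rule eventually_sequentiallyI[of "nat \<lceil>t\<rceil>"])
    fix n
    assume "n \<ge> nat \<lceil>t\<rceil>"
    then have "t \<le> real (k n)"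
      using seq_suble[OF k, of n] by linarith
    then show "\<bar>mean (pert.T t f) - mean (pert.T (real (k n)) f)\<bar>
        \<le> rate * exp (- (\<gamma> - \<epsilon>) * t) * sqrt (var f)"
      using mean_cauchy[OF assms, of "real (k n)"] by (simp add: abs_minus_commute)
  qed
  ultimately show ?thesis
    by (rule tendsto_upperbound) simp
qed

lemma mean_relaxation:
  assumes "t \<ge> 0"
  shows "\<bar>mean (pert.T t f) - (\<integral>\<eta>. f \<eta> \<partial>\<nu>)\<bar> \<le> rate * exp (- (\<gamma> - \<epsilon>) * t) * norm f"
proof (rule field_le_epsilon)
  fix e :: real
  assume "e > 0"
  define k where "k = rate * exp (- (\<gamma> - \<epsilon>) * t)"
  have "k \<ge> 0"
    using gap by (simp add: k_def rate_def)
  obtain f' g' where f': "pert.generates f' g'" "norm (f' - f) < e / (k + 2)"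
    using pert.dense_domain[of "e / (k + 2)" f] \<open>e > 0\<close> \<open>k \<ge> 0\<close> by auto
  have integral_diff: "\<bar>(\<integral>\<eta>. h \<eta> \<partial>\<rho>) - (\<integral>\<eta>. h' \<eta> \<partial>\<rho>)\<bar> \<le> norm (h - h')"
    if "prob_space \<rho>" "sets \<rho> = sets borel" for h h' :: "'a \<Rightarrow>\<^sub>C real" and \<rho>
  proof -
    interpret \<rho>: prob_space \<rho> by fact
    note int = integrable_continuous[OF \<rho>.finite_measure_axioms that(2)]
    show ?thesis
      using \<rho>.abs_integral_le[OF int, of "h - h'"] continuous_bounds(2)[of "h - h'"] int[of h] int[of h']
      by simp
  qed
  have "norm (pert.T t f - pert.T t f') \<le> norm (f' - f)"
    using pert.contraction[OF assms, of "f - f'"] linear_diff[OF pert.linear[OF assms]]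
    by (simp add: norm_minus_commute)
  then have "\<bar>mean (pert.T t f) - mean (pert.T t f')\<bar> \<le> norm (f' - f)"
    using integral_diff[OF \<mu>, of "pert.T t f" "pert.T t f'"] by linarith
  moreover have "\<bar>(\<integral>\<eta>. f \<eta> \<partial>\<nu>) - (\<integral>\<eta>. f' \<eta> \<partial>\<nu>)\<bar> \<le> norm (f' - f)"
    using integral_diff[OF \<nu>, of f f'] by (simp add: norm_minus_commute)
  moreover have "\<bar>mean (pert.T t f') - (\<integral>\<eta>. f' \<eta> \<partial>\<nu>)\<bar> \<le> k * norm f + k * norm (f' - f)"
  proof -
    have "sqrt (var f') \<le> norm f'"
      using var_le[of f'] by (simp add: real_le_lsqrt)
    also have "\<dots> \<le> norm f + norm (f' - f)"
      using norm_triangle_sub[of f' f] by simp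
    finally have "k * sqrt (var f') \<le> k * (norm f + norm (f' - f))"
      using \<open>k \<ge> 0\<close> by (rule mult_left_mono)
    then show ?thesis
      using mean_relaxation_domain[OF f'(1) assms] by (simp add: k_def distrib_left)
  qed
  ultimately have "\<bar>mean (pert.T t f) - (\<integral>\<eta>. f \<eta> \<partial>\<nu>)\<bar> \<le> k * norm f + (k + 2) * norm (f' - f)"
    by (simp add: distrib_right)
  also have "(k + 2) * norm (f' - f) \<le> (k + 2) * (e / (k + 2))"
    using f'(2) \<open>k \<ge> 0\<close> by (intro mult_left_mono) auto
  also have "\<dots> = e"
    using \<open>k \<ge> 0\<close> by simp
  finally show "\<bar>mean (pert.T t f) - (\<integral>\<eta>. f \<eta> \<partial>\<nu>)\<bar> \<le> rate * exp (- (\<gamma> - \<epsilon>) * t) * norm f + e"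
    by (simp add: k_def)
qed

text \<open>A bound for all continuous functions in terms of the sup norm is a bound on the total variation
  distance.\<close>

lemma relaxation:
  assumes "t \<ge> 0" and f: "f \<in> borel_measurable borel" "\<And>\<eta>. \<bar>f \<eta>\<bar> \<le> c"
  shows "\<bar>(\<integral>w. f (Z t w) \<partial>(\<mu> \<bind> P)) - (\<integral>\<eta>. f \<eta> \<partial>\<nu>)\<bar> \<le> rate * exp (- (\<gamma> - \<epsilon>) * t) * c"
proof -
  note [measurable] = pert.Y_measurable[OF assms(1)]
  have start: "prob_space (\<mu> \<bind> P)" and [measurable_cong]: "sets (\<mu> \<bind> P) = sets M"
    using pert.prob_space_start[OF \<mu>] pert.sets_start[OF \<mu>] by auto
  define \<mu>t where "\<mu>t = distr (\<mu> \<bind> P) borel (Z t)"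
  have \<mu>t: "prob_space \<mu>t" "sets \<mu>t = sets borel"
    unfolding \<mu>t_def using start by (auto intro: prob_space.prob_space_distr)
  have law: "(\<integral>w. h (Z t w) \<partial>(\<mu> \<bind> P)) = (\<integral>\<eta>. h \<eta> \<partial>\<mu>t)" if "h \<in> borel_measurable borel"
    for h :: "'a \<Rightarrow> real"
    unfolding \<mu>t_def using that by (intro integral_distr[symmetric]) auto
  have "0 \<le> rate * exp (- (\<gamma> - \<epsilon>) * t)"
    using gap by (simp add: rate_def)
  have "\<bar>(\<integral>\<eta>. f \<eta> \<partial>\<mu>t) - (\<integral>\<eta>. f \<eta> \<partial>\<nu>)\<bar> \<le> rate * exp (- (\<gamma> - \<epsilon>) * t) * c"
  proof (rule continuous_test_functions_suffice[OF \<mu>t \<nu> _ \<open>0 \<le> rate * exp (- (\<gamma> - \<epsilon>) * t)\<close> f])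
    fix h :: "'a \<Rightarrow>\<^sub>C real"
    have "(\<integral>\<eta>. h \<eta> \<partial>\<mu>t) = mean (pert.T t h)"
      using pert.integral_transition[OF \<mu> continuous_bounds \<open>t \<ge> 0\<close>] law[OF continuous_bounds(1)]
      by (simp add: pert.apply_T[OF \<open>t \<ge> 0\<close>])
    then show "\<bar>(\<integral>\<eta>. h \<eta> \<partial>\<mu>t) - (\<integral>\<eta>. h \<eta> \<partial>\<nu>)\<bar> \<le> rate * exp (- (\<gamma> - \<epsilon>) * t) * norm h"
      using mean_relaxation[OF \<open>t \<ge> 0\<close>] by simp
  qed
  then show ?thesis
    using law[OF f(1)] by simp
qed

end

section \<open>Jump operators on the configuration space\<close>

subsection \<open>The lattice\<close>

lemma norm_inf_le_iff: "norm_inf x \<le> R \<longleftrightarrow> (\<forall>i. real_of_int \<bar>x $ i\<bar> \<le> R)"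
proof
  assume "norm_inf x \<le> R"
  moreover have "real_of_int \<bar>x $ i\<bar> \<le> norm_inf x" for i
    unfolding norm_inf_def by (intro of_int_le_iff[THEN iffD2] Max_ge) auto
  ultimately show "\<forall>i. real_of_int \<bar>x $ i\<bar> \<le> R"
    using order_trans by blast
next
  assume *: "\<forall>i. real_of_int \<bar>x $ i\<bar> \<le> R"
  have "Max (range (\<lambda>i. \<bar>x $ i\<bar>)) \<in> range (\<lambda>i. \<bar>x $ i\<bar>)"
    by (intro Max_in) auto
  then obtain i where "Max (range (\<lambda>i. \<bar>x $ i\<bar>)) = \<bar>x $ i\<bar>"
    by (rule rangeE)
  then show "norm_inf x \<le> R"
    unfolding norm_inf_def using * by metis
qed

lemma norm_inf_coordinate: "real_of_int \<bar>x $ i\<bar> \<le> norm_inf x"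
  using norm_inf_le_iff[of x "norm_inf x"] by simp

lemma norm_inf_nonneg: "norm_inf x \<ge> 0"
  using norm_inf_coordinate[of x undefined] by linarith

lemma norm_inf_0: "norm_inf (0 :: int ^ 'd) = 0"
  using norm_inf_nonneg[of "0 :: int ^ 'd"] norm_inf_le_iff[of "0 :: int ^ 'd" 0] by simp

lemma norm_inf_minus: "norm_inf (- x) = norm_inf x"
  by (simp add: norm_inf_def)

lemma norm_inf_add_le: "norm_inf (x + y) \<le> norm_inf x + norm_inf y"
proof -
  have "real_of_int \<bar>(x + y) $ i\<bar> \<le> norm_inf x + norm_inf y" for i
  proof -
    have "real_of_int \<bar>(x + y) $ i\<bar> \<le> real_of_int \<bar>x $ i\<bar> + real_of_int \<bar>y $ i\<bar>"
      by simp
    also have "\<dots> \<le> norm_inf x + norm_inf y"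
      by (intro add_mono norm_inf_coordinate)
    finally show ?thesis .
  qed
  then show ?thesis
    by (simp add: norm_inf_le_iff)
qed

lemma norm_inf_add_ge: "norm_inf x - norm_inf y \<le> norm_inf (x + y)"
  using norm_inf_add_le[of "x + y" "- y"] by (simp add: norm_inf_minus)

lemma finite_sup_ball: "finite (sup_ball R)"
proof -
  have "vec_nth ` sup_ball R \<subseteq> (\<Pi>\<^sub>E i \<in> UNIV. {- \<lceil>R\<rceil>..\<lceil>R\<rceil>})"
  proof (rule image_subsetI)
    fix x :: "int ^ 'd"
    assume "x \<in> sup_ball R"
    then have "real_of_int \<bar>x $ i\<bar> \<le> R" for i
      by (auto simp: sup_ball_def norm_inf_le_iff)
    then have "\<bar>x $ i\<bar> \<le> \<lceil>R\<rceil>" for i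
      by (metis ceiling_mono ceiling_of_int)
    then show "vec_nth x \<in> (\<Pi>\<^sub>E i \<in> UNIV. {- \<lceil>R\<rceil>..\<lceil>R\<rceil>})"
      by (auto simp: abs_le_iff minus_le_iff)
  qed
  then have "finite (vec_nth ` sup_ball R)"
    by (rule finite_subset) (intro finite_PiE; simp)
  then show ?thesis
    by (rule finite_imageD) (auto simp: inj_on_def vec_eq_iff)
qed

lemma open_lattice: "open (A :: (int ^ 'd) set)"
proof -
  have "open {x}" for x :: "int ^ 'd"
    unfolding open_vec_def
    by (intro ballI exI[of _ "\<lambda>i. {x $ i}"]) (auto simp: vec_eq_iff intro: discrete_topology_class.open_discrete)
  then have "open (\<Union>x\<in>A. {x})"
    by blast
  then show ?thesis by simp
qed

lemma lattice_measurable: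
  fixes X :: "'w \<Rightarrow> int ^ 'd"
  shows "X \<in> M \<rightarrow>\<^sub>M borel \<longleftrightarrow> X \<in> M \<rightarrow>\<^sub>M count_space UNIV"
proof -
  have "sets (borel :: (int ^ 'd) measure) = sets (count_space UNIV)"
    using borel_open[OF open_lattice] by auto
  from measurable_cong_sets[OF refl this] show ?thesis
    by blast
qed

lemma compact_configurations:
  assumes "compact (UNIV :: 's::topological_space set)"
  shows "compact (UNIV :: ('i \<Rightarrow> 's) set)"
proof -
  have "compact_space (product_topology (\<lambda>_. euclidean :: 's topology) (UNIV :: 'i set))"
    unfolding compact_space_product_topology using assms by (simp add: compact_space_def)
  then show ?thesis
    by (simp add: euclidean_product_topology compact_space_def)
qed

lemma continuous_translate: "continuous_on UNIV (translate x)"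
  unfolding translate_def[abs_def]
  by (intro continuous_on_coordinatewise_then_product) simp

lemma continuous_translate_comp:
  fixes f :: "(int ^ 'd \<Rightarrow> 's::topological_space) \<Rightarrow> real"
  assumes "continuous_on UNIV f"
  shows "continuous_on UNIV (\<lambda>\<eta>. f (translate x \<eta>))"
  using continuous_on_compose2[OF assms continuous_translate] by auto

lemma translate_measurable: "translate x \<in> borel \<rightarrow>\<^sub>M borel"
  using continuous_translate by (rule borel_measurable_continuous_onI)

lemma translate_translate: "translate x (translate y \<eta>) = translate (x + y) \<eta>"
  by (simp add: translate_def fun_eq_iff add_ac)

subsection \<open>Jumps of finite range\<close>

locale finite_range_rates =
  fixes q :: "int ^ 'd \<Rightarrow> (int ^ 'd \<Rightarrow> 's::polish_space) \<Rightarrow> real" and R :: real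
  assumes compact_spins: "compact (UNIV :: 's set)"
    and continuous: "continuous_on UNIV (q y)"
    and range: "y \<notin> sup_ball R \<Longrightarrow> q y \<eta> = 0"
begin

lemma jump_operator_eq:
  "jump_operator q f \<eta> = (\<Sum>y\<in>sup_ball R. q y \<eta> * (f (translate y \<eta>) - f \<eta>))"
proof -
  have "jump_operator q f \<eta> = (\<Sum>\<^sub>\<infinity>y\<in>sup_ball R. q y \<eta> * (f (translate y \<eta>) - f \<eta>))"
    unfolding jump_operator_def by (rule infsum_cong_neutral) (auto simp: range)
  then show ?thesis
    by (simp add: finite_sup_ball)
qed

lemma bounded_rates: "\<exists>\<rho>>0. \<forall>y \<eta>. \<bar>q y \<eta>\<bar> \<le> \<rho>"
proof -
  have "\<exists>b. \<forall>\<eta>. \<bar>q y \<eta>\<bar> \<le> b" for y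
  proof -
    have "compact (range (q y))"
      using continuous compact_configurations[OF compact_spins] by (rule compact_continuous_image)
    then have "bounded (range (q y))"
      by (rule compact_imp_bounded)
    then show ?thesis
      by (auto simp: bounded_iff)
  qed
  then obtain b where b: "\<And>y \<eta>. \<bar>q y \<eta>\<bar> \<le> b y"
    by metis
  have "\<bar>q y \<eta>\<bar> \<le> 1 + (\<Sum>y\<in>sup_ball R. \<bar>b y\<bar>)" for y \<eta>
  proof (cases "y \<in> sup_ball R")
    case True
    then have "\<bar>b y\<bar> \<le> (\<Sum>y\<in>sup_ball R. \<bar>b y\<bar>)"
      by (intro member_le_sum) (auto simp: finite_sup_ball)
    then show ?thesis
      using b[of y \<eta>] by linarith
  next
    case False
    then show ?thesis
      by (simp add: range sum_nonneg add_nonneg_nonneg)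
  qed
  moreover have "1 + (\<Sum>y\<in>sup_ball R. \<bar>b y\<bar>) > 0"
    by (simp add: sum_nonneg add_pos_nonneg)
  ultimately show ?thesis by blast
qed

lemma jump_operator_continuous:
  "continuous_on UNIV f \<Longrightarrow> continuous_on UNIV (jump_operator q f)"
  unfolding jump_operator_eq[abs_def]
  by (intro continuous_intros continuous continuous_translate_comp)

lemma jump_operator_diff:
  "jump_operator q (\<lambda>\<eta>. f \<eta> - g \<eta>) \<eta> = jump_operator q f \<eta> - jump_operator q g \<eta>"
  by (simp add: jump_operator_eq sum_subtractf[symmetric] algebra_simps)

lemma jump_operator_scale: "jump_operator q (\<lambda>\<eta>. c * f \<eta>) \<eta> = c * jump_operator q f \<eta>"
  by (simp add: jump_operator_eq sum_distrib_left algebra_simps)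

lemma jump_operator_shift: "jump_operator q (\<lambda>\<eta>. f \<eta> - c) = jump_operator q f"
  by (simp add: jump_operator_eq fun_eq_iff)

lemma jump_operator_bounded:
  assumes \<rho>: "\<And>y \<eta>. \<bar>q y \<eta>\<bar> \<le> \<rho>" and c: "\<And>\<eta>. \<bar>f \<eta>\<bar> \<le> c"
  shows "\<bar>jump_operator q f \<eta>\<bar> \<le> (real (card (sup_ball R :: (int ^ 'd) set)) * \<rho> * 2) * c"
proof -
  have "\<bar>jump_operator q f \<eta>\<bar> \<le> (\<Sum>y\<in>sup_ball R. \<bar>q y \<eta> * (f (translate y \<eta>) - f \<eta>)\<bar>)"
    unfolding jump_operator_eq by (rule sum_abs)
  also have "\<dots> \<le> (\<Sum>y\<in>(sup_ball R :: (int ^ 'd) set). \<rho> * (2 * c))"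
  proof (rule sum_mono)
    fix y
    have "\<bar>f (translate y \<eta>) - f \<eta>\<bar> \<le> 2 * c"
      using c[of \<eta>] c[of "translate y \<eta>"] by linarith
    then show "\<bar>q y \<eta> * (f (translate y \<eta>) - f \<eta>)\<bar> \<le> \<rho> * (2 * c)"
      unfolding abs_mult using \<rho>[of y \<eta>] by (intro mult_mono) auto
  qed
  finally show ?thesis
    by (simp add: algebra_simps)
qed

text \<open>The difference of the two sides is the square field
  \<^term>\<open>\<Sum>y\<in>sup_ball R. q y \<eta> * (f (translate y \<eta>) - f \<eta>)\<^sup>2\<close>.\<close>

lemma jump_operator_square:
  assumes "\<And>y \<eta>. q y \<eta> \<ge> 0"
  shows "2 * f \<eta> * jump_operator q f \<eta> \<le> jump_operator q (\<lambda>\<eta>. f \<eta> * f \<eta>) \<eta>"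
proof -
  have "jump_operator q (\<lambda>\<eta>. f \<eta> * f \<eta>) \<eta> - 2 * f \<eta> * jump_operator q f \<eta> =
      (\<Sum>y\<in>sup_ball R. q y \<eta> * (f (translate y \<eta>) - f \<eta>)\<^sup>2)"
    by (simp add: jump_operator_eq sum_distrib_left sum_subtractf[symmetric] power2_eq_square
        algebra_simps)
  also have "\<dots> \<ge> 0"
    using assms by (intro sum_nonneg mult_nonneg_nonneg) auto
  finally show ?thesis by simp
qed

context
  fixes \<mu> :: "(int ^ 'd \<Rightarrow> 's) measure"
  assumes \<mu>: "prob_space \<mu>" "sets \<mu> = sets borel" and shift: "distr \<mu> borel (translate x) = \<mu>"
begin

lemma integral_translate:
  assumes "f \<in> borel_measurable borel"
  shows "(\<integral>\<eta>. f (translate x \<eta>) \<partial>\<mu>) = (\<integral>\<eta>. f \<eta> \<partial>\<mu> :: real)"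
    "integrable \<mu> (\<lambda>\<eta>. f (translate x \<eta>)) \<longleftrightarrow> integrable \<mu> f"
proof -
  have [measurable]: "translate x \<in> \<mu> \<rightarrow>\<^sub>M borel"
    using translate_measurable \<mu>(2) by (simp cong: measurable_cong_sets)
  show "(\<integral>\<eta>. f (translate x \<eta>) \<partial>\<mu>) = (\<integral>\<eta>. f \<eta> \<partial>\<mu>)"
    using integral_distr[of "translate x" \<mu> borel f] assms by (simp add: shift)
  show "integrable \<mu> (\<lambda>\<eta>. f (translate x \<eta>)) \<longleftrightarrow> integrable \<mu> f"
    using integrable_distr_eq[of "translate x" \<mu> borel f] assms by (simp add: shift)
qed

text \<open>By translation invariance every shifted copy of \<^term>\<open>f\<close> has the same second moment.
  The constant is crude; its existence is what makes the supremum in the operator norm meaningful.\<close>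

lemma jump_operator_L2_bounded:
  assumes \<rho>: "\<And>y \<eta>. \<bar>q y \<eta>\<bar> \<le> \<rho>" and f: "square_integrable \<mu> f"
  shows "(\<integral>\<eta>. (jump_operator q f \<eta>)\<^sup>2 \<partial>\<mu>)
    \<le> (2 * \<rho> * real (card (sup_ball R :: (int ^ 'd) set)))\<^sup>2 * (\<integral>\<eta>. (f \<eta>)\<^sup>2 \<partial>\<mu>)"
proof -
  let ?B = "sup_ball R :: (int ^ 'd) set"
  have [measurable]: "f \<in> borel_measurable borel"
    using f \<mu>(2) by (simp add: square_integrable_def cong: measurable_cong_sets)
  have int: "integrable \<mu> (\<lambda>\<eta>. (f \<eta>)\<^sup>2)"
    using f by (simp add: square_integrable_def)
  then have int_translate: "integrable \<mu> (\<lambda>\<eta>. (f (translate y \<eta>))\<^sup>2)" for y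
    using integral_translate(2)[of "\<lambda>\<eta>. (f \<eta>)\<^sup>2" y] by simp
  have square: "(jump_operator q f \<eta>)\<^sup>2 \<le>
      real (card ?B) * (\<Sum>y\<in>?B. \<rho>\<^sup>2 * (2 * (f (translate y \<eta>))\<^sup>2 + 2 * (f \<eta>)\<^sup>2))" for \<eta>
  proof -
    have "(jump_operator q f \<eta>)\<^sup>2 \<le> (\<Sum>y\<in>?B. 1\<^sup>2) * (\<Sum>y\<in>?B. (q y \<eta> * (f (translate y \<eta>) - f \<eta>))\<^sup>2)"
      unfolding jump_operator_eq
      using Cauchy_Schwarz_ineq_sum[of "\<lambda>_. 1" "\<lambda>y. q y \<eta> * (f (translate y \<eta>) - f \<eta>)" ?B] by simp
    also have "\<dots> \<le> real (card ?B) * (\<Sum>y\<in>?B. \<rho>\<^sup>2 * (2 * (f (translate y \<eta>))\<^sup>2 + 2 * (f \<eta>)\<^sup>2))"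
      unfolding power_one sum_constant mult_1_right
    proof (intro mult_left_mono sum_mono)
      fix y
      have "(q y \<eta>)\<^sup>2 \<le> \<rho>\<^sup>2"
        using \<rho>[of y \<eta>] by (simp add: abs_le_square_iff[symmetric])
      moreover have "(f (translate y \<eta>) - f \<eta>)\<^sup>2 \<le> 2 * (f (translate y \<eta>))\<^sup>2 + 2 * (f \<eta>)\<^sup>2"
        using zero_le_power2[of "f (translate y \<eta>) + f \<eta>"] by (simp add: power2_eq_square algebra_simps)
      ultimately show "(q y \<eta> * (f (translate y \<eta>) - f \<eta>))\<^sup>2
          \<le> \<rho>\<^sup>2 * (2 * (f (translate y \<eta>))\<^sup>2 + 2 * (f \<eta>)\<^sup>2)"
        unfolding power_mult_distrib by (intro mult_mono) auto
    qed simp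
    finally show ?thesis .
  qed
  have "(\<integral>\<eta>. (jump_operator q f \<eta>)\<^sup>2 \<partial>\<mu>)
      \<le> (\<integral>\<eta>. real (card ?B) * (\<Sum>y\<in>?B. \<rho>\<^sup>2 * (2 * (f (translate y \<eta>))\<^sup>2 + 2 * (f \<eta>)\<^sup>2)) \<partial>\<mu>)"
    using square int int_translate
    by (intro integral_mono') (auto intro!: mult_nonneg_nonneg sum_nonneg)
  also have "\<dots> = real (card ?B) * (\<Sum>y\<in>?B. \<rho>\<^sup>2 *
      (2 * (\<integral>\<eta>. (f (translate y \<eta>))\<^sup>2 \<partial>\<mu>) + 2 * (\<integral>\<eta>. (f \<eta>)\<^sup>2 \<partial>\<mu>)))"
    using int int_translate by simp
  also have "\<dots> = (2 * \<rho> * real (card ?B))\<^sup>2 * (\<integral>\<eta>. (f \<eta>)\<^sup>2 \<partial>\<mu>)"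
    using integral_translate(1)[of "\<lambda>\<eta>. (f \<eta>)\<^sup>2"] by (simp add: power2_eq_square)
  finally show ?thesis .
qed

lemma operator_norm_bound:
  "0 \<le> L2_operator_norm \<mu> (jump_operator q)"
  "square_integrable \<mu> f \<Longrightarrow>
    (\<integral>\<eta>. (jump_operator q f \<eta>)\<^sup>2 \<partial>\<mu>) \<le> (L2_operator_norm \<mu> (jump_operator q))\<^sup>2 * (\<integral>\<eta>. (f \<eta>)\<^sup>2 \<partial>\<mu>)"
proof -
  define N where "N = {L2_norm \<mu> (jump_operator q f) | f. square_integrable \<mu> f \<and> L2_norm \<mu> f \<le> 1}"
  obtain \<rho> where "\<rho> > 0" and \<rho>: "\<And>y \<eta>. \<bar>q y \<eta>\<bar> \<le> \<rho>"
    using bounded_rates by blast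
  define K where "K = 2 * \<rho> * real (card (sup_ball R :: (int ^ 'd) set))"
  have "K \<ge> 0"
    using \<open>\<rho> > 0\<close> by (simp add: K_def)
  have L2_K: "(\<integral>\<eta>. (jump_operator q f \<eta>)\<^sup>2 \<partial>\<mu>) \<le> K\<^sup>2 * (\<integral>\<eta>. (f \<eta>)\<^sup>2 \<partial>\<mu>)"
    if "square_integrable \<mu> f" for f
    using jump_operator_L2_bounded[OF \<rho> that] by (simp add: K_def)
  have "bdd_above N"
  proof (rule bdd_aboveI)
    fix a
    assume "a \<in> N"
    then obtain f where f: "square_integrable \<mu> f" "L2_norm \<mu> f \<le> 1"
      and a: "a = L2_norm \<mu> (jump_operator q f)"
      by (auto simp: N_def)
    have "(\<integral>\<eta>. (f \<eta>)\<^sup>2 \<partial>\<mu>) \<le> 1"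
      using f(2) by (simp add: L2_norm_def)
    then have "(\<integral>\<eta>. (jump_operator q f \<eta>)\<^sup>2 \<partial>\<mu>) \<le> K\<^sup>2"
      using L2_K[OF f(1)] mult_left_mono[of "\<integral>\<eta>. (f \<eta>)\<^sup>2 \<partial>\<mu>" 1 "K\<^sup>2"] by simp
    then show "a \<le> K"
      unfolding a L2_norm_def using \<open>K \<ge> 0\<close> by (simp add: real_le_lsqrt)
  qed
  then have upper: "L2_norm \<mu> (jump_operator q f) \<le> L2_operator_norm \<mu> (jump_operator q)"
    if "square_integrable \<mu> f" "L2_norm \<mu> f \<le> 1" for f
    unfolding L2_operator_norm_def N_def[symmetric] using that
    by (intro cSup_upper) (auto simp: N_def)
  have "square_integrable \<mu> (\<lambda>_. 0)" "L2_norm \<mu> (\<lambda>_. 0) \<le> 1"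
    by (auto simp: square_integrable_def L2_norm_def)
  from upper[OF this] show nonneg: "0 \<le> L2_operator_norm \<mu> (jump_operator q)"
    by (rule order_trans[rotated]) (simp add: L2_norm_def)
  assume f: "square_integrable \<mu> f"
  define A where "A = (\<integral>\<eta>. (f \<eta>)\<^sup>2 \<partial>\<mu>)"
  have "A \<ge> 0"
    by (simp add: A_def)
  show "(\<integral>\<eta>. (jump_operator q f \<eta>)\<^sup>2 \<partial>\<mu>) \<le> (L2_operator_norm \<mu> (jump_operator q))\<^sup>2 * (\<integral>\<eta>. (f \<eta>)\<^sup>2 \<partial>\<mu>)"
  proof (cases "A = 0")
    case True
    then show ?thesis
      using L2_K[OF f] by (simp add: A_def)
  next
    case False
    then have "A > 0"
      using \<open>A \<ge> 0\<close> by simp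
    define g where "g \<eta> = (1 / sqrt A) * f \<eta>" for \<eta>
    have "square_integrable \<mu> g"
      using f unfolding square_integrable_def g_def[abs_def] by (auto simp: power_divide)
    moreover have "(\<integral>\<eta>. (g \<eta>)\<^sup>2 \<partial>\<mu>) = 1"
      using \<open>A > 0\<close> by (simp add: g_def power_divide A_def[symmetric])
    ultimately have "L2_norm \<mu> (jump_operator q g) \<le> L2_operator_norm \<mu> (jump_operator q)"
      by (intro upper) (auto simp: L2_norm_def)
    then have "(\<integral>\<eta>. (jump_operator q g \<eta>)\<^sup>2 \<partial>\<mu>) \<le> (L2_operator_norm \<mu> (jump_operator q))\<^sup>2"
      unfolding L2_norm_def by (rule sqrt_le_D)
    moreover have "(\<integral>\<eta>. (jump_operator q g \<eta>)\<^sup>2 \<partial>\<mu>) = (\<integral>\<eta>. (jump_operator q f \<eta>)\<^sup>2 \<partial>\<mu>) / A"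
      unfolding g_def[abs_def] jump_operator_scale using \<open>A > 0\<close> by (simp add: power_divide)
    ultimately show ?thesis
      using \<open>A > 0\<close> by (simp add: A_def[symmetric] pos_divide_le_eq)
  qed
qed

end

end

subsection \<open>The Poincare inequality on the continuous domain\<close>

lemma (in feller) square_integrable_continuous:
  fixes f :: "'a \<Rightarrow> real"
  assumes "prob_space \<mu>" "sets \<mu> = sets borel" "continuous_on UNIV f"
  shows "square_integrable \<mu> f"
proof -
  interpret prob_space \<mu> by fact
  have int: "integrable \<mu> h" if "continuous_on UNIV h" for h :: "'a \<Rightarrow> real"
    using that by (metis bcontfunE bcontfun_iff integrable_continuous assms(2) finite_measure_axioms)
  have "integrable \<mu> (\<lambda>\<eta>. (f \<eta>)\<^sup>2)"
    using assms(3) by (intro int continuous_intros)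
  then show ?thesis
    unfolding square_integrable_def using int[OF assms(3)] by auto
qed

text \<open>Uniform convergence of the difference quotients implies convergence in \<open>L\<^sup>2\<close>, so
  the generator on continuous functions is a restriction of the one on \<open>L\<^sup>2\<close>.\<close>

lemma (in feller) poincare_continuous:
  assumes \<mu>: "prob_space \<mu>" "sets \<mu> = sets borel"
    and poincare: "\<forall>(f, g)\<in>L2_generator \<mu> (transition P Y). (\<integral>\<eta>. f \<eta> \<partial>\<mu>) = 0 \<longrightarrow>
      \<gamma> * (L2_norm \<mu> f)\<^sup>2 \<le> - (\<integral>\<eta>. f \<eta> * g \<eta> \<partial>\<mu>)"
    and fg: "(f, g) \<in> C_generator (transition P Y)"
  shows "\<gamma> * (\<integral>\<eta>. (f \<eta> - (\<integral>\<zeta>. f \<zeta> \<partial>\<mu>))\<^sup>2 \<partial>\<mu>) \<le> - (\<integral>\<eta>. (f \<eta> - (\<integral>\<zeta>. f \<zeta> \<partial>\<mu>)) * g \<eta> \<partial>\<mu>)"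
proof -
  interpret \<mu>: prob_space \<mu> by (rule \<mu>)
  obtain f' g' where f: "f = apply_bcontfun f'" and g: "g = apply_bcontfun g'" and gen: "generates f' g'"
    using fg by (rule C_generatorE)
  define m where "m = (\<integral>\<zeta>. f \<zeta> \<partial>\<mu>)"
  have int: "integrable \<mu> h" if "continuous_on UNIV h" for h :: "'a \<Rightarrow> real"
    using that by (metis bcontfunE bcontfun_iff integrable_continuous \<mu>(2) \<mu>.finite_measure_axioms)
  have continuous: "continuous_on UNIV f" "continuous_on UNIV g"
    by (auto simp: f g)
  note square = square_integrable_continuous[OF \<mu>]
  have "((\<lambda>t. norm ((T t f' - f') /\<^sub>R t - g')) \<longlongrightarrow> 0) (at_right 0)"
    using gen unfolding generates_def by (intro tendsto_norm_zero LIM_zero)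
  moreover have "\<forall>\<^sub>F t in at_right 0. norm (L2_norm \<mu> (\<lambda>\<eta>. (transition P Y t (\<lambda>\<eta>. f \<eta> - m) \<eta> - (f \<eta> - m)) / t - g \<eta>))
      \<le> norm ((T t f' - f') /\<^sub>R t - g')"
  proof (rule eventually_at_rightI[of 0 1])
    fix t :: real
    assume t: "t \<in> {0<..<1}"
    define h where "h = (T t f' - f') /\<^sub>R t - g'"
    have "transition P Y t (\<lambda>\<eta>. f \<eta> - m) \<eta> = T t f' \<eta> - m" for \<eta>
      using transition_linear(2)[OF continuous_bounds[of f'], of "\<lambda>_. m" "\<bar>m\<bar>" t \<eta>] t
      by (simp add: apply_T f transition_const)
    then have "(transition P Y t (\<lambda>\<eta>. f \<eta> - m) \<eta> - (f \<eta> - m)) / t - g \<eta> = h \<eta>" for \<eta>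
      by (simp add: h_def f g divide_inverse mult.commute)
    moreover have "L2_norm \<mu> h \<le> norm h"
    proof -
      have "(\<integral>\<eta>. (h \<eta>)\<^sup>2 \<partial>\<mu>) \<le> (norm h)\<^sup>2"
        using continuous_bounds(2)[of h]
        by (intro \<mu>.integral_le_const int continuous_intros) (auto simp: abs_le_square_iff[symmetric])
      then show ?thesis
        unfolding L2_norm_def by (simp add: real_le_lsqrt)
    qed
    ultimately show "norm (L2_norm \<mu> (\<lambda>\<eta>. (transition P Y t (\<lambda>\<eta>. f \<eta> - m) \<eta> - (f \<eta> - m)) / t - g \<eta>))
        \<le> norm ((T t f' - f') /\<^sub>R t - g')"
      by (simp add: h_def[symmetric] L2_norm_def)
  qed simp
  ultimately have "((\<lambda>t. L2_norm \<mu> (\<lambda>\<eta>. (transition P Y t (\<lambda>\<eta>. f \<eta> - m) \<eta> - (f \<eta> - m)) / t - g \<eta>)) \<longlongrightarrow> 0) (at_right 0)"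
    by (rule Lim_null_comparison[rotated])
  then have "((\<lambda>\<eta>. f \<eta> - m), g) \<in> L2_generator \<mu> (transition P Y)"
    unfolding L2_generator_def using square continuous by (auto intro!: square continuous_intros)
  moreover have "(\<integral>\<eta>. f \<eta> - m \<partial>\<mu>) = 0"
    using int[OF continuous(1)] by (simp add: m_def \<mu>.prob_space)
  ultimately have "\<gamma> * (L2_norm \<mu> (\<lambda>\<eta>. f \<eta> - m))\<^sup>2 \<le> - (\<integral>\<eta>. (f \<eta> - m) * g \<eta> \<partial>\<mu>)"
    using poincare by blast
  then show ?thesis
    by (simp add: m_def[symmetric] L2_norm_def)
qed

section \<open>The walk in a given environment\<close>

text \<open>The process is the limit of its values at the next point to the right in finer and finer
  grids of times.\<close>

lemma right_continuous_jointly_measurable: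
  fixes g :: "real \<Rightarrow> 'w \<Rightarrow> real"
  assumes measurable: "\<And>t. t \<ge> 0 \<Longrightarrow> g t \<in> borel_measurable M"
    and right_continuous: "\<And>w t. w \<in> space M \<Longrightarrow> t \<ge> 0 \<Longrightarrow> ((\<lambda>s. g s w) \<longlongrightarrow> g t w) (at_right t)"
  shows "(\<lambda>(t, w). indicator {0..} t * g t w) \<in> borel_measurable (borel \<Otimes>\<^sub>M M)"
proof (rule borel_measurable_LIMSEQ_real)
  define s where "s n t = (real_of_int \<lfloor>real (Suc n) * t\<rfloor> + 1) / real (Suc n)" for n t
  define g' where "g' n = (\<lambda>(t, w). indicator {0..} t * g (max 0 (s n t)) w)" for n
  show "g' n \<in> borel_measurable (borel \<Otimes>\<^sub>M M)" for n
  proof -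
    have "(\<lambda>p. g (max 0 ((real_of_int i + 1) / real (Suc n))) (snd p)) \<in> borel_measurable (borel \<Otimes>\<^sub>M M)"
      for i :: int
      by (rule measurable_compose[OF measurable_snd measurable]) simp
    moreover have "(\<lambda>p. \<lfloor>real (Suc n) * fst p\<rfloor>) \<in> (borel \<Otimes>\<^sub>M M) \<rightarrow>\<^sub>M count_space UNIV"
      by measurable
    ultimately have "(\<lambda>p. g (max 0 ((real_of_int \<lfloor>real (Suc n) * fst p\<rfloor> + 1) / real (Suc n))) (snd p))
        \<in> borel_measurable (borel \<Otimes>\<^sub>M M)"
      by (rule measurable_compose_countable)
    then have "(\<lambda>p. indicator {0..} (fst p) * g (max 0 (s n (fst p))) (snd p))
        \<in> borel_measurable (borel \<Otimes>\<^sub>M M)"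
      unfolding s_def by measurable
    then show ?thesis
      by (simp add: g'_def case_prod_beta')
  qed
  show "(\<lambda>n. g' n p) \<longlonglongrightarrow> (case p of (t, w) \<Rightarrow> indicator {0..} t * g t w)"
    if "p \<in> space (borel \<Otimes>\<^sub>M M)" for p
  proof -
    obtain t w where p: "p = (t, w)" "w \<in> space M"
      using \<open>p \<in> space (borel \<Otimes>\<^sub>M M)\<close> by (auto simp: space_pair_measure)
    show ?thesis
    proof (cases "t \<ge> 0")
      case True
      have above: "t < s n t" and below: "s n t \<le> t + 1 / real (Suc n)" for n
      proof -
        define m where "m = real (Suc n)"
        have "m > 0"
          by (simp add: m_def)
        have floor: "m * t < real_of_int \<lfloor>m * t\<rfloor> + 1" "real_of_int \<lfloor>m * t\<rfloor> \<le> m * t"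
          by linarith+
        show "t < s n t"
          unfolding s_def m_def[symmetric] using \<open>m > 0\<close> floor(1)
          by (simp add: pos_less_divide_eq mult.commute)
        have "(real_of_int \<lfloor>m * t\<rfloor> + 1) / m \<le> (m * t + 1) / m"
          using \<open>m > 0\<close> floor(2) by (intro divide_right_mono) auto
        also have "\<dots> = t + 1 / m"
          using \<open>m > 0\<close> by (simp add: add_divide_distrib)
        finally show "s n t \<le> t + 1 / real (Suc n)"
          unfolding s_def m_def[symmetric] .
      qed
      have "(\<lambda>n. t + 1 / real (Suc n)) \<longlonglongrightarrow> t + 0"
        by (intro tendsto_intros LIMSEQ_Suc lim_1_over_n)
      then have "(\<lambda>n. s n t) \<longlonglongrightarrow> t"
        using above below
        by (intro tendsto_sandwich[of "\<lambda>_. t" "\<lambda>n. s n t" sequentially "\<lambda>n. t + 1 / real (Suc n)"])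
          (auto intro!: always_eventually intro: less_imp_le)
      then have "filterlim (\<lambda>n. s n t) (at_right t) sequentially"
        using above by (intro tendsto_imp_filterlim_at_right always_eventually) auto
      then have "(\<lambda>n. g (s n t) w) \<longlonglongrightarrow> g t w"
        by (rule filterlim_compose[OF right_continuous[OF p(2) True]])
      moreover have "max 0 (s n t) = s n t" for n
        using above[of n] True by simp
      ultimately show ?thesis
        using True by (simp add: g'_def p)
    next
      case False
      then show ?thesis by (simp add: g'_def p)
    qed
  qed
qed

locale environment_walk =
  env: markov M P \<sigma> + rates: finite_range_rates q R
  for M :: "'w measure" and P :: "(int ^ 'd \<Rightarrow> 's::polish_space) \<Rightarrow> 'w measure"
    and \<sigma> :: "real \<Rightarrow> 'w \<Rightarrow> int ^ 'd \<Rightarrow> 's"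
    and q :: "int ^ 'd \<Rightarrow> (int ^ 'd \<Rightarrow> 's) \<Rightarrow> real" and R :: real +
  fixes X :: "real \<Rightarrow> 'w \<Rightarrow> int ^ 'd" and \<mu> :: "(int ^ 'd \<Rightarrow> 's) measure" and \<rho> :: real
  assumes env_cadlag: "w \<in> space M \<Longrightarrow> cadlag (\<lambda>t. \<sigma> t w)"
    and walker: "walker M P \<sigma> q X"
    and \<mu>: "prob_space \<mu>" "sets \<mu> = sets borel"
    and \<rho>: "\<rho> > 0" "\<bar>q y \<eta>\<bar> \<le> \<rho>"
    and R: "R > 0"
    and rates_local: "depends_only_on (q y) (sup_ball R)"
begin

definition Q :: "'w measure" where
  "Q = \<mu> \<bind> P"

sublocale Q: prob_space Q
  unfolding Q_def using \<mu> by (rule env.prob_space_start)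

lemma sets_Q [measurable_cong]: "sets Q = sets M"
  unfolding Q_def using \<mu> by (rule env.sets_start)

lemma space_Q: "space Q = space M"
  using sets_Q by (rule sets_eq_imp_space_eq)

lemma X_measurable: "t \<ge> 0 \<Longrightarrow> X t \<in> M \<rightarrow>\<^sub>M count_space UNIV"
  using walker by (auto simp: walker_def lattice_measurable)

lemma integral_Q_eqI:
  fixes f g :: "'w \<Rightarrow> real"
  assumes "f \<in> borel_measurable M" "\<And>w. w \<in> space M \<Longrightarrow> \<bar>f w\<bar> \<le> b"
    and "g \<in> borel_measurable M" "\<And>w. w \<in> space M \<Longrightarrow> \<bar>g w\<bar> \<le> c"
    and "\<And>\<eta>. (\<integral>w. f w \<partial>P \<eta>) = (\<integral>w. g w \<partial>P \<eta>)"
  shows "(\<integral>w. f w \<partial>Q) = (\<integral>w. g w \<partial>Q)"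
  unfolding Q_def using env.integral_start[OF \<mu> assms(1,2)] env.integral_start[OF \<mu> assms(3,4)] assms(5)
  by simp

lemma integrable_Q:
  fixes f :: "'w \<Rightarrow> real"
  assumes "f \<in> borel_measurable M" "\<And>w. w \<in> space M \<Longrightarrow> \<bar>f w\<bar> \<le> b"
  shows "integrable Q f"
  using assms by (intro Q.integrable_const_bound[where B = b]) (auto simp: space_Q)

lemma abs_integral_Q_le:
  fixes f :: "'w \<Rightarrow> real"
  assumes "f \<in> borel_measurable M" "\<And>w. w \<in> space M \<Longrightarrow> \<bar>f w\<bar> \<le> b"
  shows "\<bar>\<integral>w. f w \<partial>Q\<bar> \<le> b"
  using Q.abs_integral_le[OF integrable_Q[OF assms]] assms(2) by (simp add: space_Q)

lemma X_0: "AE w in P \<eta>. X 0 w = 0"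
  using walker by (simp add: walker_def)

subsection \<open>Random functions on the lattice\<close>

text \<open>Observables of the walker that are weighted by functionals of the environment path are functions of the
  outcome and the site. They stay fixed in time while the walker moves.\<close>

abbreviation jump_rate :: "int ^ 'd \<Rightarrow> real \<Rightarrow> 'w \<Rightarrow> real" where
  "jump_rate y u w \<equiv> q y (translate (X u w) (\<sigma> u w))"

definition generator :: "('w \<Rightarrow> int ^ 'd \<Rightarrow> real) \<Rightarrow> real \<Rightarrow> 'w \<Rightarrow> real" where
  "generator H u w = (\<Sum>y\<in>sup_ball R. jump_rate y u w * (H w (X u w + y) - H w (X u w)))"

abbreviation drift :: "real \<Rightarrow> ('w \<Rightarrow> int ^ 'd \<Rightarrow> real) \<Rightarrow> 'w \<Rightarrow> real" where
  "drift t H w \<equiv> \<integral>u. indicator {0..t} u * generator H u w \<partial>lborel"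

lemma at_walker_measurable:
  assumes "\<And>z. (\<lambda>w. H w z) \<in> borel_measurable M" "u \<ge> 0"
  shows "(\<lambda>w. H w (X u w + y)) \<in> borel_measurable M"
    "(\<lambda>w. H w (X u w)) \<in> borel_measurable M"
  by (rule measurable_compose_countable[of "\<lambda>z w. H w (z + y)", OF assms(1) X_measurable[OF assms(2)]])
    (rule measurable_compose_countable[of "\<lambda>z w. H w z", OF assms(1) X_measurable[OF assms(2)]])

lemma seen_rate_measurable:
  assumes "u \<ge> 0"
  shows "(\<lambda>w. jump_rate y u w) \<in> borel_measurable M"
proof (rule at_walker_measurable(2)[where H = "\<lambda>w z. q y (translate z (\<sigma> u w))", OF _ assms])
  fix z
  have "q y \<in> borel_measurable borel"
    using rates.continuous by (rule borel_measurable_continuous_onI)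
  then have "(\<lambda>\<eta>. q y (translate z \<eta>)) \<in> borel_measurable borel"
    by (rule measurable_compose[OF translate_measurable])
  then show "(\<lambda>w. q y (translate z (\<sigma> u w))) \<in> borel_measurable M"
    by (rule measurable_compose[OF env.Y_measurable[OF assms]])
qed

lemma generator_measurable:
  assumes "\<And>z. (\<lambda>w. H w z) \<in> borel_measurable M" "u \<ge> 0"
  shows "generator H u \<in> borel_measurable M"
  unfolding generator_def[abs_def]
  by (intro borel_measurable_sum borel_measurable_times borel_measurable_diff
      seen_rate_measurable[OF assms(2)] at_walker_measurable[OF assms])

lemma X_right_constant:
  assumes "w \<in> space M" "u \<ge> 0"
  shows "\<forall>\<^sub>F v in at_right u. X v w = X u w"
proof -
  have "((\<lambda>v. X v w) \<longlongrightarrow> X u w) (at_right u)"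
    using walker assms by (auto simp: walker_def cadlag_def)
  then have "\<forall>\<^sub>F v in at_right u. X v w \<in> {X u w}"
    by (rule topological_tendstoD) (auto intro: open_lattice)
  then show ?thesis by simp
qed

lemma generator_right_continuous:
  assumes "w \<in> space M" "u \<ge> 0"
  shows "((\<lambda>v. generator H v w) \<longlongrightarrow> generator H u w) (at_right u)"
proof -
  define x where "x = X u w"
  have "((\<lambda>v. \<sigma> v w) \<longlongrightarrow> \<sigma> u w) (at_right u)"
    using env_cadlag[OF assms(1)] assms(2) by (auto simp: cadlag_def)
  then have "((\<lambda>v. q y (translate x (\<sigma> v w))) \<longlongrightarrow> q y (translate x (\<sigma> u w))) (at_right u)" for y
    by (rule continuous_on_tendsto_compose[OF continuous_translate_comp[OF rates.continuous]]) auto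
  then have "((\<lambda>v. \<Sum>y\<in>sup_ball R. q y (translate x (\<sigma> v w)) * (H w (x + y) - H w x)) \<longlongrightarrow>
      generator H u w) (at_right u)"
    unfolding generator_def x_def[symmetric] by (intro tendsto_intros)
  moreover have "\<forall>\<^sub>F v in at_right u.
      (\<Sum>y\<in>sup_ball R. q y (translate x (\<sigma> v w)) * (H w (x + y) - H w x)) = generator H v w"
    using X_right_constant[OF assms] by eventually_elim (simp add: generator_def x_def)
  ultimately show ?thesis
    by (rule Lim_transform_eventually)
qed

text \<open>A bound on the total jump rate, doubled because the generator contains an arrival and a departure
  term.\<close>

definition speed_bound :: real where
  "speed_bound = 2 * real (card (sup_ball R :: (int ^ 'd) set)) * \<rho>"

lemma speed_bound_nonneg: "speed_bound \<ge> 0"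
  using \<rho>(1) by (simp add: speed_bound_def)

lemma generator_bounded:
  assumes "\<And>z. \<bar>H w z\<bar> \<le> b"
  shows "\<bar>generator H u w\<bar> \<le> speed_bound * b"
proof -
  have "\<bar>generator H u w\<bar> \<le> (\<Sum>y\<in>sup_ball R. \<bar>jump_rate y u w * (H w (X u w + y) - H w (X u w))\<bar>)"
    unfolding generator_def by (rule sum_abs)
  also have "\<dots> \<le> (\<Sum>y\<in>(sup_ball R :: (int ^ 'd) set). \<rho> * (2 * b))"
  proof (rule sum_mono)
    fix y
    have "\<bar>H w (X u w + y) - H w (X u w)\<bar> \<le> 2 * b"
      using assms[of "X u w + y"] assms[of "X u w"] by linarith
    then show "\<bar>jump_rate y u w * (H w (X u w + y) - H w (X u w))\<bar> \<le> \<rho> * (2 * b)"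
      unfolding abs_mult using \<rho> by (intro mult_mono) auto
  qed
  finally show ?thesis
    by (simp add: speed_bound_def algebra_simps)
qed

lemma generator_jointly_measurable:
  assumes "\<And>z. (\<lambda>w. H w z) \<in> borel_measurable M"
  shows "(\<lambda>(u, w). indicator {0..t} u * generator H u w) \<in> borel_measurable (lborel \<Otimes>\<^sub>M M)"
proof -
  have [measurable]: "(\<lambda>(u, w). indicator {0..} u * generator H u w) \<in> borel_measurable (borel \<Otimes>\<^sub>M M)"
    by (rule right_continuous_jointly_measurable[OF generator_measurable[OF assms]
          generator_right_continuous])
  have "(\<lambda>p. indicator {..t} (fst p) * (case p of (u, w) \<Rightarrow> indicator {0..} u * generator H u w))
      \<in> borel_measurable (borel \<Otimes>\<^sub>M M)"
    by measurable
  also have "(\<lambda>p. indicator {..t} (fst p) * (case p of (u, w) \<Rightarrow> indicator {0..} u * generator H u w)) =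
      (\<lambda>(u, w). indicator {0..t} u * generator H u w)"
    by (auto simp: indicator_def)
  finally show ?thesis
    by (simp cong: measurable_cong_sets add: sets_pair_measure_cong[OF sets_lborel refl])
qed

lemma generator_integrable:
  assumes "\<And>z. (\<lambda>w. H w z) \<in> borel_measurable M" "\<And>w z. \<bar>H w z\<bar> \<le> b"
  shows "integrable (lborel \<Otimes>\<^sub>M Q) (\<lambda>(u, w). indicator {0..t} u * generator H u w)"
    "w \<in> space M \<Longrightarrow> integrable lborel (\<lambda>u. indicator {0..t} u * generator H u w)"
    "drift t H \<in> borel_measurable M"
    "t \<ge> 0 \<Longrightarrow> \<bar>drift t H w\<bar> \<le> speed_bound * b * t"
proof -
  have b: "\<bar>indicator {0..t} u * generator H u w\<bar> \<le> indicator {0..t} u * (speed_bound * b)" for u w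
    using generator_bounded[of H w b u, OF assms(2)] by (auto simp: indicator_def)
  have bound_integrable: "integrable lborel (\<lambda>u. indicator {0..t} u * (speed_bound * b))"
    by (intro integrable_mult_left) (simp add: integrable_indicator_iff emeasure_lborel_Icc_eq)
  note joint = generator_jointly_measurable[where H = H and t = t, OF assms(1)]
  have joint_Q: "(\<lambda>(u, w). indicator {0..t} u * generator H u w) \<in> borel_measurable (lborel \<Otimes>\<^sub>M Q)"
    using joint by (simp cong: measurable_cong_sets add: sets_pair_measure_cong[OF refl sets_Q])
  interpret pair_sigma_finite lborel Q ..
  show "integrable (lborel \<Otimes>\<^sub>M Q) (\<lambda>(u, w). indicator {0..t} u * generator H u w)"
  proof (rule Bochner_Integration.integrable_bound)
    have "emeasure (lborel \<Otimes>\<^sub>M Q) ({0..t} \<times> space Q) = emeasure lborel {0..t :: real} * emeasure Q (space Q)"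
      by (rule Q.emeasure_pair_measure_Times) auto
    then have "emeasure (lborel \<Otimes>\<^sub>M Q) ({0..t} \<times> space Q) < \<infinity>"
      by (simp add: Q.emeasure_space_1 emeasure_lborel_Icc_eq)
    then show "integrable (lborel \<Otimes>\<^sub>M Q) (\<lambda>p. indicator ({0..t} \<times> space Q) p * (speed_bound * b))"
      by (intro integrable_mult_left integrable_real_indicator) auto
    show "AE p in lborel \<Otimes>\<^sub>M Q. norm (case p of (u, w) \<Rightarrow> indicator {0..t} u * generator H u w)
        \<le> norm (indicator ({0..t} \<times> space Q) p * (speed_bound * b))"
    proof (rule AE_I2)
      fix p :: "real \<times> 'w"
      assume "p \<in> space (lborel \<Otimes>\<^sub>M Q)"
      then show "norm (case p of (u, w) \<Rightarrow> indicator {0..t} u * generator H u w)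
          \<le> norm (indicator ({0..t} \<times> space Q) p * (speed_bound * b))"
        using b[of "fst p" "snd p"] by (auto simp: space_pair_measure indicator_def)
    qed
  qed (rule joint_Q)
  show int: "integrable lborel (\<lambda>u. indicator {0..t} u * generator H u w)" if "w \<in> space M" for w
  proof (rule Bochner_Integration.integrable_bound[OF bound_integrable])
    show "(\<lambda>u. indicator {0..t} u * generator H u w) \<in> borel_measurable lborel"
      using measurable_compose[OF measurable_Pair2'[OF that] joint] by simp
    show "AE u in lborel. norm (indicator {0..t} u * generator H u w) \<le> norm (indicator {0..t} u * (speed_bound * b))"
      using b by (intro AE_I2) (simp add: order_trans[OF _ abs_ge_self])
  qed
  show "drift t H \<in> borel_measurable M"
  proof -
    have "(\<lambda>(w, u). indicator {0..t} u * generator H u w) \<in> borel_measurable (M \<Otimes>\<^sub>M lborel)"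
      using measurable_compose[OF measurable_pair_swap' joint] by (simp add: case_prod_beta')
    then show ?thesis
      by (rule lborel.borel_measurable_lebesgue_integral)
  qed
  assume "t \<ge> 0"
  have "\<bar>drift t H w\<bar> \<le> (\<integral>u. \<bar>indicator {0..t} u * generator H u w\<bar> \<partial>lborel)"
    by (rule integral_abs_bound)
  also have "\<dots> \<le> (\<integral>u. indicator {0..t} u * (speed_bound * b) \<partial>lborel)"
  proof (rule integral_mono'[OF bound_integrable])
    show "\<bar>indicator {0..t} u * generator H u w\<bar> \<le> indicator {0..t} u * (speed_bound * b)" for u
      by (rule b)
    show "0 \<le> indicator {0..t} u * (speed_bound * b)" for u :: real
      using b[of u undefined] abs_ge_zero by (rule order_trans[rotated])
  qed
  also have "\<dots> = speed_bound * b * t"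
    using \<open>t \<ge> 0\<close> by simp
  finally show "\<bar>drift t H w\<bar> \<le> speed_bound * b * t" .
qed

subsection \<open>Dynkin's formula for random functions of the environment\<close>

definition G :: "'w measure" where
  "G = sigma (space M) (events (space M) {0..} \<sigma>)"

lemma events_subset: "events (space M) I \<sigma> \<subseteq> Pow (space M)"
  by (auto simp: events_def)

lemma space_G: "space G = space M" and sets_G: "sets G = sigma_sets (space M) (events (space M) {0..} \<sigma>)"
  unfolding G_def by (simp_all add: space_measure_of sets_measure_of events_subset)

lemma subalgebra_G: "subalgebra Q G"
proof -
  have "events (space M) {0..} \<sigma> \<subseteq> sets M"
    using measurable_sets[OF env.Y_measurable] by (auto simp: events_def)
  then have "sets G \<subseteq> sets M"
    unfolding sets_G by (rule sets.sigma_sets_subset)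
  then show ?thesis
    by (simp add: subalgebra_def space_G space_Q sets_Q)
qed

lemma G_measurable_M: "f \<in> borel_measurable G \<Longrightarrow> f \<in> borel_measurable M"
  using measurable_from_subalg[OF subalgebra_G] by (simp cong: measurable_cong_sets add: sets_Q)

interpretation G: finite_measure_subalgebra Q G
  by standard (rule subalgebra_G)

definition site :: "int ^ 'd \<Rightarrow> 'w \<Rightarrow> int ^ 'd \<Rightarrow> real" where
  "site z w = indicator {z}"

definition compensated :: "real \<Rightarrow> int ^ 'd \<Rightarrow> 'w \<Rightarrow> real" where
  "compensated t z w = site z w (X t w) - site z w (X 0 w) -
    drift t (site z) w"

lemma site_measurable: "(\<lambda>w. site z w x) \<in> borel_measurable M"
  and site_bounded: "\<bar>site z w x\<bar> \<le> 1"
  by (auto simp: site_def indicator_def)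

lemma compensated_measurable:
  assumes "t \<ge> 0"
  shows "compensated t z \<in> borel_measurable M"
  unfolding compensated_def[abs_def]
  using at_walker_measurable(2)[where H = "site z", OF site_measurable] assms
    generator_integrable(3)[where H = "site z", OF site_measurable site_bounded]
  by (intro borel_measurable_diff) auto

lemma compensated_bounded:
  assumes "t \<ge> 0"
  shows "\<bar>compensated t z w\<bar> \<le> 2 + speed_bound * t"
  unfolding compensated_def
  using site_bounded[of z w "X t w"] site_bounded[of z w "X 0 w"]
    generator_integrable(4)[where H = "site z", OF site_measurable site_bounded assms, of w]
  by simp

lemma integral_compensated:
  assumes "A \<in> sets G" "t \<ge> 0"
  shows "(\<integral>w. indicator A w * compensated t z w \<partial>Q) = 0"
proof -
  have A: "A \<in> sets M"
    using assms(1) subalgebra_G by (auto simp: subalgebra_def sets_Q)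
  have I: "drift t (site z) \<in> borel_measurable M" "\<bar>drift t (site z) w\<bar> \<le> speed_bound * t" for w
    using generator_integrable(3)[where H = "site z", OF site_measurable site_bounded]
      generator_integrable(4)[where H = "site z", OF site_measurable site_bounded assms(2), of w] by simp_all
  have increment: "(\<lambda>w. site z w (X t w) - site z w (X 0 w)) \<in> borel_measurable M"
    using at_walker_measurable(2)[where H = "site z", OF site_measurable] assms(2) by (intro borel_measurable_diff) auto
  have "(\<integral>w. indicator A w * compensated t z w \<partial>P \<eta>) = 0" for \<eta>
  proof -
    interpret P: prob_space "P \<eta>"
      by (rule env.prob_space_P)
    have walker_eq: "(\<integral>w\<in>A. (indicator {z} (X t w) - indicator {z} (X 0 w)) \<partial>P \<eta>) =
        (\<integral>w\<in>A. (\<integral>u\<in>{0..t}. (\<Sum>\<^sub>\<infinity>y. jump_rate y u w *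
          (indicator {z} (X u w + y) - indicator {z} (X u w))) \<partial>lborel) \<partial>P \<eta> :: real)"
    proof -
      have "A \<in> sigma_sets (space M) (events (space M) {0..} \<sigma> \<union> events (space M) {0..0} X)"
        using assms(1) unfolding sets_G by (rule subsetD[OF sigma_sets_mono', rotated]) auto
      moreover have "bounded (range (indicator {z} :: int ^ 'd \<Rightarrow> real))"
        by (rule boundedI[of _ 1]) (auto simp: indicator_def)
      ultimately show ?thesis
        using walker assms(2) unfolding walker_def by blast
    qed
    have "(\<Sum>\<^sub>\<infinity>y. jump_rate y u w * (indicator {z} (X u w + y) - indicator {z} (X u w))) =
        generator (site z) u w" for u w
    proof -
      have "(\<Sum>\<^sub>\<infinity>y. jump_rate y u w * (indicator {z} (X u w + y) - indicator {z} (X u w))) =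
          (\<Sum>\<^sub>\<infinity>y\<in>sup_ball R. jump_rate y u w *
            (indicator {z} (X u w + y) - indicator {z} (X u w)) :: real)"
        by (rule infsum_cong_neutral) (auto simp: rates.range)
      then show ?thesis
        by (simp add: finite_sup_ball generator_def site_def)
    qed
    then have eq: "(\<integral>w. indicator A w * (site z w (X t w) - site z w (X 0 w)) \<partial>P \<eta>) =
        (\<integral>w. indicator A w * drift t (site z) w \<partial>P \<eta>)"
      using walker_eq by (simp add: set_lebesgue_integral_def site_def)
    have "integrable (P \<eta>) (\<lambda>w. indicator A w * (site z w (X t w) - site z w (X 0 w)))"
      using increment A site_bounded
      by (intro P.integrable_const_bound[where B = 2])
        (auto cong: measurable_cong_sets simp: env.sets_P site_def indicator_def)
    moreover have "integrable (P \<eta>) (\<lambda>w. indicator A w * drift t (site z) w)"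
    proof (rule P.integrable_const_bound[where B = "speed_bound * t"])
      show "AE w in P \<eta>. norm (indicator A w * drift t (site z) w) \<le> speed_bound * t"
        using I(2) order_trans[OF abs_ge_zero I(2)]
        by (intro AE_I2) (auto simp: abs_mult indicator_def)
      show "(\<lambda>w. indicator A w * drift t (site z) w) \<in> borel_measurable (P \<eta>)"
        using I(1) A by (auto cong: measurable_cong_sets simp: env.sets_P)
    qed
    ultimately show ?thesis
      using eq unfolding compensated_def right_diff_distrib[of _ "_ - _"] by simp
  qed
  then have "(\<integral>w. indicator A w * compensated t z w \<partial>Q) = (\<integral>w. 0 \<partial>Q)"
    using compensated_measurable[OF assms(2)] compensated_bounded[OF assms(2)] A
      mult_nonneg_nonneg[OF speed_bound_nonneg assms(2)]
    by (intro integral_Q_eqI[where b = "2 + speed_bound * t" and c = 0])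
      (auto simp: indicator_def)
  then show ?thesis by simp
qed

text \<open>The martingale property holds given the entire environment path: the conditional expectation of the
  compensated indicator given \<^term>\<open>G\<close> vanishes.\<close>

lemma integral_weighted_compensated:
  assumes "C \<in> borel_measurable G" "\<And>w. \<bar>C w\<bar> \<le> b" "t \<ge> 0"
  shows "(\<integral>w. C w * compensated t z w \<partial>Q) = 0"
    "integrable Q (\<lambda>w. C w * compensated t z w)"
proof -
  have measurable: "compensated t z \<in> borel_measurable Q"
    using compensated_measurable[OF assms(3)] by (simp cong: measurable_cong_sets add: sets_Q)
  have "b \<ge> 0"
    using order_trans[OF abs_ge_zero assms(2)] .
  show int: "integrable Q (\<lambda>w. C w * compensated t z w)"
  proof (rule integrable_Q)
    show "(\<lambda>w. C w * compensated t z w) \<in> borel_measurable M"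
      using G_measurable_M[OF assms(1)] compensated_measurable[OF assms(3)] by simp
    show "\<bar>C w * compensated t z w\<bar> \<le> b * (2 + speed_bound * t)" for w
      unfolding abs_mult using assms(2) compensated_bounded[OF assms(3)] \<open>b \<ge> 0\<close>
      by (intro mult_mono) auto
  qed
  have "AE w in Q. real_cond_exp Q G (compensated t z) w = 0"
  proof (rule G.real_cond_exp_charact(1))
    show "(\<integral>w\<in>A. compensated t z w \<partial>Q) = (\<integral>w\<in>A. 0 \<partial>Q)" if "A \<in> sets G" for A
      using integral_compensated[OF that assms(3)] by (simp add: set_lebesgue_integral_def)
    show "integrable Q (compensated t z)"
      using compensated_measurable[OF assms(3)] compensated_bounded[OF assms(3)]
      by (rule integrable_Q)
  qed auto
  then have "(\<integral>w. C w * real_cond_exp Q G (compensated t z) w \<partial>Q) = (\<integral>w. 0 \<partial>Q)"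
    using measurable_from_subalg[OF subalgebra_G assms(1)]
    by (intro integral_cong_AE) auto
  then show "(\<integral>w. C w * compensated t z w \<partial>Q) = 0"
    using G.real_cond_exp_intg(2)[OF int assms(1) measurable] by simp
qed

text \<open>A finitely supported random function is a sum of site indicators with weights that depend on the
  environment only, so the compensated indicators of sites determine everything.\<close>

lemma dynkin:
  assumes H: "\<And>z. (\<lambda>w. H w z) \<in> borel_measurable G" "\<And>w z. \<bar>H w z\<bar> \<le> b"
    and E: "finite E" "\<And>w z. z \<notin> E \<Longrightarrow> H w z = 0" and "t \<ge> 0"
  shows "(\<integral>w. H w (X t w) \<partial>Q) =
    (\<integral>w. H w 0 \<partial>Q) + (\<integral>u. indicator {0..t} u * (\<integral>w. generator H u w \<partial>Q) \<partial>lborel)"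
proof -
  note H_M = G_measurable_M[OF H(1)]
  have H_eq: "H w x = (\<Sum>z\<in>E. H w z * site z w x)" for w x
    using E by (cases "x \<in> E") (auto simp: site_def indicator_def sum.delta if_distrib cong: if_cong)
  have generator_eq: "generator H u w = (\<Sum>z\<in>E. H w z * generator (site z) u w)" for u w
  proof -
    have "(\<Sum>z\<in>E. H w z * generator (site z) u w) = (\<Sum>z\<in>E. \<Sum>y\<in>sup_ball R.
        jump_rate y u w *
          (H w z * site z w (X u w + y) - H w z * site z w (X u w)))"
      by (simp add: generator_def sum_distrib_left algebra_simps)
    also have "\<dots> = generator H u w"
      unfolding generator_def H_eq[of w "X u w + _"] H_eq[of w "X u w"]
      by (subst sum.swap) (simp add: sum_distrib_left[symmetric] sum_subtractf[symmetric])
    finally show ?thesis by simp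
  qed
  have sum_eq: "(\<Sum>z\<in>E. H w z * compensated t z w) = H w (X t w) - H w (X 0 w) - drift t H w"
    if "w \<in> space M" for w
  proof -
    have int: "integrable lborel (\<lambda>u. indicator {0..t} u * generator (site z) u w)" for z
      using generator_integrable(2)[where H = "site z", OF site_measurable site_bounded that] .
    have "drift t H w = (\<integral>u. (\<Sum>z\<in>E. H w z * (indicator {0..t} u * generator (site z) u w)) \<partial>lborel)"
      unfolding generator_eq by (simp add: sum_distrib_left mult_ac)
    also have "\<dots> = (\<Sum>z\<in>E. H w z * drift t (site z) w)"
      using int by simp
    finally show ?thesis
      unfolding compensated_def H_eq[of w "X t w"] H_eq[of w "X 0 w"]
      by (simp add: right_diff_distrib sum_subtractf)
  qed
  have int: "integrable Q (\<lambda>w. H w (X t w))" "integrable Q (\<lambda>w. H w (X 0 w))"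
    using at_walker_measurable(2)[where H = H, OF H_M] assms(5) H(2) by (auto intro!: integrable_Q)
  have int_I: "integrable Q (drift t H)"
    using generator_integrable(3)[where H = H, OF H_M H(2)] generator_integrable(4)[where H = H, OF H_M H(2) assms(5)]
    by (rule integrable_Q)
  have "0 = (\<Sum>z\<in>E. \<integral>w. H w z * compensated t z w \<partial>Q)"
    using integral_weighted_compensated(1)[OF H(1) H(2) assms(5)] by simp
  also have "\<dots> = (\<integral>w. (\<Sum>z\<in>E. H w z * compensated t z w) \<partial>Q)"
    using integral_weighted_compensated(2)[OF H(1) H(2) assms(5)] by simp
  also have "\<dots> = (\<integral>w. H w (X t w) - H w (X 0 w) - drift t H w \<partial>Q)"
    by (rule Bochner_Integration.integral_cong) (auto simp: sum_eq space_Q)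
  also have "\<dots> = (\<integral>w. H w (X t w) \<partial>Q) - (\<integral>w. H w (X 0 w) \<partial>Q) - (\<integral>w. drift t H w \<partial>Q)"
    using int int_I by simp
  also have "(\<integral>w. H w (X 0 w) \<partial>Q) = (\<integral>w. H w 0 \<partial>Q)"
  proof (rule integral_Q_eqI)
    show "(\<integral>w. H w (X 0 w) \<partial>P \<eta>) = (\<integral>w. H w 0 \<partial>P \<eta>)" for \<eta>
    proof (rule integral_cong_AE)
      show "AE w in P \<eta>. H w (X 0 w) = H w 0"
        using X_0[of \<eta>] by eventually_elim simp
    qed (use at_walker_measurable(2)[where H = H, OF H_M] H_M in \<open>auto cong: measurable_cong_sets simp: env.sets_P\<close>)
  qed (use at_walker_measurable(2)[where H = H, OF H_M] H_M H(2) in auto)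
  also have "(\<integral>w. drift t H w \<partial>Q) = (\<integral>u. (\<integral>w. indicator {0..t} u * generator H u w \<partial>Q) \<partial>lborel)"
  proof -
    interpret pair_sigma_finite lborel Q ..
    show ?thesis
      by (rule Fubini_integral[OF generator_integrable(1)[where H = H, OF H_M H(2)]])
  qed
  finally show ?thesis by simp
qed

lemma dynkin_bound:
  assumes H: "\<And>z. (\<lambda>w. H w z) \<in> borel_measurable G" "\<And>w z. \<bar>H w z\<bar> \<le> b"
    and E: "finite E" "\<And>w z. z \<notin> E \<Longrightarrow> H w z = 0" and "t \<ge> 0"
    and a: "integrable lborel (\<lambda>u. indicator {0..t} u * a u)"
      "\<And>u. 0 \<le> u \<Longrightarrow> u \<le> t \<Longrightarrow> \<bar>\<integral>w. generator H u w \<partial>Q\<bar> \<le> a u"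
  shows "\<bar>\<integral>w. H w (X t w) \<partial>Q\<bar> \<le>
    \<bar>\<integral>w. H w 0 \<partial>Q\<bar> + (\<integral>u. indicator {0..t} u * a u \<partial>lborel)"
proof -
  have bound: "\<bar>indicator {0..t} u * (\<integral>w. generator H u w \<partial>Q)\<bar> \<le> indicator {0..t} u * a u" for u
    using a(2)[of u] by (auto simp: indicator_def)
  have "\<bar>\<integral>u. indicator {0..t} u * (\<integral>w. generator H u w \<partial>Q) \<partial>lborel\<bar> \<le>
      (\<integral>u. \<bar>indicator {0..t} u * (\<integral>w. generator H u w \<partial>Q)\<bar> \<partial>lborel)"
    by (rule integral_abs_bound)
  also have "\<dots> \<le> (\<integral>u. indicator {0..t} u * a u \<partial>lborel)"
    using a(1) bound by (rule integral_mono') (rule order_trans[OF abs_ge_zero bound])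
  finally show ?thesis
    using dynkin[where H = H, OF H E \<open>t \<ge> 0\<close>] by linarith
qed

subsection \<open>Locality of the Dyson expansion\<close>

definition local_events :: "real \<Rightarrow> (int ^ 'd) set \<Rightarrow> 'w measure" where
  "local_events t \<Lambda> = sigma (space M) (events (space M) ({0..t} \<times> \<Lambda>) (\<lambda>(s, x) w. \<sigma> s w x))"

lemma space_local_events: "space (local_events t \<Lambda>) = space M"
  and sets_local_events: "sets (local_events t \<Lambda>) =
    sigma_sets (space M) (events (space M) ({0..t} \<times> \<Lambda>) (\<lambda>(s, x) w. \<sigma> s w x))"
proof -
  have "events (space M) ({0..t} \<times> \<Lambda>) (\<lambda>(s, x) w. \<sigma> s w x) \<subseteq> Pow (space M)"
    by (auto simp: events_def)
  then show "space (local_events t \<Lambda>) = space M"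
    "sets (local_events t \<Lambda>) =
      sigma_sets (space M) (events (space M) ({0..t} \<times> \<Lambda>) (\<lambda>(s, x) w. \<sigma> s w x))"
    unfolding local_events_def by (simp_all add: space_measure_of sets_measure_of)
qed

lemma spin_measurable:
  assumes "0 \<le> s" "s \<le> t" "x \<in> \<Lambda>"
  shows "(\<lambda>w. \<sigma> s w x) \<in> local_events t \<Lambda> \<rightarrow>\<^sub>M borel"
proof (rule measurableI)
  fix B :: "'s set"
  assume "B \<in> sets borel"
  then have "(\<lambda>w. \<sigma> s w x) -` B \<inter> space M \<in>
      events (space M) ({0..t} \<times> \<Lambda>) (\<lambda>(s, x) w. \<sigma> s w x)"
    using assms by (force simp: events_def)
  then show "(\<lambda>w. \<sigma> s w x) -` B \<inter> space (local_events t \<Lambda>) \<in> sets (local_events t \<Lambda>)"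
    unfolding space_local_events sets_local_events by (rule sigma_sets.Basic)
qed simp

lemma local_function_measurable:
  assumes "f \<in> borel_measurable borel" "depends_only_on f A"
    and "\<And>i. i \<in> A \<Longrightarrow> z + i \<in> \<Lambda>" "0 \<le> s" "s \<le> t"
  shows "(\<lambda>w. f (translate z (\<sigma> s w))) \<in> borel_measurable (local_events t \<Lambda>)"
proof -
  define \<zeta> where "\<zeta> w i = (if i \<in> A then \<sigma> s w (z + i) else undefined)" for w i
  have "(\<lambda>w. \<zeta> w i) \<in> local_events t \<Lambda> \<rightarrow>\<^sub>M borel" for i
    unfolding \<zeta>_def using assms(3-5) by (cases "i \<in> A") (auto intro: spin_measurable)
  then have "\<zeta> \<in> local_events t \<Lambda> \<rightarrow>\<^sub>M borel"
    by (rule measurable_coordinatewise_then_product)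
  then have "(\<lambda>w. f (\<zeta> w)) \<in> borel_measurable (local_events t \<Lambda>)"
    using assms(1) by (rule measurable_compose)
  moreover have "f (\<zeta> w) = f (translate z (\<sigma> s w))" for w
    using assms(2) by (simp add: depends_only_on_def \<zeta>_def translate_def)
  ultimately show ?thesis by simp
qed

lemma local_events_mono:
  assumes "\<Lambda> \<subseteq> \<Lambda>'" "f \<in> borel_measurable (local_events t \<Lambda>)"
  shows "f \<in> borel_measurable (local_events t \<Lambda>')"
proof (rule measurable_from_subalg[OF _ assms(2)])
  show "subalgebra (local_events t \<Lambda>') (local_events t \<Lambda>)"
    unfolding subalgebra_def space_local_events sets_local_events
    using assms(1) by (auto intro!: sigma_sets_mono' simp: events_def) 
qed

lemma local_events_G:
  assumes "f \<in> borel_measurable (local_events t \<Lambda>)"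
  shows "f \<in> borel_measurable G"
proof (rule measurable_from_subalg[OF _ assms])
  have "events (space M) ({0..t} \<times> \<Lambda>) (\<lambda>(s, x) w. \<sigma> s w x) \<subseteq> events (space M) {0..} \<sigma>"
  proof
    fix D
    assume "D \<in> events (space M) ({0..t} \<times> \<Lambda>) (\<lambda>(s, x) w. \<sigma> s w x)"
    then obtain s x B where D: "D = (\<lambda>w. \<sigma> s w x) -` B \<inter> space M" "0 \<le> s" "B \<in> sets borel"
      by (auto simp: events_def)
    have "(\<lambda>\<eta>. \<eta> x) -` B \<inter> space borel \<in> sets borel"
      using D(3) by (intro measurable_sets[OF borel_measurable_continuous_onI]) auto
    moreover have "D = \<sigma> s -` ((\<lambda>\<eta>. \<eta> x) -` B \<inter> space borel) \<inter> space M"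
      by (auto simp: D(1))
    ultimately show "D \<in> events (space M) {0..} \<sigma>"
      using D(2) unfolding events_def by blast
  qed
  then show "subalgebra G (local_events t \<Lambda>)"
    unfolding subalgebra_def space_local_events sets_local_events space_G sets_G
    by (auto intro!: sigma_sets_mono')
qed

text \<open>Each step of the expansion multiplies the random coefficient in front of \<^term>\<open>F\<close> by
  a jump rate at the present position of the walker and displaces the argument of \<^term>\<open>F\<close> by at
  most \<^term>\<open>R\<close>. After \<^term>\<open>j\<close> steps the coefficient at a site depends on the
  environment within distance \<^term>\<open>real j * R\<close> of that site. The remainder after
  \<^term>\<open>k\<close> steps is an iterated integral over an ordered set of \<^term>\<open>k\<close> times,
  which is the origin of the factorial.\<close>

lemma dyson_expansion:
  assumes F: "\<And>z. (\<lambda>w. F w z) \<in> borel_measurable G" "\<And>w z. \<bar>F w z\<bar> \<le> b"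
    and decorrelated: "\<And>j a c. j \<le> n \<Longrightarrow> norm_inf a \<le> real j * R \<Longrightarrow>
      c \<in> borel_measurable (local_events t (sup_ball (real j * R))) \<Longrightarrow> (\<And>w. \<bar>c w\<bar> \<le> 1) \<Longrightarrow>
      \<bar>\<integral>w. c w * F w a \<partial>Q\<bar> \<le> b * \<delta>"
    and "0 \<le> b" "0 \<le> \<delta>"
    and "j + k \<le> n" "0 \<le> u" "u \<le> t" "norm_inf a \<le> real j * R"
    and c: "finite E" "\<And>w z. z \<notin> E \<Longrightarrow> c w z = 0" "\<And>w z. \<bar>c w z\<bar> \<le> 1"
      "\<And>z. (\<lambda>w. c w z) \<in> borel_measurable (local_events t ((+) z ` sup_ball (real j * R)))"
  shows "\<bar>\<integral>w. c w (X u w) * F w (X u w + a) \<partial>Q\<bar> \<le>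
    b * (\<delta> * exp (speed_bound * u) + (speed_bound * u) ^ k / fact k)"
  using assms(6-)
proof (induction k arbitrary: j u a c E)
  case (0 j u a c E)
  have cF: "\<bar>c w z * F w (z + a)\<bar> \<le> b" for w z
    unfolding abs_mult using mult_mono[OF 0(7) F(2)] by simp
  have "(\<lambda>w. c w z * F w (z + a)) \<in> borel_measurable M" for z
    using G_measurable_M[OF local_events_G[OF 0(8)]] G_measurable_M[OF F(1)] by simp
  then have "(\<lambda>w. c w (X u w) * F w (X u w + a)) \<in> borel_measurable M"
    using at_walker_measurable(2)[where H = "\<lambda>w z. c w z * F w (z + a)"] 0(2) by simp
  then have "\<bar>\<integral>w. c w (X u w) * F w (X u w + a) \<partial>Q\<bar> \<le> b"
    by (rule abs_integral_Q_le) (rule cF)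
  also have "\<dots> \<le> b * (\<delta> * exp (speed_bound * u) + (speed_bound * u) ^ 0 / fact 0)"
    using \<open>0 \<le> b\<close> \<open>0 \<le> \<delta>\<close> mult_left_mono[of 1 "\<delta> * exp (speed_bound * u) + 1" b] by simp
  finally show ?case .
next
  case (Suc k j u a c E)
  define A where "A v = b * (\<delta> * exp (speed_bound * v) + (speed_bound * v) ^ k / fact k)" for v
  define H where "H w z = c w z * F w (z + a)" for w z
  have H_G: "(\<lambda>w. H w z) \<in> borel_measurable G" for z
    unfolding H_def using local_events_G[OF Suc.prems(8)] F(1) by (rule borel_measurable_times)
  have H_bounded: "\<bar>H w z\<bar> \<le> b" for w z
    unfolding H_def abs_mult using mult_mono[OF Suc.prems(7) F(2)] by simp
  have H_support: "H w z = 0" if "z \<notin> E" for w z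
    using Suc.prems(6)[OF that] by (simp add: H_def)
  have initial: "\<bar>\<integral>w. H w 0 \<partial>Q\<bar> \<le> b * \<delta>"
    unfolding H_def add_0 using Suc.prems(1,4,7) Suc.prems(8)[of 0]
    by (intro decorrelated[of j]) (auto simp: image_def)
  \<comment> \<open>One step of the expansion, for a jump by \<open>y\<close>: the two terms of the generator differ in whether \<^term>\<open>H\<close> is
    evaluated after (\<open>y' = y\<close>) or before (\<open>y' = 0\<close>) the jump.\<close>
  have step: "\<bar>\<integral>w. jump_rate y v w * H w (X v w + y') \<partial>Q\<bar> \<le> \<rho> * A v"
    if v: "0 \<le> v" "v \<le> u" and y': "y' \<in> sup_ball R" for v y y'
  proof -
    define c' where "c' w z = q y (translate z (\<sigma> v w)) / \<rho> * c w (z + y')" for w z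
    have rate_le: "\<bar>q y \<eta> / \<rho>\<bar> \<le> 1" for \<eta>
      using \<rho> by (simp add: abs_divide)
    have "\<bar>\<integral>w. c' w (X v w) * F w (X v w + (y' + a)) \<partial>Q\<bar> \<le> A v"
      unfolding A_def
    proof (rule Suc.IH[of "Suc j" v "y' + a" "(\<lambda>z. z - y') ` E" c'])
      show "Suc j + k \<le> n" "0 \<le> v" "v \<le> t"
        using Suc.prems v by auto
      show "norm_inf (y' + a) \<le> real (Suc j) * R"
        using norm_inf_add_le[of y' a] y' Suc.prems(4) by (simp add: sup_ball_def algebra_simps)
      show "finite ((\<lambda>z. z - y') ` E)"
        using Suc.prems(5) by simp
      show "c' w z = 0" if "z \<notin> (\<lambda>z. z - y') ` E" for w z
      proof -
        have "z + y' \<notin> E"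
          using that by force
        then show ?thesis
          using Suc.prems(6) by (simp add: c'_def)
      qed
      show "\<bar>c' w z\<bar> \<le> 1" for w z
        unfolding c'_def abs_mult using mult_mono[OF rate_le Suc.prems(7)] by simp
      show "(\<lambda>w. c' w z) \<in> borel_measurable (local_events t ((+) z ` sup_ball (real (Suc j) * R)))" for z
      proof -
        have "sup_ball R \<subseteq> sup_ball (real (Suc j) * R)"
          using R by (auto simp: sup_ball_def algebra_simps intro: order_trans)
        then have "(\<lambda>w. q y (translate z (\<sigma> v w))) \<in>
            borel_measurable (local_events t ((+) z ` sup_ball (real (Suc j) * R)))"
          using v Suc.prems(3) rates_local[of y] borel_measurable_continuous_onI[OF rates.continuous]
          by (intro local_function_measurable[where A = "sup_ball R"]) auto
        moreover have "(+) (z + y') ` sup_ball (real j * R) \<subseteq> (+) z ` sup_ball (real (Suc j) * R)"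
        proof (rule image_subsetI)
          fix x :: "int ^ 'd"
          assume "x \<in> sup_ball (real j * R)"
          then have "y' + x \<in> sup_ball (real (Suc j) * R)"
            using y' norm_inf_add_le[of y' x] by (simp add: sup_ball_def algebra_simps)
          then show "z + y' + x \<in> (+) z ` sup_ball (real (Suc j) * R)"
            by (simp add: add.assoc)
        qed
        then have "(\<lambda>w. c w (z + y')) \<in>
            borel_measurable (local_events t ((+) z ` sup_ball (real (Suc j) * R)))"
          by (rule local_events_mono[OF _ Suc.prems(8)])
        ultimately show ?thesis
          unfolding c'_def by simp
      qed
    qed
    moreover have "(\<integral>w. jump_rate y v w * H w (X v w + y') \<partial>Q) =
        \<rho> * (\<integral>w. c' w (X v w) * F w (X v w + (y' + a)) \<partial>Q)"
      using \<rho>(1) by (simp add: c'_def H_def add.assoc mult.assoc)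
    ultimately show ?thesis
      using \<rho>(1) by (simp add: abs_mult)
  qed
  have generator_le: "\<bar>\<integral>w. generator H v w \<partial>Q\<bar> \<le> speed_bound * A v" if v: "0 \<le> v" "v \<le> u" for v
  proof -
    let ?J = "\<lambda>y y'. \<integral>w. jump_rate y v w * H w (X v w + y') \<partial>Q"
    have int: "integrable Q (\<lambda>w. jump_rate y v w * H w (X v w + y'))" for y y'
    proof (rule integrable_Q)
      show "(\<lambda>w. jump_rate y v w * H w (X v w + y')) \<in> borel_measurable M"
        by (intro borel_measurable_times seen_rate_measurable[OF v(1)]
            at_walker_measurable(1)[OF G_measurable_M[OF H_G] v(1)])
      show "\<bar>jump_rate y v w * H w (X v w + y')\<bar> \<le> \<rho> * b" for w
        unfolding abs_mult using \<rho> H_bounded by (intro mult_mono) auto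
    qed
    have "(\<integral>w. generator H v w \<partial>Q) = (\<Sum>y\<in>sup_ball R. ?J y y - ?J y 0)"
      unfolding generator_def using int[of _ 0] int by (simp add: right_diff_distrib)
    then have "\<bar>\<integral>w. generator H v w \<partial>Q\<bar> \<le> (\<Sum>y\<in>sup_ball R. \<bar>?J y y - ?J y 0\<bar>)"
      by (simp only: sum_abs)
    also have "\<dots> \<le> (\<Sum>y\<in>(sup_ball R :: (int ^ 'd) set). 2 * (\<rho> * A v))"
    proof (rule sum_mono)
      fix y :: "int ^ 'd"
      assume "y \<in> sup_ball R"
      then have "\<bar>?J y y\<bar> \<le> \<rho> * A v" "\<bar>?J y 0\<bar> \<le> \<rho> * A v"
        using R by (auto intro!: step[OF v] simp del: add_0_right simp: sup_ball_def norm_inf_0)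
      then show "\<bar>?J y y - ?J y 0\<bar> \<le> 2 * (\<rho> * A v)"
        by linarith
    qed
    also have "\<dots> = speed_bound * A v"
      by (simp add: speed_bound_def)
    finally show ?thesis .
  qed
  define B where "B v = b * (\<delta> * exp (speed_bound * v) + (speed_bound * v) ^ Suc k / fact (Suc k))" for v
  have B_derivative: "(B has_real_derivative speed_bound * A v) (at v)" for v
  proof -
    have "((\<lambda>v. (speed_bound * v) ^ Suc k / fact (Suc k)) has_real_derivative
        speed_bound * ((speed_bound * v) ^ k / fact k)) (at v)"
    proof -
      have "((\<lambda>v. (speed_bound * v) ^ Suc k) has_real_derivative
          real (Suc k) * ((speed_bound * v) ^ k * speed_bound)) (at v)"
        using DERIV_power[OF DERIV_cmult_Id[of speed_bound v UNIV], of "Suc k"] by (simp add: mult_ac)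
      then have "((\<lambda>v. (speed_bound * v) ^ Suc k / fact (Suc k)) has_real_derivative
          real (Suc k) * ((speed_bound * v) ^ k * speed_bound) / fact (Suc k)) (at v)"
        by (rule DERIV_cdivide)
      moreover have "real (Suc k) * ((speed_bound * v) ^ k * speed_bound) / fact (Suc k) =
          speed_bound * ((speed_bound * v) ^ k / fact k)"
        by (simp add: fact_Suc del: of_nat_Suc)
      ultimately show ?thesis
        by (simp only:)
    qed
    moreover have "((\<lambda>v. \<delta> * exp (speed_bound * v)) has_real_derivative
        speed_bound * (\<delta> * exp (speed_bound * v))) (at v)"
      by (auto intro!: derivative_eq_intros)
    ultimately have "(B has_real_derivative b * (speed_bound * (\<delta> * exp (speed_bound * v)) +
        speed_bound * ((speed_bound * v) ^ k / fact k))) (at v)"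
      unfolding B_def by (intro DERIV_cmult DERIV_add)
    then show ?thesis
      by (simp only: A_def distrib_left mult.left_commute[of b])
  qed
  have "has_bochner_integral lborel (\<lambda>v. speed_bound * A v * indicator {0..u} v) (B u - B 0)"
    using B_derivative Suc.prems(2)
    by (intro has_bochner_integral_FTC_Icc_real) (auto simp: A_def intro!: continuous_intros)
  then have integral: "integrable lborel (\<lambda>v. indicator {0..u} v * (speed_bound * A v))"
    "(\<integral>v. indicator {0..u} v * (speed_bound * A v) \<partial>lborel) = B u - B 0"
    by (auto simp: has_bochner_integral_iff mult.commute)
  have "\<bar>\<integral>w. H w (X u w) \<partial>Q\<bar> \<le> \<bar>\<integral>w. H w 0 \<partial>Q\<bar> + (B u - B 0)"
    using dynkin_bound[where H = H, OF H_G H_bounded Suc.prems(5) H_support Suc.prems(2) integral(1)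
        generator_le] integral(2) by simp
  also have "\<dots> \<le> B u"
    using initial by (simp add: B_def)
  finally show ?case
    by (simp add: H_def B_def)
qed

text \<open>The expansion starts from the coefficient \<open>1\<close>, cut off outside a box to have finite
  support. The bound does not depend on the box.\<close>

lemma decorrelation_of_walk:
  assumes F: "\<And>z. (\<lambda>w. F w z) \<in> borel_measurable G" "\<And>w z. \<bar>F w z\<bar> \<le> b"
    and decorrelated: "\<And>j a c. j \<le> n \<Longrightarrow> norm_inf a \<le> real j * R \<Longrightarrow>
      c \<in> borel_measurable (local_events t (sup_ball (real j * R))) \<Longrightarrow> (\<And>w. \<bar>c w\<bar> \<le> 1) \<Longrightarrow>
      \<bar>\<integral>w. c w * F w a \<partial>Q\<bar> \<le> b * \<delta>"
    and "0 \<le> b" "0 \<le> \<delta>" "0 \<le> t"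
  shows "\<bar>\<integral>w. F w (X t w) \<partial>Q\<bar> \<le> b * (\<delta> * exp (speed_bound * t) + (speed_bound * t) ^ n / fact n)"
proof -
  note F_X = at_walker_measurable(2)[where H = F, OF G_measurable_M[OF F(1)] \<open>0 \<le> t\<close>]
  have [measurable]: "(\<lambda>w. F w (X t w)) \<in> borel_measurable Q"
    using F_X by (simp cong: measurable_cong_sets add: sets_Q)
  have [measurable]: "(\<lambda>w. indicator (sup_ball (real m)) (X t w) :: real) \<in> borel_measurable Q" for m
    using measurable_compose[OF X_measurable[OF \<open>0 \<le> t\<close>], of "indicator (sup_ball (real m))" borel]
    by (simp cong: measurable_cong_sets add: sets_Q)
  have "(\<lambda>m. \<integral>w. indicator (sup_ball (real m)) (X t w) * F w (X t w) \<partial>Q)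
      \<longlonglongrightarrow> (\<integral>w. F w (X t w) \<partial>Q)"
  proof (rule integral_dominated_convergence[where w = "\<lambda>_. b"])
    show "AE w in Q. (\<lambda>m. indicator (sup_ball (real m)) (X t w) * F w (X t w)) \<longlonglongrightarrow> F w (X t w)"
    proof (rule AE_I2)
      fix w
      have "indicator (sup_ball (real m)) (X t w) * F w (X t w) = F w (X t w)"
        if "m \<ge> nat \<lceil>norm_inf (X t w)\<rceil>" for m
        using that by (simp add: sup_ball_def)
      then show "(\<lambda>m. indicator (sup_ball (real m)) (X t w) * F w (X t w)) \<longlonglongrightarrow> F w (X t w)"
        by (intro tendsto_eventually eventually_sequentiallyI)
    qed
    show "AE w in Q. norm (indicator (sup_ball (real m)) (X t w) * F w (X t w)) \<le> b" for m
      using F(2) \<open>0 \<le> b\<close> by (intro AE_I2) (simp add: abs_mult indicator_def)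
  qed auto
  then have "(\<lambda>m. \<bar>\<integral>w. indicator (sup_ball (real m)) (X t w) * F w (X t w) \<partial>Q\<bar>)
      \<longlonglongrightarrow> \<bar>\<integral>w. F w (X t w) \<partial>Q\<bar>"
    by (rule tendsto_rabs)
  moreover have "\<bar>\<integral>w. indicator (sup_ball (real m)) (X t w) * F w (X t w) \<partial>Q\<bar> \<le>
      b * (\<delta> * exp (speed_bound * t) + (speed_bound * t) ^ n / fact n)" for m
  proof -
    have "\<bar>\<integral>w. indicator (sup_ball (real m)) (X t w) * F w (X t w + 0) \<partial>Q\<bar> \<le>
        b * (\<delta> * exp (speed_bound * t) + (speed_bound * t) ^ n / fact n)"
      by (rule dyson_expansion[where n = n and j = 0 and E = "sup_ball (real m)",
            OF F decorrelated \<open>0 \<le> b\<close> \<open>0 \<le> \<delta>\<close>])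
        (use \<open>0 \<le> t\<close> in \<open>auto simp: finite_sup_ball norm_inf_0 indicator_def\<close>)
    then show ?thesis by simp
  qed
  ultimately show ?thesis
    using tendsto_upperbound[OF _ always_eventually sequentially_bot] by blast
qed

end

section \<open>Decay of correlations with the origin\<close>

lemma power_over_fact_le_exp:
  fixes y :: real
  assumes "y \<ge> 0"
  shows "y ^ n / fact n \<le> exp y"
proof -
  have "(\<lambda>k. y ^ k /\<^sub>R fact k) sums exp y"
    by (rule exp_converges)
  then have "sum (\<lambda>k. y ^ k /\<^sub>R fact k) {n} \<le> exp y"
    unfolding sums_iff using assms sum_le_suminf[of "\<lambda>k. y ^ k /\<^sub>R fact k" "{n}"] by auto
  then show ?thesis
    by (simp add: divide_inverse mult.commute)
qed

text \<open>At distance \<open>\<xi>\<close> the walk is run for a time \<open>\<tau> * \<xi>\<close> and the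
  expansion is stopped after a number of steps proportional to \<open>\<xi>\<close>. That number is kept small
  enough for the coefficients and the displacements of the observable to use up at most a quarter of the
  distance together. The time is so short that the environment does not carry influence across the remaining gap
  and that the exponential growth in time is outweighed.\<close>

lemma choice_of_scales:
  fixes C \<theta> N R c :: real
  assumes "C > 0" "\<theta> > 0" "N \<ge> 0" "R > 0" "c > 0"
  shows "\<exists>\<theta>'>0. \<exists>\<tau>>0. \<forall>L\<ge>0. \<forall>\<xi>\<ge>4 * L. \<exists>n.
    C * (\<tau> * \<xi>) \<le> \<xi> - 2 * real n * R - L \<and>
    exp (- \<theta> * (\<xi> - 2 * real n * R - L)) * exp (N * (\<tau> * \<xi>)) + (N * (\<tau> * \<xi>)) ^ n / fact n
      \<le> (1 + exp 1) * exp (- \<theta>' * \<xi>) \<and>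
    exp (- c * (\<tau> * \<xi>)) \<le> exp (- \<theta>' * \<xi>)"
    (is "\<exists>\<theta>'>0. \<exists>\<tau>>0. \<forall>L\<ge>0. \<forall>\<xi>\<ge>4 * L. \<exists>n. ?fits \<theta>' \<tau> L \<xi> n")
proof -
  define \<kappa> where "\<kappa> = 1 / (8 * R)"
  define \<tau> where "\<tau> = min (1 / (2 * C)) (min (\<theta> / (4 * (N + 1))) (\<kappa> / (2 * (exp 1 * (N + 1)))))"
  define \<theta>' where "\<theta>' = min (\<theta> / 4) (min (\<kappa> / 2) (c * \<tau>))"
  have "\<kappa> > 0"
    using assms by (simp add: \<kappa>_def)
  have "\<tau> > 0"
    unfolding \<tau>_def min_less_iff_conj using assms \<open>\<kappa> > 0\<close> by simp
  have "\<theta>' > 0"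
    unfolding \<theta>'_def min_less_iff_conj using assms \<open>\<kappa> > 0\<close> \<open>\<tau> > 0\<close> by simp
  have "\<tau> \<le> 1 / (2 * C)" "\<tau> \<le> \<theta> / (4 * (N + 1))" "\<tau> \<le> \<kappa> / (2 * (exp 1 * (N + 1)))"
    unfolding \<tau>_def by linarith+
  then have \<tau>_le: "C * \<tau> \<le> 1 / 2" "(N + 1) * \<tau> \<le> \<theta> / 4" "exp 1 * (N + 1) * \<tau> \<le> \<kappa> / 2"
  proof -
    have "0 < 2 * (exp 1 * (N + 1))"
      using assms(3) by simp
    then have "\<tau> * (2 * (exp 1 * (N + 1))) \<le> \<kappa>"
      using \<open>\<tau> \<le> \<kappa> / (2 * (exp 1 * (N + 1)))\<close> by (simp only: pos_le_divide_eq)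
    then show "exp 1 * (N + 1) * \<tau> \<le> \<kappa> / 2"
      by argo
    show "C * \<tau> \<le> 1 / 2" "(N + 1) * \<tau> \<le> \<theta> / 4"
      using \<open>\<tau> \<le> 1 / (2 * C)\<close> \<open>\<tau> \<le> \<theta> / (4 * (N + 1))\<close> assms
      by (simp_all add: pos_le_divide_eq field_simps)
  qed
  have N\<tau>: "N * \<tau> \<le> \<theta> / 4" "exp 1 * (N * \<tau>) \<le> \<kappa> / 2"
  proof -
    have "N * \<tau> \<le> (N + 1) * \<tau>"
      using \<open>\<tau> > 0\<close> by (intro mult_right_mono) auto
    then show "N * \<tau> \<le> \<theta> / 4"
      using \<tau>_le(2) by linarith
    have "exp 1 * (N * \<tau>) \<le> exp 1 * ((N + 1) * \<tau>)"
      using \<open>N * \<tau> \<le> (N + 1) * \<tau>\<close> by (rule mult_left_mono) simp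
    then show "exp 1 * (N * \<tau>) \<le> \<kappa> / 2"
      using \<tau>_le(3) unfolding mult.assoc by (rule order_trans)
  qed
  have \<theta>'_le: "\<theta>' \<le> \<theta> / 4" "\<theta>' \<le> \<kappa> / 2" "\<theta>' \<le> c * \<tau>"
    unfolding \<theta>'_def by linarith+
  have "\<exists>n. ?fits \<theta>' \<tau> L \<xi> n" if "L \<ge> 0" "\<xi> \<ge> 4 * L" for L \<xi>
  proof (intro exI conjI)
    define n where "n = nat \<lfloor>\<kappa> * \<xi>\<rfloor>"
    have "\<xi> \<ge> 0"
      using that by linarith
    then have "\<kappa> * \<xi> \<ge> 0"
      using \<open>\<kappa> > 0\<close> by simp
    then have n: "real n \<le> \<kappa> * \<xi>" "\<kappa> * \<xi> \<le> real n + 1"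
      unfolding n_def by linarith+
    have "real n * R \<le> \<xi> / 8"
      using n(1) assms(4) mult_right_mono[of "real n" "\<kappa> * \<xi>" R] by (simp add: \<kappa>_def)
    then have gap: "\<xi> / 2 \<le> \<xi> - 2 * real n * R - L"
      using that by linarith
    have "C * \<tau> * \<xi> \<le> 1 / 2 * \<xi>"
      using \<tau>_le(1) \<open>\<xi> \<ge> 0\<close> by (rule mult_right_mono)
    then show "C * (\<tau> * \<xi>) \<le> \<xi> - 2 * real n * R - L"
      using gap by (simp add: mult.assoc)
    show "exp (- c * (\<tau> * \<xi>)) \<le> exp (- \<theta>' * \<xi>)"
      using mult_right_mono[OF \<theta>'_le(3) \<open>\<xi> \<ge> 0\<close>] by (simp add: mult.assoc)
    have first: "exp (- \<theta> * (\<xi> - 2 * real n * R - L)) * exp (N * (\<tau> * \<xi>)) \<le> exp (- \<theta>' * \<xi>)"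
    proof -
      have "N * \<tau> * \<xi> \<le> \<theta> / 4 * \<xi>" "\<theta>' * \<xi> \<le> \<theta> / 4 * \<xi>"
        by (rule mult_right_mono[OF N\<tau>(1) \<open>\<xi> \<ge> 0\<close>], rule mult_right_mono[OF \<theta>'_le(1) \<open>\<xi> \<ge> 0\<close>])
      moreover have "\<theta> * (\<xi> / 2) \<le> \<theta> * (\<xi> - 2 * real n * R - L)"
        using gap assms(2) by (intro mult_left_mono) auto
      ultimately have "- \<theta> * (\<xi> - 2 * real n * R - L) + N * (\<tau> * \<xi>) \<le> - \<theta>' * \<xi>"
        by argo
      then show ?thesis
        by (simp add: exp_add[symmetric])
    qed
    have second: "(N * (\<tau> * \<xi>)) ^ n / fact n \<le> exp 1 * exp (- \<theta>' * \<xi>)"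
    proof -
      have nonneg: "0 \<le> exp 1 * (N * (\<tau> * \<xi>))"
        using assms(3) \<open>\<tau> > 0\<close> \<open>\<xi> \<ge> 0\<close> by simp
      have "(N * (\<tau> * \<xi>)) ^ n / fact n = exp (- real n) * ((exp 1 * (N * (\<tau> * \<xi>))) ^ n / fact n)"
        by (simp add: power_mult_distrib exp_of_nat_mult[symmetric] exp_minus)
      also have "\<dots> \<le> exp (- real n) * exp (exp 1 * (N * (\<tau> * \<xi>)))"
        using power_over_fact_le_exp[OF nonneg] by (intro mult_left_mono) auto
      also have "\<dots> = exp (- real n + exp 1 * (N * (\<tau> * \<xi>)))"
        by (rule exp_add[symmetric])
      also have "\<dots> \<le> exp (1 - \<theta>' * \<xi>)"
      proof -
        have "exp 1 * (N * \<tau>) * \<xi> \<le> \<kappa> / 2 * \<xi>" "\<theta>' * \<xi> \<le> \<kappa> / 2 * \<xi>"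
          by (rule mult_right_mono[OF N\<tau>(2) \<open>\<xi> \<ge> 0\<close>], rule mult_right_mono[OF \<theta>'_le(2) \<open>\<xi> \<ge> 0\<close>])
        then have "- real n + exp 1 * (N * (\<tau> * \<xi>)) \<le> 1 - \<theta>' * \<xi>"
          using n(2) by argo
        then show ?thesis by simp
      qed
      also have "\<dots> = exp 1 * exp (- \<theta>' * \<xi>)"
        by (simp add: exp_add[symmetric])
      finally show ?thesis .
    qed
    show "exp (- \<theta> * (\<xi> - 2 * real n * R - L)) * exp (N * (\<tau> * \<xi>)) + (N * (\<tau> * \<xi>)) ^ n / fact n
        \<le> (1 + exp 1) * exp (- \<theta>' * \<xi>)"
      using first second by (simp add: distrib_right)
  qed
  then show ?thesis
    using \<open>\<theta>' > 0\<close> \<open>\<tau> > 0\<close> by blast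
qed

lemma set_distance_ge:
  assumes "A \<noteq> {}" "B \<noteq> {}" "\<And>x y. x \<in> A \<Longrightarrow> y \<in> B \<Longrightarrow> D \<le> norm_inf (x - y)"
  shows "D \<le> set_distance A B"
  unfolding set_distance_def using assms by (intro cInf_greatest) auto

text \<open>For a centred observable the product of means in the decorrelation inequality vanishes. A
  coefficient after \<^term>\<open>j\<close> steps lives within \<^term>\<open>real j * R\<close> of the origin
  and the observable has come closer by at most as much, which is why \<^term>\<open>2 * real n * R\<close> is
  subtracted from the distance.\<close>

lemma (in environment_walk) far_observable_decorrelates:
  assumes stationary: "invariant_measure P \<sigma> \<mu>" and shift: "\<And>x. distr \<mu> borel (translate x) = \<mu>"
    and speed: "\<And>\<Lambda> \<Lambda>' U V. \<Lambda> \<noteq> {} \<Longrightarrow> \<Lambda>' \<noteq> {} \<Longrightarrow> set_distance \<Lambda> \<Lambda>' \<ge> C * t \<Longrightarrow>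
      U \<in> borel_measurable (local_events t \<Lambda>) \<Longrightarrow> V \<in> borel_measurable (local_events t \<Lambda>') \<Longrightarrow>
      (\<And>w. \<bar>U w\<bar> \<le> 1) \<Longrightarrow> (\<And>w. \<bar>V w\<bar> \<le> 1) \<Longrightarrow>
      \<bar>(\<integral>w. U w * V w \<partial>Q) - (\<integral>w. U w \<partial>Q) * (\<integral>w. V w \<partial>Q)\<bar> \<le> exp (- \<theta> * set_distance \<Lambda> \<Lambda>')"
    and "\<theta> > 0" "C > 0" "t \<ge> 0" "L \<ge> 0"
    and f: "f \<in> borel_measurable borel" "\<And>\<eta>. \<bar>f \<eta>\<bar> \<le> b" "depends_only_on f (sup_ball L)" "(\<integral>\<eta>. f \<eta> \<partial>\<mu>) = 0"
    and far: "C * t \<le> norm_inf x - 2 * real n * R - L"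
  shows "\<bar>\<integral>w. f (translate x (seen_from X \<sigma> t w)) \<partial>Q\<bar> \<le>
    b * (exp (- \<theta> * (norm_inf x - 2 * real n * R - L)) * exp (speed_bound * t) + (speed_bound * t) ^ n / fact n)"
proof -
  define F where "F w z = f (translate (x + z) (\<sigma> t w))" for w z
  define D where "D = norm_inf x - 2 * real n * R - L"
  have F_local: "(\<lambda>w. F w z) \<in> borel_measurable (local_events t ((+) (x + z) ` sup_ball L))" for z
    unfolding F_def using f \<open>t \<ge> 0\<close> by (intro local_function_measurable[where A = "sup_ball L"]) auto
  have F_bounded: "\<bar>F w z\<bar> \<le> b" for w z
    unfolding F_def by (rule f(2))
  have "b \<ge> 0"
    using order_trans[OF abs_ge_zero f(2)] .
  have F_mean: "(\<integral>w. F w z \<partial>Q) = 0" for z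
  proof -
    have measurable: "(\<lambda>\<eta>. f (translate (x + z) \<eta>)) \<in> borel_measurable borel"
      using translate_measurable f(1) by (rule measurable_compose)
    have "(\<integral>w. F w z \<partial>Q) = (\<integral>\<eta>. f (translate (x + z) \<eta>) \<partial>\<mu>)"
      unfolding F_def Q_def
      using env.integral_transition[OF \<mu> measurable f(2) \<open>t \<ge> 0\<close>]
        env.integral_invariant[OF \<mu> stationary measurable f(2) \<open>t \<ge> 0\<close>] by simp
    then show ?thesis
      using rates.integral_translate(1)[OF \<mu> shift f(1)] f(4) by simp
  qed
  have "\<bar>\<integral>w. F w (X t w) \<partial>Q\<bar> \<le>
    b * (exp (- \<theta> * D) * exp (speed_bound * t) + (speed_bound * t) ^ n / fact n)"
  proof (rule decorrelation_of_walk[OF local_events_G[OF F_local] F_bounded _ \<open>b \<ge> 0\<close> _ \<open>t \<ge> 0\<close>])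
    fix j :: nat and a :: "int ^ 'd" and c :: "'w \<Rightarrow> real"
    assume j: "j \<le> n" and a: "norm_inf a \<le> real j * R"
      and c: "c \<in> borel_measurable (local_events t (sup_ball (real j * R)))" "\<And>w. \<bar>c w\<bar> \<le> 1"
    show "\<bar>\<integral>w. c w * F w a \<partial>Q\<bar> \<le> b * exp (- \<theta> * D)"
    proof (cases "b = 0")
      case True
      then have "F w a = 0" for w
        using F_bounded[of w a] by simp
      then show ?thesis
        using True by simp
    next
      case False
      then have "b > 0"
        using \<open>b \<ge> 0\<close> by simp
      let ?\<Lambda> = "sup_ball (real j * R) :: (int ^ 'd) set" and ?\<Lambda>' = "(+) (x + a) ` sup_ball L"
      have nonempty: "?\<Lambda> \<noteq> {}" "?\<Lambda>' \<noteq> {}"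
        using R \<open>L \<ge> 0\<close> by (auto simp: sup_ball_def norm_inf_0 intro!: exI[of _ 0])
      have distance: "D \<le> set_distance ?\<Lambda> ?\<Lambda>'"
      proof (rule set_distance_ge[OF nonempty])
        fix p y
        assume p: "p \<in> ?\<Lambda>" and "y \<in> ?\<Lambda>'"
        then obtain l where y: "y = x + a + l" and l: "norm_inf l \<le> L"
          by (auto simp: sup_ball_def)
        have "real j * R \<le> real n * R"
          using j R by (intro mult_right_mono) auto
        moreover have "norm_inf p \<le> real j * R"
          using p by (simp add: sup_ball_def)
        moreover have "norm_inf x - norm_inf (a + (l - p)) \<le> norm_inf (x + (a + (l - p)))"
          by (rule norm_inf_add_ge)
        moreover have "norm_inf (a + (l - p)) \<le> norm_inf a + (norm_inf l + norm_inf p)"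
          using norm_inf_add_le[of a "l - p"] norm_inf_add_le[of l "- p"] by (simp add: norm_inf_minus)
        moreover have "norm_inf (p - y) = norm_inf (x + (a + (l - p)))"
          using norm_inf_minus[of "p - y"] by (simp add: y algebra_simps)
        ultimately show "D \<le> norm_inf (p - y)"
          using a l unfolding D_def by linarith
      qed
      have "\<bar>(\<integral>w. c w * (F w a / b) \<partial>Q) - (\<integral>w. c w \<partial>Q) * (\<integral>w. F w a / b \<partial>Q)\<bar>
          \<le> exp (- \<theta> * set_distance ?\<Lambda> ?\<Lambda>')"
      proof (rule speed[OF nonempty])
        show "C * t \<le> set_distance ?\<Lambda> ?\<Lambda>'"
          using far distance by (simp add: D_def)
        show "\<bar>F w a / b\<bar> \<le> 1" for w
          using F_bounded[of w a] \<open>b > 0\<close> by (simp add: abs_divide)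
      qed (use c F_local in auto)
      also have "\<dots> \<le> exp (- \<theta> * D)"
        using distance \<open>\<theta> > 0\<close> by simp
      finally show ?thesis
        using \<open>b > 0\<close> by (simp add: F_mean abs_divide pos_divide_le_eq mult.commute)
    qed
  qed simp
  moreover have "F w (X t w) = f (translate x (seen_from X \<sigma> t w))" for w
    by (simp add: F_def seen_from_def translate_translate)
  ultimately show ?thesis
    by (simp add: D_def)
qed

theorem theorem3:
  fixes M :: "'w measure"
    and P :: "(int ^ 'd \<Rightarrow> 's::polish_space) \<Rightarrow> 'w measure"
    and \<sigma> :: "real \<Rightarrow> 'w \<Rightarrow> int ^ 'd \<Rightarrow> 's"
    and X X\<^sub>\<epsilon> :: "real \<Rightarrow> 'w \<Rightarrow> int ^ 'd"
    and r r\<^sub>\<epsilon> r_hat :: "int ^ 'd \<Rightarrow> (int ^ 'd \<Rightarrow> 's) \<Rightarrow> real"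
    and \<mu> \<mu>\<^sub>\<epsilon> :: "(int ^ 'd \<Rightarrow> 's) measure"
    and \<gamma> \<epsilon> :: real and n :: nat
  defines "S_env \<equiv> transition P \<sigma>"
    and "S \<equiv> transition P (seen_from X \<sigma>)"
    and "S\<^sub>\<epsilon> \<equiv> transition P (seen_from X\<^sub>\<epsilon> \<sigma>)"
  assumes compact_S: "compact (UNIV :: 's set)"
    and env_feller: "feller_process M P \<sigma>"
    and env_cadlag: "\<forall>w\<in>space M. cadlag (\<lambda>t. \<sigma> t w)"
    and \<mu>_prob: "prob_space \<mu>" "sets \<mu> = sets borel"
    and \<mu>_shift: "\<forall>x. distr \<mu> borel (translate x) = \<mu>"
    and env_stationary: "invariant_measure P \<sigma> \<mu>"
    and env_shift: "\<forall>f x. \<forall>t\<ge>0. square_integrable \<mu> f \<longrightarrow>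
          (AE \<eta> in \<mu>. S_env t (f \<circ> translate x) \<eta> = S_env t f (translate x \<eta>))"
    and \<gamma>_pos: "\<gamma> > 0"
    and poincare: "\<forall>(f, g)\<in>L2_generator \<mu> S_env. (\<integral>\<eta>. f \<eta> \<partial>\<mu>) = 0 \<longrightarrow>
          \<gamma> * (L2_norm \<mu> f)\<^sup>2 \<le> - (\<integral>\<eta>. f \<eta> * g \<eta> \<partial>\<mu>)"
    and rates_continuous: "\<forall>y. continuous_on UNIV (r y) \<and> continuous_on UNIV (r\<^sub>\<epsilon> y) \<and>
          continuous_on UNIV (r_hat y)"
    and rates_0: "\<forall>\<eta>. r 0 \<eta> = 0 \<and> r\<^sub>\<epsilon> 0 \<eta> = 0 \<and> r_hat 0 \<eta> = 0"
    and rates_nonneg: "\<forall>y \<eta>. r y \<eta> \<ge> 0 \<and> r\<^sub>\<epsilon> y \<eta> \<ge> 0"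
    and rates_sum: "\<forall>y \<eta>. r\<^sub>\<epsilon> y \<eta> = r y \<eta> + r_hat y \<eta>"
    and n_pos: "n \<ge> 1"
    and r_moment: "(\<lambda>y. norm_inf y ^ n * (SUP \<eta>. r y \<eta>)) summable_on UNIV"
    and r_hat_moment: "(\<lambda>y. norm_inf y ^ n * (SUP \<eta>. \<bar>r_hat y \<eta>\<bar>)) summable_on UNIV"
    and walker: "walker M P \<sigma> r X"
    and walker_\<epsilon>: "walker M P \<sigma> r\<^sub>\<epsilon> X\<^sub>\<epsilon>"
    and seen_feller: "feller_process M P (seen_from X \<sigma>)"
    and seen_\<epsilon>_feller: "feller_process M P (seen_from X\<^sub>\<epsilon> \<sigma>)"
    and seen_generator: "C_generator S =
          {(f, \<lambda>\<eta>. g \<eta> + jump_operator r f \<eta>) | f g. (f, g) \<in> C_generator S_env}"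
    and seen_\<epsilon>_generator: "C_generator S\<^sub>\<epsilon> =
          {(f, \<lambda>\<eta>. g \<eta> + jump_operator r f \<eta> + jump_operator r_hat f \<eta>) | f g.
             (f, g) \<in> C_generator S_env}"
    and \<mu>_invariant: "invariant_measure P (seen_from X \<sigma>) \<mu>"
    and \<epsilon>_def: "\<epsilon> = L2_operator_norm \<mu> (jump_operator r_hat)"
    and \<epsilon>_less: "\<epsilon> < \<gamma>"
    and \<mu>\<^sub>\<epsilon>_prob: "prob_space \<mu>\<^sub>\<epsilon>" "sets \<mu>\<^sub>\<epsilon> = sets borel"
    and \<mu>\<^sub>\<epsilon>_ac: "absolutely_continuous \<mu> \<mu>\<^sub>\<epsilon>"
    and \<mu>\<^sub>\<epsilon>_invariant: "invariant_measure P (seen_from X\<^sub>\<epsilon> \<sigma>) \<mu>\<^sub>\<epsilon>"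
    and S_shift: "\<forall>f x. \<forall>t\<ge>0. local_function f \<longrightarrow> S t (f \<circ> translate x) = S t f \<circ> translate x"
    and speed: "\<exists>\<alpha> \<theta>. \<theta> > 0 \<and> finite_speed (\<mu> \<bind> P) \<sigma> \<alpha> \<and> (\<forall>u\<ge>0. \<alpha> u \<le> exp (- \<theta> * u))"
    and finite_range: "\<exists>R>0.
          (\<forall>z \<eta>. z \<notin> sup_ball R \<longrightarrow> r z \<eta> = 0 \<and> r_hat z \<eta> = 0) \<and>
          (\<forall>z. depends_only_on (r z) (sup_ball R) \<and> depends_only_on (r_hat z) (sup_ball R))"
  shows "\<exists>\<theta>'>0. \<forall>f. local_function f \<longrightarrow>
           (\<exists>C. \<forall>x. \<bar>(\<integral>\<eta>. f (translate x \<eta>) \<partial>\<mu>\<^sub>\<epsilon>) - (\<integral>\<eta>. f \<eta> \<partial>\<mu>)\<bar> \<le> C * exp (- \<theta>' * norm_inf x))"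
proof -
  obtain R where R: "R > 0" and range: "\<And>z \<eta>. z \<notin> sup_ball R \<Longrightarrow> r z \<eta> = 0 \<and> r_hat z \<eta> = 0"
    and local: "\<And>z. depends_only_on (r z) (sup_ball R) \<and> depends_only_on (r_hat z) (sup_ball R)"
    using finite_range by blast
  interpret env: feller M P \<sigma>
    using env_feller compact_configurations[OF compact_S] by unfold_locales
  interpret seen: feller M P "seen_from X \<sigma>"
    using seen_feller compact_configurations[OF compact_S] by unfold_locales
  interpret pert: feller M P "seen_from X\<^sub>\<epsilon> \<sigma>"
    using seen_\<epsilon>_feller compact_configurations[OF compact_S] by unfold_locales
  interpret r: finite_range_rates r R
    using compact_S rates_continuous range by unfold_locales auto
  interpret r_hat: finite_range_rates r_hat R
    using compact_S rates_continuous range by unfold_locales auto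
  interpret r\<^sub>\<epsilon>: finite_range_rates r\<^sub>\<epsilon> R
    using compact_S rates_continuous range rates_sum by unfold_locales auto
  obtain \<rho> where \<rho>: "\<rho> > 0" "\<And>y \<eta>. \<bar>r y \<eta>\<bar> \<le> \<rho>"
    using r.bounded_rates by blast
  obtain \<rho>\<^sub>\<epsilon> where \<rho>\<^sub>\<epsilon>: "\<rho>\<^sub>\<epsilon> > 0" "\<And>y \<eta>. \<bar>r\<^sub>\<epsilon> y \<eta>\<bar> \<le> \<rho>\<^sub>\<epsilon>"
    using r\<^sub>\<epsilon>.bounded_rates by blast
  have shift: "distr \<mu> borel (translate x) = \<mu>" for x
    using \<mu>_shift by blast
  have "0 \<le> \<epsilon>"
    unfolding \<epsilon>_def using r_hat.operator_norm_bound(1)[OF \<mu>_prob shift] .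
  \<comment> \<open>Any constant between the norm of the perturbation and the spectral gap serves, and a positive one
    is more convenient than \<^term>\<open>\<epsilon>\<close>, which may be zero.\<close>
  define \<epsilon>' where "\<epsilon>' = (\<epsilon> + \<gamma>) / 2"
  have \<epsilon>': "0 < \<epsilon>'" "\<epsilon> \<le> \<epsilon>'" "\<epsilon>' < \<gamma>"
    using \<open>0 \<le> \<epsilon>\<close> \<gamma>_pos \<epsilon>_less by (simp_all add: \<epsilon>'_def)
  interpret \<mu>: prob_space \<mu>
    by (rule \<mu>_prob)
  interpret \<mu>\<^sub>\<epsilon>: prob_space \<mu>\<^sub>\<epsilon>
    by (rule \<mu>\<^sub>\<epsilon>_prob)
  interpret relax: perturbed_feller M P \<sigma> "seen_from X \<sigma>" "seen_from X\<^sub>\<epsilon> \<sigma>" \<mu> \<mu>\<^sub>\<epsilon>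
    "jump_operator r" "jump_operator r_hat" \<gamma> \<epsilon>' "real (card (sup_ball R :: (int ^ 'd) set)) * \<rho> * 2"
  proof unfold_locales
    show "\<gamma> * (\<integral>\<eta>. (f \<eta> - (\<integral>\<zeta>. f \<zeta> \<partial>\<mu>))\<^sup>2 \<partial>\<mu>) \<le> - (\<integral>\<eta>. (f \<eta> - (\<integral>\<zeta>. f \<zeta> \<partial>\<mu>)) * g \<eta> \<partial>\<mu>)"
      if "(f, g) \<in> C_generator (transition P \<sigma>)" for f g
      using env.poincare_continuous[OF \<mu>_prob poincare[unfolded S_env_def] that] .
    show "(f, \<lambda>\<eta>. g \<eta> + jump_operator r f \<eta>) \<in> C_generator (transition P (seen_from X \<sigma>))"
      if "(f, g) \<in> C_generator (transition P \<sigma>)" for f g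
      using seen_generator that unfolding S_def S_env_def by blast
    show "\<exists>g. (f, g) \<in> C_generator (transition P \<sigma>) \<and>
        h = (\<lambda>\<eta>. g \<eta> + jump_operator r f \<eta> + jump_operator r_hat f \<eta>)"
      if "(f, h) \<in> C_generator (transition P (seen_from X\<^sub>\<epsilon> \<sigma>))" for f h
      using seen_\<epsilon>_generator that unfolding S\<^sub>\<epsilon>_def S_env_def by blast
    show "(\<integral>\<eta>. (jump_operator r_hat f \<eta>)\<^sup>2 \<partial>\<mu>) \<le> \<epsilon>'\<^sup>2 * (\<integral>\<eta>. (f \<eta>)\<^sup>2 \<partial>\<mu>)"
      if f: "continuous_on UNIV f" for f
    proof -
      have "square_integrable \<mu> f"
        using env.square_integrable_continuous[OF \<mu>_prob f] .
      then have "(\<integral>\<eta>. (jump_operator r_hat f \<eta>)\<^sup>2 \<partial>\<mu>) \<le> \<epsilon>\<^sup>2 * (\<integral>\<eta>. (f \<eta>)\<^sup>2 \<partial>\<mu>)"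
        unfolding \<epsilon>_def by (rule r_hat.operator_norm_bound(2)[OF \<mu>_prob shift])
      also have "\<dots> \<le> \<epsilon>'\<^sup>2 * (\<integral>\<eta>. (f \<eta>)\<^sup>2 \<partial>\<mu>)"
        using \<epsilon>' \<open>0 \<le> \<epsilon>\<close> by (intro mult_right_mono power_mono) auto
      finally show ?thesis .
    qed
    show "\<bar>jump_operator r f \<eta>\<bar> \<le> real (card (sup_ball R :: (int ^ 'd) set)) * \<rho> * 2 * c"
      if "\<And>\<eta>. \<bar>f \<eta>\<bar> \<le> c" for f c \<eta>
      using r.jump_operator_bounded[OF \<rho>(2) that] .
    show "2 * f \<eta> * jump_operator r f \<eta> \<le> jump_operator r (\<lambda>\<eta>. f \<eta> * f \<eta>) \<eta>" for f \<eta>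
      using rates_nonneg by (intro r.jump_operator_square) auto
  qed (use \<mu>_prob env_stationary \<mu>_invariant r.jump_operator_continuous r.jump_operator_diff
      r_hat.jump_operator_continuous r_hat.jump_operator_shift \<epsilon>' \<mu>\<^sub>\<epsilon>_prob \<mu>\<^sub>\<epsilon>_ac \<mu>\<^sub>\<epsilon>_invariant in auto)
  interpret walk: environment_walk M P \<sigma> r\<^sub>\<epsilon> R X\<^sub>\<epsilon> \<mu> \<rho>\<^sub>\<epsilon>
  proof unfold_locales
    show "depends_only_on (r\<^sub>\<epsilon> y) (sup_ball R)" for y
      using local[of y] rates_sum unfolding depends_only_on_def by metis
  qed (use env_cadlag walker_\<epsilon> \<mu>_prob \<rho>\<^sub>\<epsilon> R in auto)
  obtain \<alpha> \<theta> where "\<theta> > 0" and \<alpha>: "finite_speed (\<mu> \<bind> P) \<sigma> \<alpha>" "\<And>u. u \<ge> 0 \<Longrightarrow> \<alpha> u \<le> exp (- \<theta> * u)"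
    using speed by blast
  let ?Q = "\<mu> \<bind> P"
  let ?events = "\<lambda>t \<Lambda>. events (space ?Q) ({0..t} \<times> \<Lambda>) (\<lambda>(s, x) w. \<sigma> s w x)"
  obtain C where "C > 0" and C: "\<forall>t\<ge>0. \<forall>\<Lambda> \<Lambda>' U V. \<Lambda> \<noteq> {} \<longrightarrow> \<Lambda>' \<noteq> {} \<longrightarrow>
      set_distance \<Lambda> \<Lambda>' \<ge> C * t \<longrightarrow>
      U \<in> borel_measurable (sigma (space ?Q) (?events t \<Lambda>)) \<longrightarrow>
      V \<in> borel_measurable (sigma (space ?Q) (?events t \<Lambda>')) \<longrightarrow>
      (\<forall>w\<in>space ?Q. \<bar>U w\<bar> \<le> 1) \<longrightarrow> (\<forall>w\<in>space ?Q. \<bar>V w\<bar> \<le> 1) \<longrightarrow>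
      \<bar>(\<integral>w. U w * V w \<partial>?Q) - (\<integral>w. U w \<partial>?Q) * (\<integral>w. V w \<partial>?Q)\<bar> \<le> \<alpha> (set_distance \<Lambda> \<Lambda>')"
    using \<alpha>(1) unfolding finite_speed_def by (elim conjE exE) (rule that)
  have local_events: "sigma (space ?Q) (?events t \<Lambda>) = walk.local_events t \<Lambda>" for t \<Lambda>
    using walk.space_Q by (simp add: walk.local_events_def walk.Q_def)
  have decorrelation: "\<bar>(\<integral>w. U w * V w \<partial>walk.Q) - (\<integral>w. U w \<partial>walk.Q) * (\<integral>w. V w \<partial>walk.Q)\<bar>
      \<le> exp (- \<theta> * set_distance \<Lambda> \<Lambda>')"
    if "t \<ge> 0" "\<Lambda> \<noteq> {}" "\<Lambda>' \<noteq> {}" "set_distance \<Lambda> \<Lambda>' \<ge> C * t"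
      "U \<in> borel_measurable (walk.local_events t \<Lambda>)" "V \<in> borel_measurable (walk.local_events t \<Lambda>')"
      "\<And>w. \<bar>U w\<bar> \<le> 1" "\<And>w. \<bar>V w\<bar> \<le> 1" for t \<Lambda> \<Lambda>' U V
  proof -
    have "0 \<le> C * t"
      using \<open>C > 0\<close> that(1) by simp
    then have "\<alpha> (set_distance \<Lambda> \<Lambda>') \<le> exp (- \<theta> * set_distance \<Lambda> \<Lambda>')"
      using that(4) by (intro \<alpha>(2)) linarith
    moreover have "\<bar>(\<integral>w. U w * V w \<partial>walk.Q) - (\<integral>w. U w \<partial>walk.Q) * (\<integral>w. V w \<partial>walk.Q)\<bar>
        \<le> \<alpha> (set_distance \<Lambda> \<Lambda>')"
      unfolding walk.Q_def using that by (intro C[rule_format]) (simp_all add: local_events)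
    ultimately show ?thesis
      by linarith
  qed
  obtain \<theta>' \<tau> where "\<theta>' > 0" "\<tau> > 0" and scales: "\<And>L \<xi>. L \<ge> 0 \<Longrightarrow> \<xi> \<ge> 4 * L \<Longrightarrow> \<exists>n.
      C * (\<tau> * \<xi>) \<le> \<xi> - 2 * real n * R - L \<and>
      exp (- \<theta> * (\<xi> - 2 * real n * R - L)) * exp (walk.speed_bound * (\<tau> * \<xi>)) +
        (walk.speed_bound * (\<tau> * \<xi>)) ^ n / fact n \<le> (1 + exp 1) * exp (- \<theta>' * \<xi>) \<and>
      exp (- (\<gamma> - \<epsilon>') * (\<tau> * \<xi>)) \<le> exp (- \<theta>' * \<xi>)"
    using choice_of_scales[OF \<open>C > 0\<close> \<open>\<theta> > 0\<close> walk.speed_bound_nonneg R, of "\<gamma> - \<epsilon>'"] \<epsilon>'(3) by auto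
  show ?thesis
  proof (rule exI[of _ \<theta>'], intro conjI allI impI)
    show "\<theta>' > 0" by fact
    fix f :: "(int ^ 'd \<Rightarrow> 's) \<Rightarrow> real"
    assume "local_function f"
    then obtain A b0 where f: "f \<in> borel_measurable borel" "finite A" "depends_only_on f A"
      and b0: "\<And>\<eta>. \<bar>f \<eta>\<bar> \<le> b0"
      by (auto simp: local_function_def bounded_iff)
    define L where "L = (\<Sum>y\<in>A. norm_inf y)"
    have "L \<ge> 0"
      unfolding L_def by (intro sum_nonneg norm_inf_nonneg)
    have A: "A \<subseteq> sup_ball L"
      unfolding sup_ball_def L_def using f(2) norm_inf_nonneg by (auto intro: member_le_sum)
    define g where "g \<eta> = f \<eta> - (\<integral>\<eta>. f \<eta> \<partial>\<mu>)" for \<eta>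
    define b where "b = 2 * b0"
    have integrable: "integrable \<nu> f" "integrable \<nu> (\<lambda>\<eta>. f (translate x \<eta>))"
      if "prob_space \<nu>" "sets \<nu> = sets borel" for \<nu> x
    proof -
      interpret \<nu>: prob_space \<nu> by fact
      show "integrable \<nu> f" "integrable \<nu> (\<lambda>\<eta>. f (translate x \<eta>))"
        using f(1) b0 measurable_compose[OF translate_measurable f(1)] that(2)
        by (auto intro!: \<nu>.integrable_const_bound[where B = b0] cong: measurable_cong_sets)
    qed
    have mean_le: "\<bar>\<integral>\<eta>. f \<eta> \<partial>\<mu>\<bar> \<le> b0"
      using integrable(1)[OF \<mu>_prob] b0 by (intro \<mu>.abs_integral_le)
    have g: "g \<in> borel_measurable borel" "\<And>\<eta>. \<bar>g \<eta>\<bar> \<le> b" "depends_only_on g (sup_ball L)"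
      "(\<integral>\<eta>. g \<eta> \<partial>\<mu>) = 0"
    proof -
      show "g \<in> borel_measurable borel"
        unfolding g_def[abs_def] using f(1) by simp
      show "\<bar>g \<eta>\<bar> \<le> b" for \<eta>
        using b0[of \<eta>] mean_le by (simp add: g_def b_def)
      show "depends_only_on g (sup_ball L)"
        using f(3) A unfolding depends_only_on_def g_def by (metis subsetD)
      show "(\<integral>\<eta>. g \<eta> \<partial>\<mu>) = 0"
        using integrable(1)[OF \<mu>_prob] by (simp add: g_def \<mu>.prob_space)
    qed
    have "b \<ge> 0"
      using order_trans[OF abs_ge_zero g(2)] .
    have "relax.rate \<ge> 0"
      using \<epsilon>' by (simp add: relax.rate_def)
    define K where "K = b * (relax.rate + (1 + exp 1)) + b * exp (\<theta>' * (4 * L))"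
    have "\<bar>(\<integral>\<eta>. f (translate x \<eta>) \<partial>\<mu>\<^sub>\<epsilon>) - (\<integral>\<eta>. f \<eta> \<partial>\<mu>)\<bar> \<le> K * exp (- \<theta>' * norm_inf x)" for x
    proof -
      define \<xi> where "\<xi> = norm_inf x"
      have "\<xi> \<ge> 0"
        by (simp add: \<xi>_def norm_inf_nonneg)
      have g_x: "(\<lambda>\<eta>. g (translate x \<eta>)) \<in> borel_measurable borel"
        using translate_measurable g(1) by (rule measurable_compose)
      have eq: "(\<integral>\<eta>. f (translate x \<eta>) \<partial>\<mu>\<^sub>\<epsilon>) - (\<integral>\<eta>. f \<eta> \<partial>\<mu>) = (\<integral>\<eta>. g (translate x \<eta>) \<partial>\<mu>\<^sub>\<epsilon>)"
        using integrable(2)[OF \<mu>\<^sub>\<epsilon>_prob] by (simp add: g_def \<mu>\<^sub>\<epsilon>.prob_space)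
      let ?e = "exp (- \<theta>' * \<xi>)" and ?Y = "seen_from X\<^sub>\<epsilon> \<sigma>"
      have "\<bar>\<integral>\<eta>. g (translate x \<eta>) \<partial>\<mu>\<^sub>\<epsilon>\<bar> \<le> K * ?e"
      proof (cases "\<xi> \<ge> 4 * L")
        case True
        define t where "t = \<tau> * \<xi>"
        have "t \<ge> 0"
          using \<open>\<tau> > 0\<close> \<open>\<xi> \<ge> 0\<close> by (simp add: t_def)
        obtain n where n: "C * t \<le> \<xi> - 2 * real n * R - L"
          "exp (- \<theta> * (\<xi> - 2 * real n * R - L)) * exp (walk.speed_bound * t) +
            (walk.speed_bound * t) ^ n / fact n \<le> (1 + exp 1) * ?e"
          "exp (- (\<gamma> - \<epsilon>') * t) \<le> ?e"
          using scales[OF \<open>L \<ge> 0\<close> True] unfolding t_def by blast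
        have "\<bar>(\<integral>w. g (translate x (?Y t w)) \<partial>walk.Q) - (\<integral>\<eta>. g (translate x \<eta>) \<partial>\<mu>\<^sub>\<epsilon>)\<bar>
            \<le> relax.rate * exp (- (\<gamma> - \<epsilon>') * t) * b"
          unfolding walk.Q_def by (rule relax.relaxation[OF \<open>t \<ge> 0\<close> g_x g(2)])
        also have "\<dots> \<le> relax.rate * ?e * b"
          using n(3) \<open>relax.rate \<ge> 0\<close> \<open>b \<ge> 0\<close> by (intro mult_right_mono mult_left_mono)
        finally have relaxed: "\<bar>(\<integral>w. g (translate x (?Y t w)) \<partial>walk.Q) - (\<integral>\<eta>. g (translate x \<eta>) \<partial>\<mu>\<^sub>\<epsilon>)\<bar>
            \<le> relax.rate * ?e * b" .
        have "\<bar>\<integral>w. g (translate x (?Y t w)) \<partial>walk.Q\<bar> \<le>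
            b * (exp (- \<theta> * (norm_inf x - 2 * real n * R - L)) * exp (walk.speed_bound * t) +
              (walk.speed_bound * t) ^ n / fact n)"
          using n(1) unfolding \<xi>_def
          by (intro walk.far_observable_decorrelates[OF env_stationary shift decorrelation[OF \<open>t \<ge> 0\<close>]
                \<open>\<theta> > 0\<close> \<open>C > 0\<close> \<open>t \<ge> 0\<close> \<open>L \<ge> 0\<close> g])
        also have "\<dots> \<le> b * ((1 + exp 1) * ?e)"
          using n(2) \<open>b \<ge> 0\<close> unfolding \<xi>_def by (intro mult_left_mono)
        finally have "\<bar>\<integral>\<eta>. g (translate x \<eta>) \<partial>\<mu>\<^sub>\<epsilon>\<bar> \<le> b * (relax.rate + (1 + exp 1)) * ?e"
          using relaxed by (simp add: algebra_simps)
        also have "\<dots> \<le> K * ?e"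
          using \<open>b \<ge> 0\<close> by (intro mult_right_mono) (auto simp: K_def)
        finally show ?thesis .
      next
        case False
        have "\<bar>\<integral>\<eta>. g (translate x \<eta>) \<partial>\<mu>\<^sub>\<epsilon>\<bar> \<le> b"
          using integrable(2)[OF \<mu>\<^sub>\<epsilon>_prob] g(2) by (intro \<mu>\<^sub>\<epsilon>.abs_integral_le) (auto simp: g_def)
        also have "b \<le> b * exp (\<theta>' * (4 * L) - \<theta>' * \<xi>)"
        proof -
          have "\<theta>' * \<xi> \<le> \<theta>' * (4 * L)"
            using False \<open>\<theta>' > 0\<close> by (intro mult_left_mono) auto
          then have "1 \<le> exp (\<theta>' * (4 * L) - \<theta>' * \<xi>)"
            by simp
          then show ?thesis
            using \<open>b \<ge> 0\<close> mult_left_mono[of 1 "exp (\<theta>' * (4 * L) - \<theta>' * \<xi>)" b] by simp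
        qed
        also have "\<dots> = b * exp (\<theta>' * (4 * L)) * ?e"
          by (simp add: exp_add[symmetric])
        also have "\<dots> \<le> K * ?e"
          using \<open>b \<ge> 0\<close> \<open>relax.rate \<ge> 0\<close> by (intro mult_right_mono) (auto simp: K_def)
        finally show ?thesis .
      qed
      then show ?thesis
        unfolding eq by (simp add: \<xi>_def)
    qed
    then show "\<exists>C. \<forall>x. \<bar>(\<integral>\<eta>. f (translate x \<eta>) \<partial>\<mu>\<^sub>\<epsilon>) - (\<integral>\<eta>. f \<eta> \<partial>\<mu>)\<bar> \<le> C * exp (- \<theta>' * norm_inf x)"
      by blast
  qed
qed

end
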